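(* Let $\mathcal{M}$ and $\mathcal{N}$ be diffeological étale manifolds of dimensions $m$ and $n$, respectively, and let $f:\mathcal{M}\to\mathcal{N}$ be a smooth map with constant internal rank $k$. Then for each $x\in\mathcal{M}$ there exist diffeological étale maps $\varphi:U\to\mathcal{M}$ and $\psi:V\to\mathcal{N}$, defined on an $m$-domain $U$ and an $n$-domain $V$ respectively, with $x\in\varphi(U)$ and $f(x)\in\psi(V)$, such that $f\circ\varphi=\psi\circ\widehat{F}$, where $\widehat{F}:U\to V$ has the form $$\widehat{F}(x_1,\dots,x_k,x_{k+1},\dots,x_m)=(x_1,\dots,x_k,0,\dots,0).$$
   Context: An $n$-domain is an open subset of $\mathbb{R}^n$; a domain is an $n$-domain for some $n\ge 0$. A parametrization in a set $X$ is a map from a domain to $X$. A diffeology on $X$ is a set $\mathcal{D}$ of parametrizations in $X$ such that: (D1) the images of the elements of $\mathcal{D}$ cover $X$; (D2) $P\circ F\in\mathcal{D}$ for every $P:U\to X$ in $\mathcal{D}$ and every smooth map $F:V\to U$ between domains; (D3) if a family of $n$-parametrizations $P_i:U_i\to X$ in $\mathcal{D}$ agree on overlaps, their common extension to $\bigcup_i U_i$ is in $\mathcal{D}$. A diffeological space is a set with a diffeology, whose elements are called plots. A map $f:X\to Y$ is smooth if $f\circ P$ is a plot in $Y$ for every plot $P$ in $X$; a diffeomorphism is a smooth bijection with smooth inverse. A subset of $X$ is D-open if its preimage under every plot is open. Subsets carry the subspace diffeology (plots with values in the subset), and the plots of a product are the tuples of plots. Domains carry their usual smooth parametrizations as plots.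 For smooth maps $f:X\to Y$ and $g:Z\to Y$, the pullback of $f$ by $g$ is $g^*f:g^*X\to Z$, $(z,x)\mapsto z$, where $g^*X=\{(z,x)\in Z\times X: g(z)=f(x)\}$. Internal tangent space: for $x\in X$, consider the category whose objects are the plots $P:U\to X$ with $0\in U$ and $P(0)=x$ (plots centered at $x$), and whose morphisms from $Q:V\to X$ to $P:U\to X$ are the germs at $0$ of smooth maps $F:W\to U$, $W\subseteq V$ an open neighborhood of $0$, with $F(0)=0$ and $Q|_W=P\circ F$. The internal tangent space $T_xX$ is the colimit in real vector spaces of the functor sending $P:U\to X$ to $T_0U$ and the germ of $F$ to $dF_0$; write $dP_0:T_0U\to T_xX$ for the structure maps. For smooth $f:X\to Y$, the internal tangent map $df_x:T_xX\to T_{f(x)}Y$ is the unique linear map with $df_x\circ dP_0=d(f\circ P)_0$ for every plot $P$ centered at $x$. A smooth map $f:X\to Y$ has constant internal rank $k$ if $df_x$ has rank $k$ at each point $x\in X$. Étale map: a map $f:X\to Y$ such that every $x_0\in X$ has a D-open neighborhood $O\subseteq X$, and $f(x_0)$ a D-open neighborhood $O'\subseteq Y$, with $f|_O:O\to O'$ a diffeomorphism. Diffeological étale map: a smooth map whose pullback by every plot in the target is étale. Diffeological étale $n$-manifold (diffeological étale manifold of dimension $n$): a diffeological space $\mathcal{M}$ admitting a family of diffeological étale maps from $n$-domains into $\mathcal{M}$ (diffeological étale charts) whose images cover $\mathcal{M}$. *)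

theory Defs
  imports
    "HOL-Analysis.Analysis"
    "HOL-Algebra.AbelCoset"
    "Jordan_Normal_Form.Missing_VectorSpace"
begin

section \<open>Smooth maps between domains\<close>

text \<open>
  The dimension of a domain varies inside the definitions below, so \<open>\<real>\<^sup>n\<close> is the library's
  \<^const>\<open>Euclidean_space\<close>: the sequences \<^typ>\<open>nat \<Rightarrow> real\<close> vanishing from index \<open>n\<close> on, with
  the coordinates numbered \<open>0, \<dots>, n - 1\<close>.  An \<open>n\<close>-domain is a set \<open>U\<close> with
  \<open>openin (Euclidean_space n) U\<close>.
\<close>

type_synonym rvec = "nat \<Rightarrow> real"

abbreviation origin :: rvec where
  "origin \<equiv> (\<lambda>_. 0)"

definition partial_deriv :: "nat \<Rightarrow> (rvec \<Rightarrow> real) \<Rightarrow> rvec \<Rightarrow> real" where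
  "partial_deriv i f x = deriv (\<lambda>t. f (x(i := t))) (x i)"

text \<open>\<open>Ck_on k n U f\<close>: on the \<open>n\<close>-domain \<open>U\<close>, all partial derivatives of \<open>f\<close> of order at most
  \<open>k\<close> exist and are continuous.  (The topology of \<^typ>\<open>nat \<Rightarrow> real\<close> used by
  \<^const>\<open>continuous_on\<close> is the product topology, which induces that of
  \<^const>\<open>Euclidean_space\<close>.)\<close>

primrec Ck_on :: "nat \<Rightarrow> nat \<Rightarrow> rvec set \<Rightarrow> (rvec \<Rightarrow> real) \<Rightarrow> bool" where
  "Ck_on 0 n U f \<longleftrightarrow> continuous_on U f"
| "Ck_on (Suc k) n U f \<longleftrightarrow> continuous_on U f \<and>
     (\<forall>i<n. (\<forall>x\<in>U. (\<lambda>t. f (x(i := t))) differentiable at (x i)) \<and>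
            Ck_on k n U (partial_deriv i f))"

definition smooth_between ::
    "nat \<Rightarrow> rvec set \<Rightarrow> nat \<Rightarrow> rvec set \<Rightarrow> (rvec \<Rightarrow> rvec) \<Rightarrow> bool" where
  "smooth_between m V n U F \<longleftrightarrow>
     openin (Euclidean_space m) V \<and> openin (Euclidean_space n) U \<and>
     F \<in> V \<rightarrow> U \<and> (\<forall>j<n. \<forall>k. Ck_on k m V (\<lambda>x. F x j))"

definition differential :: "nat \<Rightarrow> nat \<Rightarrow> (rvec \<Rightarrow> rvec) \<Rightarrow> rvec \<Rightarrow> rvec \<Rightarrow> rvec" where
  "differential m n F a v =
     (\<lambda>j. if j < n then \<Sum>i<m. partial_deriv i (\<lambda>x. F x j) a * v i else 0)"


section \<open>Diffeological spaces\<close>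

text \<open>A parametrization \<open>P : U \<rightarrow> X\<close> on an \<open>n\<close>-domain is the triple \<open>(n, U, P)\<close> with \<open>P\<close>
  extensional, so that equal maps are equal triples.  The dimension is part of the data because
  the empty set is an \<open>n\<close>-domain for every \<open>n\<close>.\<close>

type_synonym 'a param = "nat \<times> rvec set \<times> (rvec \<Rightarrow> 'a)"

definition parametrizations :: "'a set \<Rightarrow> 'a param set" where
  "parametrizations X = {(n, U, P). openin (Euclidean_space n) U \<and> P \<in> U \<rightarrow>\<^sub>E X}"

record 'a dspace =
  points :: "'a set"
  plots :: "'a param set"

definition diffeological_space :: "'a dspace \<Rightarrow> bool" where
  "diffeological_space X \<longleftrightarrow>
     plots X \<subseteq> parametrizations (points X) \<and>
     (\<Union>(n, U, P)\<in>plots X. P ` U) = points X \<and>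
     (\<forall>n U P m V F. (n, U, P) \<in> plots X \<longrightarrow> smooth_between m V n U F \<longrightarrow>
        (m, V, compose V P F) \<in> plots X) \<and>
     (\<forall>n \<F> R. (\<forall>(U, P)\<in>\<F>. (n, U, P) \<in> plots X) \<longrightarrow>
        (\<forall>(U, P)\<in>\<F>. \<forall>(V, Q)\<in>\<F>. \<forall>x\<in>U \<inter> V. P x = Q x) \<longrightarrow>
        R \<in> extensional (\<Union>(U, P)\<in>\<F>. U) \<longrightarrow>
        (\<forall>(U, P)\<in>\<F>. \<forall>x\<in>U. R x = P x) \<longrightarrow>
        (n, \<Union>(U, P)\<in>\<F>. U, R) \<in> plots X)"

definition smooth :: "'a dspace \<Rightarrow> 'b dspace \<Rightarrow> ('a \<Rightarrow> 'b) \<Rightarrow> bool" where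
  "smooth X Y f \<longleftrightarrow> f \<in> points X \<rightarrow> points Y \<and>
     (\<forall>(n, U, P)\<in>plots X. (n, U, compose U f P) \<in> plots Y)"

definition diffeomorphism :: "'a dspace \<Rightarrow> 'b dspace \<Rightarrow> ('a \<Rightarrow> 'b) \<Rightarrow> bool" where
  "diffeomorphism X Y f \<longleftrightarrow> smooth X Y f \<and> bij_betw f (points X) (points Y) \<and>
     smooth Y X (inv_into (points X) f)"

definition D_open :: "'a dspace \<Rightarrow> 'a set \<Rightarrow> bool" where
  "D_open X A \<longleftrightarrow> A \<subseteq> points X \<and>
     (\<forall>(n, U, P)\<in>plots X. openin (Euclidean_space n) {u \<in> U. P u \<in> A})"

definition dsubspace :: "'a dspace \<Rightarrow> 'a set \<Rightarrow> 'a dspace" where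
  "dsubspace X A = \<lparr>points = A, plots = {(n, U, P) \<in> plots X. P ` U \<subseteq> A}\<rparr>"

definition dproduct :: "'a dspace \<Rightarrow> 'b dspace \<Rightarrow> ('a \<times> 'b) dspace" where
  "dproduct X Y =
     \<lparr>points = points X \<times> points Y,
      plots = {(n, U, R). R \<in> extensional U \<and>
        (n, U, compose U fst R) \<in> plots X \<and> (n, U, compose U snd R) \<in> plots Y}\<rparr>"

definition domain_space :: "nat \<Rightarrow> rvec set \<Rightarrow> rvec dspace" where
  "domain_space n U =
     \<lparr>points = U,
      plots = {(m, V, F). F \<in> extensional V \<and> smooth_between m V n U F}\<rparr>"

text \<open>The space \<open>g\<^sup>*X\<close>; the pullback map \<open>g\<^sup>*f\<close> on it is \<^const>\<open>fst\<close>.\<close>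

definition dpullback ::
    "'a dspace \<Rightarrow> 'c dspace \<Rightarrow> ('a \<Rightarrow> 'b) \<Rightarrow> ('c \<Rightarrow> 'b) \<Rightarrow> ('c \<times> 'a) dspace" where
  "dpullback X Z f g =
     dsubspace (dproduct Z X) {(z, x). z \<in> points Z \<and> x \<in> points X \<and> g z = f x}"


section \<open>Etale maps and etale manifolds\<close>

definition etale :: "'a dspace \<Rightarrow> 'b dspace \<Rightarrow> ('a \<Rightarrow> 'b) \<Rightarrow> bool" where
  "etale X Y f \<longleftrightarrow> f \<in> points X \<rightarrow> points Y \<and>
     (\<forall>x\<in>points X. \<exists>A B. D_open X A \<and> x \<in> A \<and> D_open Y B \<and> f x \<in> B \<and>
        diffeomorphism (dsubspace X A) (dsubspace Y B) f)"

definition diffeological_etale :: "'a dspace \<Rightarrow> 'b dspace \<Rightarrow> ('a \<Rightarrow> 'b) \<Rightarrow> bool" where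
  "diffeological_etale X Y f \<longleftrightarrow> smooth X Y f \<and>
     (\<forall>(n, U, P)\<in>plots Y.
        etale (dpullback X (domain_space n U) f P) (domain_space n U) fst)"

definition diffeological_etale_manifold :: "nat \<Rightarrow> 'a dspace \<Rightarrow> bool" where
  "diffeological_etale_manifold n M \<longleftrightarrow> diffeological_space M \<and>
     (\<exists>\<A>. (\<forall>(U, \<phi>)\<in>\<A>. openin (Euclidean_space n) U \<and>
                diffeological_etale (domain_space n U) M \<phi>) \<and>
           (\<Union>(U, \<phi>)\<in>\<A>. \<phi> ` U) = points M)"


section \<open>Internal tangent spaces\<close>

text \<open>Real vector spaces with explicit carrier are modules in the sense of \<open>HOL-Algebra\<close> over
  \<open>real_ring\<close>.  The ring multiplication and unit that the record type of modules inherits play no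
  role for modules; they are given dummy values.\<close>

abbreviation real_ring :: "real ring" where
  "real_ring \<equiv> \<lparr>carrier = UNIV, mult = (*), one = 1, zero = 0, add = (+)\<rparr>"

definition quotient_module ::
    "('r, 'v, 'e) module_scheme \<Rightarrow> 'v set \<Rightarrow> ('r, 'v set) module" where
  "quotient_module M N =
     \<lparr>carrier = a_rcosets\<^bsub>M\<^esub> N, mult = (\<lambda>_ _. N), one = N, zero = N,
      add = (\<lambda>A B. A <+>\<^bsub>M\<^esub> B),
      smult = (\<lambda>r A. \<Union>a\<in>A. N +>\<^bsub>M\<^esub> (r \<odot>\<^bsub>M\<^esub> a))\<rparr>"

definition centered_plots :: "'a dspace \<Rightarrow> 'a \<Rightarrow> 'a param set" where
  "centered_plots X x = {(n, U, P) \<in> plots X. origin \<in> U \<and> P origin = x}"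

text \<open>The colimit is the quotient of the direct sum of the spaces \<open>T\<^sub>0U = \<real>\<^sup>n\<close>, taken over all plots
  \<open>(n, U, P)\<close> centered at \<open>x\<close>, by the span of the elements \<open>\<iota>\<^sub>Q(v) - \<iota>\<^sub>P(dF\<^sub>0(v))\<close> for the
  morphisms \<open>F\<close> from \<open>Q\<close> to \<open>P\<close>; these depend on the germ of \<open>F\<close> at the origin only.\<close>

definition tangent_sum :: "'a dspace \<Rightarrow> 'a \<Rightarrow> (real, 'a param \<Rightarrow> rvec) module" where
  "tangent_sum X x =
     \<lparr>carrier = {c. finite {p. c p \<noteq> origin} \<and>
        (\<forall>p. p \<notin> centered_plots X x \<longrightarrow> c p = origin) \<and>
        (\<forall>n U P. c (n, U, P) \<in> topspace (Euclidean_space n))},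
      mult = (\<lambda>_ _ _ _. 0), one = (\<lambda>_ _. 0), zero = (\<lambda>_ _. 0),
      add = (\<lambda>c d p i. c p i + d p i),
      smult = (\<lambda>r c p i. r * c p i)\<rparr>"

definition tangent_inj :: "'a param \<Rightarrow> rvec \<Rightarrow> 'a param \<Rightarrow> rvec" where
  "tangent_inj p v = (\<lambda>q. if q = p then v else origin)"

definition plot_morphism :: "'a param \<Rightarrow> 'a param \<Rightarrow> rvec set \<Rightarrow> (rvec \<Rightarrow> rvec) \<Rightarrow> bool" where
  "plot_morphism = (\<lambda>(m, V, Q) (n, U, P) W F.
     W \<subseteq> V \<and> origin \<in> W \<and> smooth_between m W n U F \<and> F origin = origin \<and>
     (\<forall>w\<in>W. Q w = P (F w)))"

definition tangent_relators :: "'a dspace \<Rightarrow> 'a \<Rightarrow> ('a param \<Rightarrow> rvec) set" where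
  "tangent_relators X x =
     {\<lambda>p i. tangent_inj (m, V, Q) v p i -
            tangent_inj (n, U, P) (differential m n F origin v) p i
      | m V Q n U P W F v.
        (m, V, Q) \<in> centered_plots X x \<and> (n, U, P) \<in> centered_plots X x \<and>
        plot_morphism (m, V, Q) (n, U, P) W F \<and> v \<in> topspace (Euclidean_space m)}"

definition tangent_kernel :: "'a dspace \<Rightarrow> 'a \<Rightarrow> ('a param \<Rightarrow> rvec) set" where
  "tangent_kernel X x =
     LinearCombinations.module.span real_ring (tangent_sum X x) (tangent_relators X x)"

definition internal_tangent_space ::
    "'a dspace \<Rightarrow> 'a \<Rightarrow> (real, ('a param \<Rightarrow> rvec) set) module" where
  "internal_tangent_space X x = quotient_module (tangent_sum X x) (tangent_kernel X x)"

text \<open>The structure map \<open>dP\<^sub>0\<close> of the plot \<open>p\<close>.\<close>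

definition plot_differential ::
    "'a dspace \<Rightarrow> 'a \<Rightarrow> 'a param \<Rightarrow> rvec \<Rightarrow> ('a param \<Rightarrow> rvec) set" where
  "plot_differential X x p v = tangent_kernel X x +>\<^bsub>tangent_sum X x\<^esub> tangent_inj p v"

definition internal_tangent_map ::
    "'a dspace \<Rightarrow> 'b dspace \<Rightarrow> ('a \<Rightarrow> 'b) \<Rightarrow> 'a \<Rightarrow>
     ('a param \<Rightarrow> rvec) set \<Rightarrow> ('b param \<Rightarrow> rvec) set" where
  "internal_tangent_map X Y f x =
     (THE L. L \<in> extensional (carrier (internal_tangent_space X x)) \<and>
        L \<in> module_hom real_ring (internal_tangent_space X x) (internal_tangent_space Y (f x)) \<and>
        (\<forall>n U P. (n, U, P) \<in> centered_plots X x \<longrightarrow>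
           (\<forall>v\<in>topspace (Euclidean_space n).
              L (plot_differential X x (n, U, P) v) =
              plot_differential Y (f x) (n, U, compose U f P) v)))"

text \<open>For an infinite-dimensional space \<^const>\<open>vectorspace.dim\<close> is unspecified, hence the
  separate requirement of finite dimension.\<close>

definition has_rank ::
    "(real, 'v) module \<Rightarrow> (real, 'w) module \<Rightarrow> ('v \<Rightarrow> 'w) \<Rightarrow> nat \<Rightarrow> bool" where
  "has_rank V W L k \<longleftrightarrow>
     vectorspace.fin_dim real_ring (W\<lparr>carrier := L ` carrier V\<rparr>) \<and>
     vectorspace.dim real_ring (W\<lparr>carrier := L ` carrier V\<rparr>) = k"

definition constant_internal_rank ::
    "'a dspace \<Rightarrow> 'b dspace \<Rightarrow> ('a \<Rightarrow> 'b) \<Rightarrow> nat \<Rightarrow> bool" where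
  "constant_internal_rank X Y f k \<longleftrightarrow>
     (\<forall>x\<in>points X.
        has_rank (internal_tangent_space X x) (internal_tangent_space Y (f x))
          (internal_tangent_map X Y f x) k)"

end

theory Submission
  imports Defs
begin

text \<open>
  A diffeological etale map \<open>\<phi>\<close> from a domain is one through which every plot lifts locally, uniquely once a
  point above is chosen.  Lifting \<open>f \<circ> \<phi>\<close> through a chart of the target represents \<open>f\<close> by a smooth map
  \<open>F\<close> between domains, and an etale chart identifies the internal tangent space with \<open>\<real>\<^sup>m\<close> by sending
  the class of a vector along a plot to its image under the differential of the lift; so \<open>F\<close> has constant
  rank \<open>k\<close>.  The classical rank theorem then follows one coordinate at a time: while \<open>F\<close> preserves only
  \<open>j < k\<close> coordinates, some further component of \<open>F\<close> has a nonzero partial derivative in a direction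
  \<open>b \<ge> j\<close>, and it can replace the \<open>b\<close>-th coordinate.  When \<open>j = k\<close> the remaining components depend on
  the first \<open>k\<close> coordinates only and are removed by a shear of the target.
\<close>

section \<open>Cubes and the topology of Euclidean space\<close>

text \<open>The dimension of a domain is a number and not a type, so all calculus here concerns real
  functions on sets of sequences and rests on one-variable derivatives. This is why the inverse
  function theorem enters only for maps that change a single coordinate: there, strict monotonicity
  and the intermediate value theorem produce the inverse. An etale chart need not be locally
  injective, so there is no expression of \<open>f\<close> through an inverse of
  \<open>\<psi>\<close>. \<open>F\<close> is a chosen lift, and each change of coordinates has to be
  shown to preserve the lifting property. The rank hypothesis is used twice, in opposite directions.
  At the one point above \<open>x\<close> it forbids that too few directions matter, which allows
  the next coordinate to be straightened. Once \<open>k\<close> coordinates are straight it forbids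
  \<open>k + 1\<close> independent columns, and this is needed at every point of the domain: only
  there does it matter that the rank is constant.\<close>

abbreviation rspace :: "nat \<Rightarrow> rvec set" where
  "rspace n \<equiv> topspace (Euclidean_space n)"

abbreviation openE :: "nat \<Rightarrow> rvec set \<Rightarrow> bool" where
  "openE n \<equiv> openin (Euclidean_space n)"

text \<open>Cubes serve as basic neighborhoods because a coordinate can be moved on its own without
  leaving them, as arguments with partial derivatives require. For \<open>n = 0\<close> a cube is
  the origin alone, whatever \<open>d\<close> is.\<close>

definition cube :: "nat \<Rightarrow> rvec \<Rightarrow> real \<Rightarrow> rvec set" where
  "cube n x d = {y \<in> rspace n. \<forall>i<n. \<bar>y i - x i\<bar> < d}"

lemma rspace_iff: "x \<in> rspace n \<longleftrightarrow> (\<forall>i\<ge>n. x i = 0)"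
  by (simp add: topspace_Euclidean_space)

lemma openE_subset: "openE n U \<Longrightarrow> U \<subseteq> rspace n"
  by (rule openin_subset)

lemma openE_open: "openE n U \<longleftrightarrow> (\<exists>T. open T \<and> U = T \<inter> rspace n)"
  by (auto simp: Euclidean_space_def openin_subtopology euclidean_product_topology)

lemma cube_subset: "d \<le> e \<Longrightarrow> cube n x d \<subseteq> cube n x e"
  by (force simp: cube_def)

lemma cube_self [simp]: "x \<in> rspace n \<Longrightarrow> 0 < d \<Longrightarrow> x \<in> cube n x d"
  by (simp add: cube_def)

lemma cube_rspace: "y \<in> cube n x d \<Longrightarrow> y \<in> rspace n"
  by (simp add: cube_def)

lemma openE_cube [simp]: "openE n (cube n x d)"
proof -
  have "open {f :: rvec. \<forall>i\<in>{..<n}. f i \<in> {t. \<bar>t - x i\<bar> < d}}"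
  proof (rule product_topology_basis')
    show "open {t. \<bar>t - x i\<bar> < d}" for i
      by (intro open_Collect_less continuous_intros)
  qed simp
  moreover have "cube n x d = {f :: rvec. \<forall>i\<in>{..<n}. f i \<in> {t. \<bar>t - x i\<bar> < d}} \<inter> rspace n"
    by (auto simp: cube_def)
  ultimately show ?thesis
    unfolding openE_open by blast
qed

text \<open>A basic open set of the product topology restricts coordinates that may lie beyond
  \<open>n\<close>; on \<open>rspace n\<close> these vanish, so only the first \<open>n\<close>
  intervals count and their radii have a positive minimum.\<close>

lemma openE_iff_cube:
  "openE n U \<longleftrightarrow> U \<subseteq> rspace n \<and> (\<forall>x\<in>U. \<exists>d>0. cube n x d \<subseteq> U)"
proof
  assume U: "openE n U"
  then obtain T where T: "open T" "U = T \<inter> rspace n"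
    unfolding openE_open by blast
  have "\<exists>d>0. cube n x d \<subseteq> U" if x: "x \<in> U" for x
  proof -
    have "openin (product_topology (\<lambda>i. euclidean) UNIV) T"
      using T(1) by (simp add: euclidean_product_topology)
    with x T(2) obtain X where X: "\<And>i. open (X i)" "x \<in> Pi\<^sub>E UNIV X" "Pi\<^sub>E UNIV X \<subseteq> T"
      unfolding openin_product_topology_alt by (metis IntD1 UNIV_I open_openin)
    have "\<exists>d>0. \<forall>t. \<bar>t - x i\<bar> < d \<longrightarrow> t \<in> X i" for i
    proof -
      have "x i \<in> X i"
        using X(2) by auto
      then show ?thesis
        using X(1)[of i] unfolding open_dist dist_real_def by blast
    qed
    then obtain d where d: "\<And>i. d i > 0" "\<And>i t. \<bar>t - x i\<bar> < d i \<Longrightarrow> t \<in> X i"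
      by metis
    \<comment> \<open>The entry \<open>1\<close> keeps the minimum defined when
      \<open>n = 0\<close>.\<close>
    define e where "e = Min (insert 1 (d ` {..<n}))"
    have e: "e > 0"
      unfolding e_def using d(1) by (subst Min_gr_iff) auto
    have "cube n x e \<subseteq> U"
    proof
      fix y assume y: "y \<in> cube n x e"
      have "y i \<in> X i" for i
      proof (cases "i < n")
        case True
        then have "e \<le> d i"
          unfolding e_def by (intro Min_le) auto
        with y True have "\<bar>y i - x i\<bar> < d i"
          by (force simp: cube_def)
        then show ?thesis
          by (rule d(2))
      next
        case False
        then have "y i = x i"
          using y x openE_subset[OF U] by (auto simp: cube_def rspace_iff subset_iff)
        then show ?thesis
          using d(1)[of i] d(2)[where i = i and t = "x i"] by simp
      qed
      then show "y \<in> U"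
        using X(3) T(2) y by (auto simp: cube_def PiE_def extensional_def)
    qed
    with e show ?thesis by blast
  qed
  then show "U \<subseteq> rspace n \<and> (\<forall>x\<in>U. \<exists>d>0. cube n x d \<subseteq> U)"
    using openE_subset[OF U] by blast
next
  assume U: "U \<subseteq> rspace n \<and> (\<forall>x\<in>U. \<exists>d>0. cube n x d \<subseteq> U)"
  have "\<exists>T. openE n T \<and> x \<in> T \<and> T \<subseteq> U" if "x \<in> U" for x
    using U that by (meson cube_self in_mono openE_cube)
  then show "openE n U"
    by (subst openin_subopen) blast
qed

lemma openE_cubeE:
  assumes "openE n U" "x \<in> U"
  obtains d where "d > 0" "cube n x d \<subseteq> U"
  using assms openE_iff_cube by blast

lemma openE_Int_open: "openE n U \<Longrightarrow> open T \<Longrightarrow> openE n (U \<inter> T)"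
  unfolding openE_open by (metis Int_assoc Int_commute open_Int)

lemma openE_vimage:
  assumes "openE m U" "continuous_on U f" "f ` U \<subseteq> rspace n" "openE n V"
  shows "openE m {x \<in> U. f x \<in> V}"
proof -
  obtain T where T: "open T" "V = T \<inter> rspace n"
    using assms(4) openE_open by blast
  obtain A where A: "open A" "A \<inter> U = f -` T \<inter> U"
    using assms(2) T(1) continuous_on_open_invariant by metis
  have "{x \<in> U. f x \<in> V} = U \<inter> A"
    using T A(2) assms(3) by auto
  then show ?thesis
    using openE_Int_open[OF assms(1) A(1)] by simp
qed

lemma continuous_on_rspace_iff:
  assumes "U \<subseteq> rspace n" "f ` U \<subseteq> rspace k"
  shows "continuous_on U f \<longleftrightarrow> (\<forall>j<k. continuous_on U (\<lambda>x. f x j))"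
proof
  assume R: "\<forall>j<k. continuous_on U (\<lambda>x. f x j)"
  have "continuous_on U (\<lambda>x. f x j)" for j
  proof (cases "j < k")
    case False
    then have "f x j = 0" if "x \<in> U" for x
      using assms(2) that by (auto simp: rspace_iff image_subset_iff)
    then show ?thesis
      by (subst continuous_on_cong[OF refl, where g = "\<lambda>_. 0"]) auto
  qed (use R in simp)
  then show "continuous_on U f"
    by (rule continuous_on_coordinatewise_then_product)
qed (auto intro: continuous_on_product_then_coordinatewise)

lemma continuous_on_cube_iff:
  fixes f :: "rvec \<Rightarrow> real"
  assumes "openE n U"
  shows "continuous_on U f \<longleftrightarrow>
    (\<forall>x\<in>U. \<forall>e>0. \<exists>d>0. cube n x d \<subseteq> U \<and> (\<forall>y\<in>cube n x d. \<bar>f y - f x\<bar> < e))"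
    (is "?L \<longleftrightarrow> ?R")
proof
  assume L: ?L
  show ?R
  proof (intro ballI allI impI)
    fix x and e :: real assume x: "x \<in> U" "e > 0"
    obtain A where A: "open A" "A \<inter> U = f -` ball (f x) e \<inter> U"
      using L continuous_on_open_invariant open_ball by metis
    have "openE n (U \<inter> A)"
      by (rule openE_Int_open[OF assms A(1)])
    moreover have "x \<in> U \<inter> A"
      using A(2) x by auto
    ultimately obtain d where "d > 0" "cube n x d \<subseteq> U \<inter> A"
      by (rule openE_cubeE)
    moreover have "\<bar>f y - f x\<bar> < e" if "y \<in> U \<inter> A" for y
    proof -
      have "f y \<in> ball (f x) e"
        using A(2) that by blast
      then show ?thesis
        by (simp add: dist_real_def abs_minus_commute)
    qed
    ultimately show "\<exists>d>0. cube n x d \<subseteq> U \<and> (\<forall>y\<in>cube n x d. \<bar>f y - f x\<bar> < e)"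
      by (meson Int_lower1 subset_iff)
  qed
next
  assume R: ?R
  show ?L
    unfolding continuous_on_topological
  proof (intro ballI allI impI)
    fix x B assume x: "x \<in> U" and B: "open B" "f x \<in> B"
    obtain e where e: "e > 0" "ball (f x) e \<subseteq> B"
      using B open_contains_ball by blast
    obtain d where d: "d > 0" "cube n x d \<subseteq> U" "\<forall>y\<in>cube n x d. \<bar>f y - f x\<bar> < e"
      using R[THEN bspec, OF x, THEN spec, THEN mp, OF e(1)] by (elim exE conjE) (rule that)
    obtain T where T: "open T" "cube n x d = T \<inter> rspace n"
      using openE_cube[of n x d] unfolding openE_open by blast
    have "x \<in> T"
      using T(2) cube_self[of x n d] x openE_subset[OF assms] d by auto
    moreover have "f y \<in> B" if "y \<in> U" "y \<in> T" for y
    proof -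
      have "y \<in> cube n x d"
        using that T(2) openE_subset[OF assms] by blast
      then have "\<bar>f y - f x\<bar> < e"
        using d(3) by blast
      then have "f y \<in> ball (f x) e"
        by (simp add: dist_real_def)
      then show ?thesis
        using e(2) by blast
    qed
    ultimately show "\<exists>A. open A \<and> x \<in> A \<and> (\<forall>y\<in>U. y \<in> A \<longrightarrow> f y \<in> B)"
      using T(1) by blast
  qed
qed

lemma eventually_cube:
  assumes "\<And>j. j < n \<Longrightarrow> ((\<lambda>t. c t j) \<longlongrightarrow> x j) F" "eventually (\<lambda>t. c t \<in> rspace n) F" "d > 0"
  shows "eventually (\<lambda>t. c t \<in> cube n x d) F"
proof -
  have "eventually (\<lambda>t. \<forall>j\<in>{..<n}. \<bar>c t j - x j\<bar> < d) F"
    using tendstoD[OF assms(1) assms(3)]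
    by (intro eventually_ball_finite) (auto simp: dist_real_def)
  with assms(2) show ?thesis
    by eventually_elim (auto simp: cube_def)
qed

lemma rspace_upd: "x \<in> rspace n \<Longrightarrow> i < n \<Longrightarrow> x(i := t) \<in> rspace n"
  by (simp add: rspace_iff)

lemma eventually_upd_in:
  assumes "openE n U" "x \<in> U" "i < n"
  shows "eventually (\<lambda>t. x(i := t) \<in> U) (nhds (x i))"
proof -
  obtain d where d: "d > 0" "cube n x d \<subseteq> U"
    using assms by (elim openE_cubeE)
  have x: "x \<in> rspace n"
    using assms openE_subset by blast
  have "eventually (\<lambda>t. x(i := t) \<in> cube n x d) (nhds (x i))"
  proof (rule eventually_cube)
    show "((\<lambda>t. (x(i := t)) j) \<longlongrightarrow> x j) (nhds (x i))" for j
      by (cases "j = i") (auto simp: filterlim_ident)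
  qed (use d rspace_upd[OF x assms(3)] in auto)
  then show ?thesis
    by eventually_elim (use d in blast)
qed

section \<open>Functions of class \<open>C\<^sup>k\<close>\<close>

text \<open>\<open>Ck_on\<close> speaks of the value of \<open>deriv\<close>, whereas
  differentiation rules produce explicit derivatives; this predicate carries the latter.\<close>

definition has_partials :: "nat \<Rightarrow> rvec set \<Rightarrow> (rvec \<Rightarrow> real) \<Rightarrow> (nat \<Rightarrow> rvec \<Rightarrow> real) \<Rightarrow> bool" where
  "has_partials n U f g \<longleftrightarrow>
     (\<forall>i<n. \<forall>x\<in>U. ((\<lambda>t. f (x(i := t))) has_real_derivative g i x) (at (x i)))"

lemma partial_deriv_eq:
  "((\<lambda>t. f (x(i := t))) has_real_derivative D) (at (x i)) \<Longrightarrow> partial_deriv i f x = D"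
  unfolding partial_deriv_def by (rule DERIV_imp_deriv)

lemma has_partials_eq:
  "has_partials n U f g \<Longrightarrow> i < n \<Longrightarrow> x \<in> U \<Longrightarrow> partial_deriv i f x = g i x"
  unfolding has_partials_def by (blast intro: partial_deriv_eq)

lemma has_partials_cong:
  assumes "openE n U" "\<And>x. x \<in> U \<Longrightarrow> f x = f' x" "has_partials n U f g"
  shows "has_partials n U f' g"
  unfolding has_partials_def
proof (intro allI impI ballI)
  fix i x assume ix: "i < n" "x \<in> U"
  have "eventually (\<lambda>t. f (x(i := t)) = f' (x(i := t))) (nhds (x i))"
    using eventually_upd_in[OF assms(1) ix(2,1)] by eventually_elim (rule assms(2))
  moreover have "((\<lambda>t. f (x(i := t))) has_real_derivative g i x) (at (x i))"
    using assms(3) ix unfolding has_partials_def by blast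
  ultimately show "((\<lambda>t. f' (x(i := t))) has_real_derivative g i x) (at (x i))"
    by (subst (asm) DERIV_cong_ev[OF refl _ refl])
qed

lemma Ck_on_SucD:
  assumes "Ck_on (Suc k) n U f"
  shows "continuous_on U f" "has_partials n U f (\<lambda>i. partial_deriv i f)"
    "i < n \<Longrightarrow> Ck_on k n U (partial_deriv i f)"
proof -
  show "has_partials n U f (\<lambda>i. partial_deriv i f)"
    using assms unfolding has_partials_def partial_deriv_def
    by (auto simp: DERIV_deriv_iff_real_differentiable)
qed (use assms in auto)

lemma Ck_on_cong:
  assumes "openE n U" "\<And>x. x \<in> U \<Longrightarrow> f x = g x" "Ck_on k n U f"
  shows "Ck_on k n U g"
  using assms(2,3)
proof (induction k arbitrary: f g)
  case 0
  then have "continuous_on U g"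
    by (intro continuous_on_eq[of U f g]) simp_all
  then show ?case by simp
next
  case (Suc k)
  note D = Ck_on_SucD[OF Suc.prems(2)]
  have g: "has_partials n U g (\<lambda>i. partial_deriv i f)"
    using has_partials_cong[OF assms(1) Suc.prems(1) D(2)] .
  have "continuous_on U g"
    using D(1) Suc.prems(1) by (rule continuous_on_eq)
  moreover have "(\<lambda>t. g (x(i := t))) differentiable at (x i)" if "i < n" "x \<in> U" for i x
    using g that unfolding has_partials_def real_differentiable_def by blast
  moreover have "Ck_on k n U (partial_deriv i g)" if "i < n" for i
    using D(3)[OF that]
    by (rule Suc.IH[rotated]) (rule has_partials_eq[OF g that, symmetric])
  ultimately show ?case by simp
qed

text \<open>The closure properties below are inductions on the order through this rule: formulas for
  the partial derivatives are exhibited and shown to be of the lower order.\<close>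

lemma Ck_on_SucI:
  assumes "openE n U" "continuous_on U f" "has_partials n U f g" "\<And>i. i < n \<Longrightarrow> Ck_on k n U (g i)"
  shows "Ck_on (Suc k) n U f"
proof -
  have "(\<lambda>t. f (x(i := t))) differentiable at (x i)" if "i < n" "x \<in> U" for i x
    using assms(3) that unfolding has_partials_def real_differentiable_def by blast
  moreover have "Ck_on k n U (partial_deriv i f)" if "i < n" for i
    using assms(4)[OF that]
    by (rule Ck_on_cong[OF assms(1), rotated]) (rule has_partials_eq[OF assms(3) that, symmetric])
  ultimately show ?thesis
    using assms(2) by simp
qed

lemma Ck_on_continuous: "Ck_on k n U f \<Longrightarrow> continuous_on U f"
  by (cases k) auto

lemma Ck_on_decSuc: "Ck_on (Suc k) n U f \<Longrightarrow> Ck_on k n U f"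
proof (induction k arbitrary: f)
  case (Suc k)
  then show ?case
    unfolding Ck_on.simps(2)[of "Suc k"] Ck_on.simps(2)[of k] by blast
qed simp

lemma Ck_on_subset: "Ck_on k n U f \<Longrightarrow> V \<subseteq> U \<Longrightarrow> Ck_on k n V f"
  by (induction k arbitrary: f) (auto intro: continuous_on_subset)

lemma Ck_on_const: "openE n U \<Longrightarrow> Ck_on k n U (\<lambda>x. c)"
proof (induction k arbitrary: c)
  case (Suc k)
  have "has_partials n U (\<lambda>x. c) (\<lambda>i x. 0)"
    by (auto simp: has_partials_def)
  from Ck_on_SucI[OF Suc.prems _ this] Suc show ?case by simp
qed simp

lemma continuous_on_coord: "continuous_on U (\<lambda>x :: rvec. x j)"
  by (rule continuous_on_subset[OF continuous_on_product_coordinates]) simp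

lemma Ck_on_coord:
  assumes "openE n U"
  shows "Ck_on k n U (\<lambda>x. x j)"
proof (cases k)
  case 0
  then show ?thesis
    by (simp add: continuous_on_coord)
next
  case (Suc l)
  have "((\<lambda>t. (x(i := t)) j) has_real_derivative (if i = j then 1 else 0)) (at (x i))" 
    for i and x :: rvec
    by (cases "i = j") auto
  then have "has_partials n U (\<lambda>x. x j) (\<lambda>i x. if i = j then 1 else 0)"
    unfolding has_partials_def by blast
  from Ck_on_SucI[OF assms _ this, of l] Suc show ?thesis
    by (simp add: Ck_on_const[OF assms] continuous_on_coord)
qed

lemma Ck_on_add:
  assumes "openE n U"
  shows "Ck_on k n U f \<Longrightarrow> Ck_on k n U g \<Longrightarrow> Ck_on k n U (\<lambda>x. f x + g x)"
proof (induction k arbitrary: f g)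
  case 0
  then show ?case by (simp add: continuous_on_add)
next
  case (Suc k)
  note F = Ck_on_SucD[OF Suc.prems(1)] and G = Ck_on_SucD[OF Suc.prems(2)]
  have "has_partials n U (\<lambda>x. f x + g x) (\<lambda>i x. partial_deriv i f x + partial_deriv i g x)"
    using F(2) G(2) unfolding has_partials_def by (auto intro!: DERIV_add)
  then show ?case
    by (rule Ck_on_SucI[OF assms, rotated]) (auto intro!: continuous_on_add Suc.IH F G)
qed

lemma Ck_on_mult:
  assumes "openE n U"
  shows "Ck_on k n U f \<Longrightarrow> Ck_on k n U g \<Longrightarrow> Ck_on k n U (\<lambda>x. f x * g x)"
proof (induction k arbitrary: f g)
  case 0
  then show ?case by (simp add: continuous_on_mult)
next
  case (Suc k)
  note F = Ck_on_SucD[OF Suc.prems(1)] and G = Ck_on_SucD[OF Suc.prems(2)]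
  have "has_partials n U (\<lambda>x. f x * g x)
          (\<lambda>i x. partial_deriv i f x * g x + partial_deriv i g x * f x)"
    unfolding has_partials_def
  proof (intro allI impI ballI)
    fix i x assume "i < n" "x \<in> U"
    then have "((\<lambda>t. f (x(i := t))) has_real_derivative partial_deriv i f x) (at (x i))"
      "((\<lambda>t. g (x(i := t))) has_real_derivative partial_deriv i g x) (at (x i))"
      using F(2) G(2) unfolding has_partials_def by blast+
    from DERIV_mult[OF this]
    show "((\<lambda>t. f (x(i := t)) * g (x(i := t))) has_real_derivative
        partial_deriv i f x * g x + partial_deriv i g x * f x) (at (x i))"
      by simp
  qed
  then show ?case
    by (rule Ck_on_SucI[OF assms, rotated])
      (auto intro!: continuous_on_mult Ck_on_add[OF assms] Suc.IH F G Suc.prems[THEN Ck_on_decSuc])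
qed

lemma Ck_on_uminus: "openE n U \<Longrightarrow> Ck_on k n U f \<Longrightarrow> Ck_on k n U (\<lambda>x. - f x)"
  using Ck_on_mult[OF _ Ck_on_const[of n U k "-1"], of f] by simp

lemma Ck_on_diff: 
  "openE n U \<Longrightarrow> Ck_on k n U f \<Longrightarrow> Ck_on k n U g \<Longrightarrow> Ck_on k n U (\<lambda>x. f x - g x)"
  using Ck_on_add[OF _ _ Ck_on_uminus[of n U k g], of f] by simp

lemma Ck_on_sum:
  assumes "openE n U"
  shows "(\<And>j. j \<in> S \<Longrightarrow> Ck_on k n U (f j)) \<Longrightarrow> Ck_on k n U (\<lambda>x. \<Sum>j\<in>S. f j x)"
proof (induction S rule: infinite_finite_induct)
  case (insert a S)
  have "Ck_on k n U (\<lambda>x. f a x + (\<Sum>j\<in>S. f j x))"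
    using insert.prems insert.IH by (intro Ck_on_add[OF assms]) blast+
  then show ?case
    by (subst sum.insert[OF insert.hyps])
next
  case empty
  show ?case
    unfolding sum.empty by (rule Ck_on_const[OF assms])
next
  case (infinite S)
  show ?case
    unfolding sum.infinite[OF infinite.hyps] by (rule Ck_on_const[OF assms])
qed

text \<open>The partial derivatives of the reciprocal contain the reciprocal again, but only to
  order \<open>k\<close>, which the induction hypothesis covers.\<close>

lemma Ck_on_inverse:
  assumes "openE n U" "\<And>x. x \<in> U \<Longrightarrow> f x \<noteq> 0"
  shows "Ck_on k n U f \<Longrightarrow> Ck_on k n U (\<lambda>x. inverse (f x))"
proof (induction k)
  case 0
  then have "continuous_on U f" by simp
  then have "continuous_on U (\<lambda>x. inverse (f x))"
    by (rule continuous_on_inverse) (use assms(2) in blast)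
  then show ?case by simp
next
  case (Suc k)
  note F = Ck_on_SucD[OF Suc.prems]
  have "has_partials n U (\<lambda>x. inverse (f x))
          (\<lambda>i x. - (inverse (f x) * partial_deriv i f x * inverse (f x)))"
    unfolding has_partials_def
  proof (intro allI impI ballI)
    fix i x assume ix: "i < n" "x \<in> U"
    then have "((\<lambda>t. f (x(i := t))) has_real_derivative partial_deriv i f x) (at (x i))"
      using F(2) unfolding has_partials_def by blast
    from DERIV_inverse'[OF this] assms(2)[OF ix(2)]
    show "((\<lambda>t. inverse (f (x(i := t)))) has_real_derivative
        - (inverse (f x) * partial_deriv i f x * inverse (f x))) (at (x i))"
      by simp
  qed
  then show ?case
    by (rule Ck_on_SucI[OF assms(1), rotated])
      (use assms(2) in \<open>auto intro!: continuous_on_inverse Ck_on_mult[OF assms(1)]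
        Ck_on_uminus[OF assms(1)] Suc.IH F Ck_on_decSuc[OF Suc.prems]\<close>)
qed

section \<open>The chain rule\<close>

text \<open>Formulated with \<open>closed_segment\<close> so that the order of the endpoints and
  their coincidence need not be distinguished later.\<close>

lemma mean_value_segment:
  fixes g :: "real \<Rightarrow> real"
  assumes "\<And>t. t \<in> closed_segment a b \<Longrightarrow> (g has_real_derivative g' t) (at t)"
  shows "\<exists>t\<in>closed_segment a b. g b - g a = g' t * (b - a)"
proof -
  consider "a = b" | "a < b" | "b < a" by linarith
  then show ?thesis
  proof cases
    case 2
    then obtain z where "a < z" "z < b" "g b - g a = (b - a) * g' z"
      using MVT2[of a b g g'] assms by (auto simp: closed_segment_eq_real_ivl)
    then show ?thesis
      by (intro bexI[of _ z]) (auto simp: closed_segment_eq_real_ivl)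
  next
    case 3
    then obtain z where z: "b < z" "z < a" "g a - g b = (a - b) * g' z"
      using MVT2[of b a g g'] assms by (auto simp: closed_segment_eq_real_ivl)
    then have "g b - g a = g' z * (b - a)"
      by (simp add: algebra_simps)
    then show ?thesis
      using z by (intro bexI[of _ z]) (auto simp: closed_segment_eq_real_ivl)
  qed auto
qed

lemma segment_abs_le:
  fixes a b t :: real
  shows "t \<in> closed_segment a b \<Longrightarrow> \<bar>t - a\<bar> \<le> \<bar>b - a\<bar>"
  by (auto simp: closed_segment_eq_real_ivl split: if_splits)

lemma continuous_on_uniform_cube:
  assumes U: "openE n U" and g: "\<And>j. j < n \<Longrightarrow> continuous_on U (g j)" and x: "x \<in> U" and e: "0 < e"
  obtains d where "0 < d" "cube n x d \<subseteq> U"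
    "\<And>y j. y \<in> cube n x d \<Longrightarrow> j < n \<Longrightarrow> \<bar>g j y - g j x\<bar> < (e :: real)"
proof -
  obtain d0 where d0: "0 < d0" "cube n x d0 \<subseteq> U"
    using U x by (rule openE_cubeE)
  have "\<exists>d>0. \<forall>y\<in>cube n x d. \<bar>g j y - g j x\<bar> < e" if "j < n" for j
    using g[OF that, unfolded continuous_on_cube_iff[OF U], rule_format, OF x e] by blast
  then obtain D where D: "\<And>j. j < n \<Longrightarrow> D j > 0"
    "\<And>j y. j < n \<Longrightarrow> y \<in> cube n x (D j) \<Longrightarrow> \<bar>g j y - g j x\<bar> < e"
    by metis
  \<comment> \<open>Besides giving \<open>cube n x d \<subseteq> U\<close>, the entry
    \<open>d0\<close> keeps the set nonempty when \<open>n = 0\<close>.\<close>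
  define d where "d = Min (insert d0 (D ` {..<n}))"
  have d: "d \<le> d0" "\<And>j. j < n \<Longrightarrow> d \<le> D j"
    unfolding d_def by (auto intro!: Min_le)
  have "0 < d"
    unfolding d_def using d0 D(1) by (subst Min_gr_iff) auto
  then show ?thesis
  proof (rule that)
    show "cube n x d \<subseteq> U"
      using cube_subset[OF d(1)] d0(2) by blast
    show "\<bar>g j y - g j x\<bar> < e" if "y \<in> cube n x d" "j < n" for y j
      using D(2)[OF that(2)] cube_subset[OF d(2)[OF that(2)]] that(1) by blast
  qed
qed

text \<open>Caratheodory's form of differentiability needs no linear approximation: the slopes \<open>a y j\<close> come
  from moving from \<open>x\<close> to \<open>y\<close> one coordinate at a time.\<close>

lemma C1_caratheodory:
  assumes U: "openE n U" and f: "Ck_on (Suc 0) n U f" and x: "x \<in> U"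
  obtains a d0 where "d0 > 0" "cube n x d0 \<subseteq> U"
    "\<And>y. y \<in> cube n x d0 \<Longrightarrow> f y - f x = (\<Sum>j<n. a y j * (y j - x j))"
    "\<And>e. e > 0 \<Longrightarrow> \<exists>d>0. \<forall>y\<in>cube n x d. \<forall>j<n. \<bar>a y j - partial_deriv j f x\<bar> < e"
proof -
  note F = Ck_on_SucD[OF f]
  obtain d0 where d0: "d0 > 0" "cube n x d0 \<subseteq> U"
    using U x by (rule openE_cubeE)
  \<comment> \<open>\<open>z y j\<close> is the corner that the coordinate path from
    \<open>x\<close> to \<open>y\<close> reaches after \<open>j\<close> moves.\<close>
  define z :: "rvec \<Rightarrow> nat \<Rightarrow> rvec" where "z y j = (\<lambda>i. if i < j then y i else x i)" for y j
  \<comment> \<open>Where \<open>y j = x j\<close> the quotient is meaningless; the derivative at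
    \<open>x\<close> is then a value without error, and the increment it has to account for is
    zero.\<close>
  define a where "a y j = (if y j = x j then partial_deriv j f x
      else (f (z y (Suc j)) - f (z y j)) / (y j - x j))" for y j
  have zS: "z y (Suc j) = (z y j)(j := y j)" "z y j = (z y j)(j := x j)" "z y j j = x j" for y j
    by (auto simp: z_def)
  have xr: "x \<in> rspace n"
    using x openE_subset[OF U] by blast
  have a_eq: "f (z y (Suc j)) - f (z y j) = a y j * (y j - x j)" for y j
  proof (cases "y j = x j")
    case True
    then have "z y (Suc j) = z y j"
      using zS(1)[of y j] zS(2)[of y j] by simp
    then show ?thesis
      by (simp add: True)
  qed (simp add: a_def)
  have sum: "f y - f x = (\<Sum>j<n. a y j * (y j - x j))" if "y \<in> cube n x d0" for y
  proof -
    have "z y n = y" "z y 0 = x"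
      using that xr by (auto simp: z_def cube_def rspace_iff fun_eq_iff)
    then have "f y - f x = (\<Sum>j<n. f (z y (Suc j)) - f (z y j))"
      using sum_lessThan_telescope[of "\<lambda>j. f (z y j)" n] by metis
    then show ?thesis
      unfolding a_eq .
  qed
  have "\<exists>d>0. \<forall>y\<in>cube n x d. \<forall>j<n. \<bar>a y j - partial_deriv j f x\<bar> < e" if e: "e > 0" for e
  proof -
    have "continuous_on U (partial_deriv j f)" if "j < n" for j
      using F(3)[OF that] by simp
    from continuous_on_uniform_cube[where g = "\<lambda>j. partial_deriv j f", OF U this x e]
    obtain d where d: "0 < d" "cube n x d \<subseteq> U"
      "\<And>y j. y \<in> cube n x d \<Longrightarrow> j < n \<Longrightarrow> \<bar>partial_deriv j f y - partial_deriv j f x\<bar> < e"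
      by metis
    have "\<bar>a y j - partial_deriv j f x\<bar> < e" if y: "y \<in> cube n x d" and j: "j < n" for y j
    proof (cases "y j = x j")
      case True
      then show ?thesis using e by (simp add: a_def)
    next
      case False
      have in_cube: "(z y j)(j := t) \<in> cube n x d" if "t \<in> closed_segment (x j) (y j)" for t
        using segment_abs_le[OF that] y j xr d(1)
        by (auto simp: cube_def z_def rspace_iff intro: le_less_trans)
      have "((\<lambda>t. f ((z y j)(j := t))) has_real_derivative partial_deriv j f ((z y j)(j := t))) (at t)"
        if "t \<in> closed_segment (x j) (y j)" for t
        using F(2)[unfolded has_partials_def, rule_format, OF j, of "(z y j)(j := t)"]
          in_cube[OF that] d(2) by (simp add: subset_iff)
      from mean_value_segment[of "x j" "y j", OF this]
      obtain t where t: "t \<in> closed_segment (x j) (y j)"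
        "f ((z y j)(j := y j)) - f ((z y j)(j := x j)) =
           partial_deriv j f ((z y j)(j := t)) * (y j - x j)"
        by blast
      have "a y j = partial_deriv j f ((z y j)(j := t))"
        using t(2) False zS(1)[of y j] zS(2)[of y j] by (simp add: a_def)
      then show ?thesis
        using d(3)[OF in_cube[OF t(1)] j] by simp
    qed
    then show ?thesis
      using d(1) by (intro exI[of _ d]) simp
  qed
  from that[of d0 a, OF d0 sum this] show ?thesis .
qed

text \<open>The Caratheodory form along a curve \<open>c\<close> of which only convergence of the
  coordinates is known. Besides the chain rule this serves to differentiate an inverse map, whose
  differentiability is not yet available.\<close>

lemma C1_caratheodory_tendsto:
  fixes f :: "rvec \<Rightarrow> real" and F :: "real filter"
  assumes U: "openE n U" and f: "Ck_on (Suc 0) n U f" and x: "x \<in> U"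
    and c: "\<And>j. j < n \<Longrightarrow> ((\<lambda>t. c t j) \<longlongrightarrow> x j) F" "eventually (\<lambda>t. c t \<in> rspace n) F"
  obtains a where "eventually (\<lambda>t. f (c t) - f x = (\<Sum>j<n. a t j * (c t j - x j))) F"
    "\<And>j. j < n \<Longrightarrow> ((\<lambda>t. a t j) \<longlongrightarrow> partial_deriv j f x) F"
proof -
  obtain b d0 where b: "d0 > 0" "cube n x d0 \<subseteq> U"
    "\<And>y. y \<in> cube n x d0 \<Longrightarrow> f y - f x = (\<Sum>j<n. b y j * (y j - x j))"
    "\<And>e. e > 0 \<Longrightarrow> \<exists>d>0. \<forall>y\<in>cube n x d. \<forall>j<n. \<bar>b y j - partial_deriv j f x\<bar> < e"
    by (rule C1_caratheodory[OF U f x]) (rule that)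
  have ev: "eventually (\<lambda>t. c t \<in> cube n x d) F" if "d > 0" for d
    by (rule eventually_cube[OF c(1) c(2) that])
  show ?thesis
  proof (rule that)
    show "eventually (\<lambda>t. f (c t) - f x = (\<Sum>j<n. b (c t) j * (c t j - x j))) F"
      using ev[OF b(1)] by eventually_elim (rule b(3))
    show "((\<lambda>t. b (c t) j) \<longlongrightarrow> partial_deriv j f x) F" if "j < n" for j
    proof (rule tendstoI)
      fix e :: real assume "e > 0"
      from b(4)[OF this]
      obtain d where d: "d > 0" "\<forall>y\<in>cube n x d. \<forall>j<n. \<bar>b y j - partial_deriv j f x\<bar> < e"
        by (elim exE conjE) (rule that)
      show "eventually (\<lambda>t. dist (b (c t) j) (partial_deriv j f x) < e) F"
        using ev[OF d(1)] by eventually_elim (use d(2) that in \<open>simp add: dist_real_def\<close>)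
    qed
  qed
qed

text \<open>Dividing the Caratheodory identity along \<open>c\<close> by \<open>t - s\<close> leaves
  slopes converging to the partial derivatives, times difference quotients converging to
  \<open>c'\<close>.\<close>

lemma C1_chain_rule:
  assumes U: "openE n U" and f: "Ck_on (Suc 0) n U f" and x: "c s \<in> U"
    and c: "\<And>j. j < n \<Longrightarrow> ((\<lambda>t. c t j) has_real_derivative c' j) (at s)"
      "eventually (\<lambda>t. c t \<in> rspace n) (at s)"
  shows "((\<lambda>t. f (c t)) has_real_derivative (\<Sum>j<n. partial_deriv j f (c s) * c' j)) (at s)"
proof -
  have "((\<lambda>t. c t j) \<longlongrightarrow> c s j) (at s)" if "j < n" for j
    using DERIV_isCont[OF c(1)[OF that]] by (simp add: isCont_def)
  then obtain a where a: "eventually (\<lambda>t. f (c t) - f (c s) = (\<Sum>j<n. a t j * (c t j - c s j))) (at s)"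
    "\<And>j. j < n \<Longrightarrow> ((\<lambda>t. a t j) \<longlongrightarrow> partial_deriv j f (c s)) (at s)"
    by (rule C1_caratheodory_tendsto[OF U f x _ c(2)]) (assumption, rule that)
  have "((\<lambda>t. \<Sum>j<n. a t j * ((c t j - c s j) / (t - s))) \<longlongrightarrow>
      (\<Sum>j<n. partial_deriv j f (c s) * c' j)) (at s)"
    by (intro tendsto_sum tendsto_mult a(2)) (use c(1) in \<open>auto simp: has_field_derivative_iff\<close>)
  moreover have "eventually (\<lambda>t. (\<Sum>j<n. a t j * ((c t j - c s j) / (t - s))) =
      (f (c t) - f (c s)) / (t - s)) (at s)"
    using a(1) by eventually_elim (simp add: sum_divide_distrib)
  ultimately have "((\<lambda>t. (f (c t) - f (c s)) / (t - s)) \<longlongrightarrow>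
      (\<Sum>j<n. partial_deriv j f (c s) * c' j)) (at s)"
    by (rule Lim_transform_eventually)
  then show ?thesis
    by (simp add: has_field_derivative_iff)
qed

lemma Ck_on_1: "Ck_on (Suc k) n U f \<Longrightarrow> Ck_on (Suc 0) n U f"
  by (auto simp: Ck_on_continuous)

lemma has_partials_compose:
  assumes V: "openE n V" and f: "Ck_on (Suc 0) n V f" and U: "openE m U" and F: "F \<in> U \<rightarrow> V"
    and C: "\<And>j. j < n \<Longrightarrow> Ck_on (Suc 0) m U (\<lambda>x. F x j)"
  shows "has_partials m U (\<lambda>x. f (F x))
    (\<lambda>i x. \<Sum>j<n. partial_deriv j f (F x) * partial_deriv i (\<lambda>x. F x j) x)"
  unfolding has_partials_def
proof (intro allI impI ballI)
  fix i x assume ix: "i < m" "x \<in> U"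
  let ?c = "\<lambda>t. F (x(i := t))"
  have "((\<lambda>t. f (?c t)) has_real_derivative
      (\<Sum>j<n. partial_deriv j f (?c (x i)) * partial_deriv i (\<lambda>x. F x j) x)) (at (x i))"
  proof (rule C1_chain_rule[OF V f])
    show "?c (x i) \<in> V"
      using F ix(2) by auto
    show "((\<lambda>t. ?c t j) has_real_derivative partial_deriv i (\<lambda>x. F x j) x) (at (x i))"
      if "j < n" for j
      using Ck_on_SucD(2)[OF C[OF that]] ix unfolding has_partials_def by blast
    have "eventually (\<lambda>t. x(i := t) \<in> U) (nhds (x i))"
      by (rule eventually_upd_in[OF U ix(2,1)])
    then have "eventually (\<lambda>t. ?c t \<in> rspace n) (nhds (x i))"
      by eventually_elim (use F openE_subset[OF V] in blast)
    then show "eventually (\<lambda>t. ?c t \<in> rspace n) (at (x i))"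
      unfolding eventually_at_filter by eventually_elim simp
  qed
  then show "((\<lambda>t. f (?c t)) has_real_derivative
      (\<Sum>j<n. partial_deriv j f (F x) * partial_deriv i (\<lambda>x. F x j) x)) (at (x i))"
    by simp
qed

lemma continuous_on_Ck_map:
  assumes "openE n V" "F \<in> U \<rightarrow> V" "U \<subseteq> rspace m" "\<And>j. j < n \<Longrightarrow> Ck_on k m U (\<lambda>x. F x j)"
  shows "continuous_on U F"
  using assms(2) openE_subset[OF assms(1)]
  by (subst continuous_on_rspace_iff[OF assms(3)]) (auto intro: Ck_on_continuous assms(4))

text \<open>The chain rule gives sums of products of partial derivatives of \<open>f\<close>,
  composed with \<open>F\<close>, and of partial derivatives of \<open>F\<close>. The former are
  compositions with a new outer function, hence the induction over arbitrary
  \<open>f\<close>.\<close>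

lemma Ck_on_compose:
  assumes V: "openE n V" and U: "openE m U" and F: "F \<in> U \<rightarrow> V"
  shows "Ck_on k n V f \<Longrightarrow> (\<And>j. j < n \<Longrightarrow> Ck_on k m U (\<lambda>x. F x j)) \<Longrightarrow>
    Ck_on k m U (\<lambda>x. f (F x))"
proof (induction k arbitrary: f)
  case 0
  have "continuous_on U F"
    by (rule continuous_on_Ck_map[OF V F openE_subset[OF U] 0(2)])
  then have "continuous_on U (\<lambda>x. f (F x))"
    using 0(1) F by (intro continuous_on_compose2[of V f U F]) auto
  then show ?case by simp
next
  case (Suc k)
  have cF: "continuous_on U F"
    by (rule continuous_on_Ck_map[OF V F openE_subset[OF U] Suc.prems(2)])
  note D = Ck_on_SucD[OF Suc.prems(1)]
  have "has_partials m U (\<lambda>x. f (F x))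
    (\<lambda>i x. \<Sum>j<n. partial_deriv j f (F x) * partial_deriv i (\<lambda>x. F x j) x)"
    by (rule has_partials_compose[OF V Ck_on_1[OF Suc.prems(1)] U F Ck_on_1[OF Suc.prems(2)]])
  then show ?case
  proof (rule Ck_on_SucI[OF U, rotated])
    show "continuous_on U (\<lambda>x. f (F x))"
      using D(1) F by (intro continuous_on_compose2[OF _ cF]) auto
    show "Ck_on k m U (\<lambda>x. \<Sum>j<n. partial_deriv j f (F x) * partial_deriv i (\<lambda>x. F x j) x)"
      if "i < m" for i
    proof (intro Ck_on_sum[OF U] Ck_on_mult[OF U])
      fix j assume "j \<in> {..<n}"
      then have j: "j < n" by simp
      show "Ck_on k m U (\<lambda>x. partial_deriv j f (F x))"
        by (rule Suc.IH[OF D(3)[OF j] Ck_on_decSuc[OF Suc.prems(2)]])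
      show "Ck_on k m U (partial_deriv i (\<lambda>x. F x j))"
        by (rule Ck_on_SucD(3)[OF Suc.prems(2)[OF j] that])
    qed
  qed
qed

section \<open>Smooth maps between domains\<close>

lemma smooth_betweenD:
  assumes "smooth_between m U n V F"
  shows "openE m U" "openE n V" "x \<in> U \<Longrightarrow> F x \<in> V" "F \<in> U \<rightarrow> V" "continuous_on U F"
    "U \<subseteq> rspace m" "V \<subseteq> rspace n" "j < n \<Longrightarrow> Ck_on k m U (\<lambda>x. F x j)"
proof -
  show U: "openE m U" and V: "openE n V" and F: "F \<in> U \<rightarrow> V"
    and C: "\<And>k j. j < n \<Longrightarrow> Ck_on k m U (\<lambda>x. F x j)"
    using assms by (auto simp: smooth_between_def)
  show "x \<in> U \<Longrightarrow> F x \<in> V"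
    using F by blast
  show "U \<subseteq> rspace m" "V \<subseteq> rspace n"
    using U V openE_subset by auto
  show "continuous_on U F"
    by (rule continuous_on_Ck_map[OF V F openE_subset[OF U] C])
qed

lemma smooth_betweenI:
  assumes "openE m U" "openE n V" "\<And>x. x \<in> U \<Longrightarrow> F x \<in> V"
    "\<And>j k. j < n \<Longrightarrow> Ck_on k m U (\<lambda>x. F x j)"
  shows "smooth_between m U n V F"
  using assms by (auto simp: smooth_between_def)

lemma smooth_between_compose:
  assumes "smooth_between n V p W G" "smooth_between m U n V F"
  shows "smooth_between m U p W (\<lambda>x. G (F x))"
proof (rule smooth_betweenI)
  note F = smooth_betweenD[OF assms(2)] and G = smooth_betweenD[OF assms(1)]
  show "Ck_on k m U (\<lambda>x. G (F x) j)" if "j < p" for k j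
    by (rule Ck_on_compose[OF F(2,1,4) G(8)[OF that] F(8)])
  show "G (F x) \<in> W" if "x \<in> U" for x
    by (rule G(3)[OF F(3)[OF that]])
qed (use assms smooth_betweenD in blast)+

lemma smooth_between_cong:
  assumes "smooth_between m U n V F" "\<And>x. x \<in> U \<Longrightarrow> F x = G x"
  shows "smooth_between m U n V G"
proof (rule smooth_betweenI)
  note F = smooth_betweenD[OF assms(1)]
  show "Ck_on k m U (\<lambda>x. G x j)" if "j < n" for k j
    by (rule Ck_on_cong[OF F(1) _ F(8)[OF that]]) (simp add: assms(2))
  show "G x \<in> V" if "x \<in> U" for x
    using F(3)[OF that] assms(2)[OF that] by simp
qed (use assms smooth_betweenD in blast)+

lemma smooth_between_subset:
  assumes "smooth_between m U n V F" "openE m U'" "U' \<subseteq> U" "openE n V'" "\<And>x. x \<in> U' \<Longrightarrow> F x \<in> V'"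
  shows "smooth_between m U' n V' F"
proof (rule smooth_betweenI)
  show "Ck_on k m U' (\<lambda>x. F x j)" if "j < n" for k j
    by (rule Ck_on_subset[OF smooth_betweenD(8)[OF assms(1) that] assms(3)])
qed (use assms in blast)+

lemma smooth_between_id: "openE m U \<Longrightarrow> openE m V \<Longrightarrow> U \<subseteq> V \<Longrightarrow> smooth_between m U m V (\<lambda>x. x)"
  by (intro smooth_betweenI) (auto intro: Ck_on_coord)

lemma smooth_between_vimage:
  assumes "smooth_between m U n V F" "openE n W"
  shows "openE m {x \<in> U. F x \<in> W}"
  using smooth_betweenD[OF assms(1)] assms(2) by (intro openE_vimage) auto

lemma differential_rspace: "differential m n F a v \<in> rspace n"
  by (simp add: differential_def rspace_iff)

lemma differential_compose:
  assumes G: "smooth_between n V p W G" and F: "smooth_between m U n V F" and x: "x \<in> U"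
  shows "differential m p (\<lambda>x. G (F x)) x v = differential n p G (F x) (differential m n F x v)"
proof
  note F' = smooth_betweenD[OF F] and G' = smooth_betweenD[OF G]
  fix l
  show "differential m p (\<lambda>x. G (F x)) x v l = differential n p G (F x) (differential m n F x v) l"
  proof (cases "l < p")
    case True
    have "partial_deriv i (\<lambda>x. G (F x) l) x =
        (\<Sum>j<n. partial_deriv j (\<lambda>y. G y l) (F x) * partial_deriv i (\<lambda>x. F x j) x)" if "i < m" for i
      by (rule has_partials_eq[OF has_partials_compose[OF F'(2) G'(8)[OF True] F'(1,4) F'(8)] that x])
    then have "differential m p (\<lambda>x. G (F x)) x v l =
        (\<Sum>i<m. \<Sum>j<n. partial_deriv j (\<lambda>y. G y l) (F x) * partial_deriv i (\<lambda>x. F x j) x * v i)"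
      using True by (simp add: differential_def sum_distrib_right)
    also have "\<dots> = (\<Sum>j<n. \<Sum>i<m. partial_deriv j (\<lambda>y. G y l) (F x) * partial_deriv i (\<lambda>x. F x j) x * v i)"
      by (rule sum.swap)
    also have "\<dots> = differential n p G (F x) (differential m n F x v) l"
      using True by (simp add: differential_def sum_distrib_left mult.assoc)
    finally show ?thesis .
  qed (simp add: differential_def)
qed

lemma differential_cong:
  assumes "openE m U" "x \<in> U" "\<And>y. y \<in> U \<Longrightarrow> F y = G y"
  shows "differential m n F x = differential m n G x"
proof -
  have "partial_deriv i (\<lambda>x. F x j) x = partial_deriv i (\<lambda>x. G x j) x" if "i < m" for i j
    unfolding partial_deriv_def
  proof (rule deriv_cong_ev)
    show "eventually (\<lambda>t. F (x(i := t)) j = G (x(i := t)) j) (nhds (x i))"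
      using eventually_upd_in[OF assms(1,2) that] by eventually_elim (simp add: assms(3))
  qed simp
  then show ?thesis
    by (simp add: differential_def fun_eq_iff)
qed

lemma partial_deriv_coord: "partial_deriv i (\<lambda>x. x j) a = (if i = j then 1 else 0)"
  by (rule partial_deriv_eq) (auto simp: fun_upd_def)

lemma differential_id: "v \<in> rspace m \<Longrightarrow> differential m m (\<lambda>x. x) a v = v"
  by (auto simp: differential_def partial_deriv_coord rspace_iff fun_eq_iff if_distrib if_distribR
      sum.delta' sum.delta cong: if_cong)

lemma differential_add:
  "differential m n F a (\<lambda>i. v i + w i) = (\<lambda>i. differential m n F a v i + differential m n F a w i)"
  by (auto simp: differential_def fun_eq_iff sum.distrib distrib_left)

lemma differential_scale:
  "differential m n F a (\<lambda>i. r * v i) = (\<lambda>i. r * differential m n F a v i)"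
  by (auto simp: differential_def fun_eq_iff sum_distrib_left mult_ac)

section \<open>Replacing one coordinate by a function\<close>

lemma cube_upd:
  "y \<in> cube n x d \<Longrightarrow> i < n \<Longrightarrow> \<bar>t - x i\<bar> < d \<Longrightarrow> y(i := t) \<in> cube n x d"
  by (auto simp: cube_def rspace_iff)

text \<open>The inverse function theorem for \<open>x(i := g x)\<close>. Along lines in direction
  \<open>i\<close> the function \<open>g\<close> is strictly increasing near \<open>x0\<close>,
  which gives injectivity; the intermediate value theorem makes the image open and the inverse
  \<open>h\<close> continuous; differentiating \<open>g (h y) = y i\<close> expresses the partial
  derivatives of \<open>h\<close> through \<open>h\<close> itself, so that \<open>h\<close> gains
  one order of smoothness at a time.\<close>

lemma coordinate_change_pos:
  assumes U: "openE m U" and g: "\<And>k. Ck_on k m U g" and i: "i < m" and x0: "x0 \<in> U"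
    and pos: "partial_deriv i g x0 > 0"
  obtains W V h where "openE m W" "W \<subseteq> U" "x0 \<in> W" "smooth_between m V m W h"
    "\<And>x. x \<in> W \<Longrightarrow> x(i := g x) \<in> V" "\<And>x. x \<in> W \<Longrightarrow> h (x(i := g x)) = x"
    "\<And>y. y \<in> V \<Longrightarrow> (h y)(i := g (h y)) = y"
proof -
  have cont: "continuous_on U (partial_deriv l g)" if "l < m" for l
    using Ck_on_SucD(3)[OF g that, of 0] by simp
  have x0r: "x0 \<in> rspace m"
    using x0 openE_subset[OF U] by blast
  obtain r where r: "0 < r" "cube m x0 r \<subseteq> U"
    and "\<forall>y\<in>cube m x0 r. \<bar>partial_deriv i g y - partial_deriv i g x0\<bar> < partial_deriv i g x0"
    using cont[OF i, unfolded continuous_on_cube_iff[OF U], THEN bspec, OF x0, THEN spec, THEN mp, OF pos]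
    by (elim exE conjE) (rule that)
  then have dpos: "partial_deriv i g y > 0" if "y \<in> cube m x0 r" for y
    using that by (force simp: abs_if split: if_splits)
  define W where "W = cube m x0 r"
  have W: "openE m W" "W \<subseteq> U" "x0 \<in> W" "W \<subseteq> rspace m"
    using r x0r by (auto simp: W_def cube_rspace)
  \<comment> \<open>Convexity of the cube in direction \<open>i\<close>.\<close>
  have Wmid: "z(i := t) \<in> W" if "z(i := t1) \<in> W" "z(i := t2) \<in> W" "t1 \<le> t" "t \<le> t2" for z t t1 t2
  proof -
    have "\<bar>t1 - x0 i\<bar> < r" "\<bar>t2 - x0 i\<bar> < r"
      using that(1,2) i by (auto simp: W_def cube_def dest: spec[of _ i])
    then have "\<bar>t - x0 i\<bar> < r"
      using that(3,4) by linarith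
    then show ?thesis
      using cube_upd[OF that(1)[unfolded W_def] i] by (simp add: W_def)
  qed
  have deriv: "((\<lambda>t. g (z(i := t))) has_real_derivative partial_deriv i g (z(i := t))) (at t)"
    if "z(i := t) \<in> W" for z t
    using Ck_on_SucD(2)[OF g, unfolded has_partials_def, rule_format, OF i, of "z(i := t)"] that W(2)
    by (simp add: subset_iff)
  have mono: "g (z(i := t1)) < g (z(i := t2))" if "z(i := t1) \<in> W" "z(i := t2) \<in> W" "t1 < t2" for z t1 t2
  proof (rule DERIV_pos_imp_increasing[OF that(3)])
    fix t assume "t1 \<le> t" "t \<le> t2"
    then have "z(i := t) \<in> W"
      by (rule Wmid[OF that(1,2)])
    then show "\<exists>y. ((\<lambda>t. g (z(i := t))) has_real_derivative y) (at t) \<and> 0 < y"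
      using deriv dpos W_def by blast
  qed
  define \<alpha> where "\<alpha> x = x(i := g x)" for x
  have inj: "inj_on \<alpha> W"
  proof (rule inj_onI)
    fix x y assume xy: "x \<in> W" "y \<in> W" "\<alpha> x = \<alpha> y"
    have gxy: "g x = g y"
      using fun_cong[OF xy(3), of i] by (simp add: \<alpha>_def)
    have yx: "y = x(i := y i)"
    proof
      fix j
      show "y j = (x(i := y i)) j"
        using fun_cong[OF xy(3), of j] by (cases "j = i") (auto simp: \<alpha>_def)
    qed
    have "x i = y i"
    proof (rule ccontr)
      assume "x i \<noteq> y i"
      then consider "x i < y i" | "y i < x i" by linarith
      then show False
      proof cases
        case 1
        then have "g (x(i := x i)) < g (x(i := y i))"
          by (rule mono[rotated 2]) (use xy yx[symmetric] in simp_all)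
        then show False
          unfolding yx[symmetric] using gxy by simp
      next
        case 2
        then have "g (x(i := y i)) < g (x(i := x i))"
          by (rule mono[rotated 2]) (use xy yx[symmetric] in simp_all)
        then show False
          unfolding yx[symmetric] using gxy by simp
      qed
    qed
    then have "x(i := y i) = x"
      by (metis fun_upd_triv)
    with yx show "x = y"
      by (rule trans[OF sym sym, rotated])
  qed
  define V where "V = \<alpha> ` W"
  define h where "h = inv_into W \<alpha>"
  have h\<alpha>: "h (\<alpha> x) = x" if "x \<in> W" for x
    unfolding h_def by (rule inv_into_f_f[OF inj that])
  have hW: "h y \<in> W" and \<alpha>h: "\<alpha> (h y) = y" if "y \<in> V" for y
    using that inv_into_into[of y \<alpha> W] f_inv_into_f[of y \<alpha> W] by (simp_all add: h_def V_def)
  have hj: "h y j = y j" if "y \<in> V" "j \<noteq> i" for y j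
    using fun_cong[OF \<alpha>h[OF that(1)], of j] that(2) by (simp add: \<alpha>_def)
  have gh: "g (h y) = y i" if "y \<in> V" for y
    using fun_cong[OF \<alpha>h[OF that(1)], of i] by (simp add: \<alpha>_def)
  \<comment> \<open>One estimate serves both for the openness of \<open>V\<close> and for the
    continuity of \<open>h\<close>: for \<open>y\<close> near \<open>y0\<close>, the equation
    \<open>g (y(i := t)) = y i\<close> has a solution close to the one for
    \<open>y0\<close>.\<close>
  have key: "\<exists>d>0. \<forall>y\<in>cube m y0 d. y \<in> V \<and> \<bar>h y i - h y0 i\<bar> < e" if y0: "y0 \<in> V" and e: "e > 0" for y0 e
  proof -
    define x where "x = h y0"
    have xW: "x \<in> W"
      unfolding x_def by (rule hW[OF y0])
    have xr: "\<bar>x i - x0 i\<bar> < r"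
      using xW i by (auto simp: W_def cube_def)
    \<comment> \<open>Half of the available room: \<open>x i - \<delta>\<close> and
      \<open>x i + \<delta>\<close> stay in the cube, and everything between them is within
      \<open>e\<close> of \<open>x i\<close>.\<close>
    define \<delta> where "\<delta> = min e (r - \<bar>x i - x0 i\<bar>) / 2"
    have \<delta>: "0 < \<delta>" "\<delta> < e" "\<delta> < r - \<bar>x i - x0 i\<bar>"
      using e xr by (auto simp: \<delta>_def min_def field_simps)
    define t1 t2 where "t1 = x i - \<delta>" and "t2 = x i + \<delta>"
    have t12: "x(i := t1) \<in> W" "x(i := t2) \<in> W"
      unfolding W_def by (intro cube_upd xW[unfolded W_def] i; use \<delta> in \<open>simp add: t1_def t2_def\<close>)+
    have gx: "g x = y0 i"
      unfolding x_def by (rule gh[OF y0])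
    have lt: "g (x(i := t1)) < y0 i" "y0 i < g (x(i := t2))"
      using mono[of x t1 "x i"] mono[of x "x i" t2] t12 xW \<delta>(1) gx by (auto simp: t1_def t2_def)
    \<comment> \<open>Half of the smaller gap between \<open>y0 i\<close> and the values of
      \<open>g\<close> at the two ends: shifting \<open>y i\<close> and the end values by less than
      \<open>\<gamma>\<close> each keeps \<open>y i\<close> between them.\<close>
    define \<gamma> where "\<gamma> = min (y0 i - g (x(i := t1))) (g (x(i := t2)) - y0 i) / 2"
    have \<gamma>: "0 < \<gamma>" "g (x(i := t1)) + \<gamma> \<le> y0 i - \<gamma>" "y0 i + \<gamma> \<le> g (x(i := t2)) - \<gamma>"
      using lt by (auto simp: \<gamma>_def min_def field_simps)
    have gcont: "continuous_on W g"
      by (rule continuous_on_subset[OF Ck_on_continuous[OF g] W(2)])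
    note gcube = gcont[unfolded continuous_on_cube_iff[OF W(1)], THEN bspec, THEN spec, THEN mp, OF _ \<gamma>(1)]
    obtain d1 where d1: "d1 > 0" "cube m (x(i := t1)) d1 \<subseteq> W"
      "\<forall>y\<in>cube m (x(i := t1)) d1. \<bar>g y - g (x(i := t1))\<bar> < \<gamma>"
      using gcube[OF t12(1)] by (elim exE conjE) (rule that)
    obtain d2 where d2: "d2 > 0" "cube m (x(i := t2)) d2 \<subseteq> W"
      "\<forall>y\<in>cube m (x(i := t2)) d2. \<bar>g y - g (x(i := t2))\<bar> < \<gamma>"
      using gcube[OF t12(2)] by (elim exE conjE) (rule that)
    define d where "d = min \<gamma> (min d1 d2)"
    have d: "0 < d" "d \<le> \<gamma>" "d \<le> d1" "d \<le> d2"
      using \<gamma>(1) d1(1) d2(1) by (auto simp: d_def)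
    have "y \<in> V \<and> \<bar>h y i - h y0 i\<bar> < e" if y: "y \<in> cube m y0 d" for y
    proof -
      \<comment> \<open>Off the coordinate \<open>i\<close> the points \<open>x\<close> and
        \<open>y0\<close> agree, so closeness to \<open>y0\<close> carries over.\<close>
      have upd: "y(i := t) \<in> cube m (x(i := t)) d" for t
      proof -
        have "\<bar>y j - x j\<bar> < d" if "j < m" "j \<noteq> i" for j
          using y that hj[OF y0 that(2)] by (simp add: cube_def x_def)
        then show ?thesis
          using y i d(1) by (auto simp: cube_def rspace_iff)
      qed
      have z1: "y(i := t1) \<in> cube m (x(i := t1)) d1" and z2: "y(i := t2) \<in> cube m (x(i := t2)) d2"
        using upd cube_subset[OF d(3)] cube_subset[OF d(4)] by blast+
      have zW: "y(i := t1) \<in> W" "y(i := t2) \<in> W"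
        using z1 z2 d1(2) d2(2) by auto
      have yi: "\<bar>y i - y0 i\<bar> < \<gamma>"
        using y i d(2) by (auto simp: cube_def)
      have "\<bar>g (y(i := t1)) - g (x(i := t1))\<bar> < \<gamma>" "\<bar>g (y(i := t2)) - g (x(i := t2))\<bar> < \<gamma>"
        using d1(3) d2(3) z1 z2 by blast+
      then have ivl: "g (y(i := t1)) \<le> y i" "y i \<le> g (y(i := t2))"
        using \<gamma> yi by linarith+
      have "\<exists>t\<ge>t1. t \<le> t2 \<and> g (y(i := t)) = y i"
      proof (rule IVT'[where f = "\<lambda>t. g (y(i := t))", OF ivl])
        show "t1 \<le> t2" using \<delta>(1) by (simp add: t1_def t2_def)
        show "continuous_on {t1..t2} (\<lambda>t. g (y(i := t)))"
        proof (rule DERIV_continuous_on)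
          fix t assume "t \<in> {t1..t2}"
          then have "y(i := t) \<in> W"
            using Wmid[OF zW] by simp
          then show "((\<lambda>t. g (y(i := t))) has_real_derivative partial_deriv i g (y(i := t)))
              (at t within {t1..t2})"
            by (rule has_field_derivative_at_within[OF deriv])
        qed
      qed
      then obtain t where t: "t1 \<le> t" "t \<le> t2" "g (y(i := t)) = y i"
        by blast
      have tW: "y(i := t) \<in> W"
        by (rule Wmid[OF zW t(1,2)])
      have eq: "\<alpha> (y(i := t)) = y"
        using t(3) by (simp add: \<alpha>_def)
      have "y \<in> V"
        using imageI[OF tW, of \<alpha>] eq by (simp add: V_def)
      moreover have "h y = y(i := t)"
        using h\<alpha>[OF tW] eq by simp
      ultimately show ?thesis
        using t \<delta> by (simp add: x_def[symmetric] t1_def t2_def)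
    qed
    with d(1) show ?thesis
      by (intro exI[of _ d]) simp
  qed
  have Vr: "V \<subseteq> rspace m"
    unfolding V_def \<alpha>_def using W(4) i by (auto intro: rspace_upd)
  have V: "openE m V"
    unfolding openE_iff_cube
  proof (intro conjI Vr ballI)
    fix y assume y: "y \<in> V"
    have "(0 :: real) < 1" by simp
    from key[OF y this] obtain d where "d > 0" "\<forall>y'\<in>cube m y d. y' \<in> V \<and> \<bar>h y' i - h y i\<bar> < 1"
      by (elim exE conjE) (rule that)
    then show "\<exists>d>0. cube m y d \<subseteq> V"
      by (intro exI[of _ d]) auto
  qed
  have hcont: "continuous_on V (\<lambda>y. h y i)"
    unfolding continuous_on_cube_iff[OF V]
  proof (intro ballI allI impI)
    fix y and e :: real assume "y \<in> V" "e > 0"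
    from key[OF this] obtain d where "d > 0" "\<forall>y'\<in>cube m y d. y' \<in> V \<and> \<bar>h y' i - h y i\<bar> < e"
      by (elim exE conjE) (rule that)
    then show "\<exists>d>0. cube m y d \<subseteq> V \<and> (\<forall>y'\<in>cube m y d. \<bar>h y' i - h y i\<bar> < e)"
      by (intro exI[of _ d]) auto
  qed
  \<comment> \<open>the values forced by differentiating \<open>g (h y) = y i\<close>\<close>
  define D where "D l y = (if l = i then inverse (partial_deriv i g (h y))
      else - (partial_deriv l g (h y) * inverse (partial_deriv i g (h y))))" for l y
  have hD: "has_partials m V (\<lambda>y. h y i) D"
    unfolding has_partials_def
  proof (intro allI impI ballI)
    fix l y assume l: "l < m" and y: "y \<in> V"
    define F where "F = at (y l)"
    define c where "c t = h (y(l := t))" for t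
    have nhds: "eventually (\<lambda>t. y(l := t) \<in> cube m y d) F" if "d > 0" for d
    proof -
      have "eventually (\<lambda>t. y(l := t) \<in> cube m y d) (nhds (y l))"
        by (rule eventually_upd_in) (use y Vr l that in auto)
      then show ?thesis
        unfolding F_def eventually_at_filter by eventually_elim simp
    qed
    have evV: "eventually (\<lambda>t. y(l := t) \<in> V) F"
    proof -
      obtain d where d: "d > 0" "cube m y d \<subseteq> V"
        using V y by (rule openE_cubeE)
      show ?thesis
        using nhds[OF d(1)] by eventually_elim (use d(2) in blast)
    qed
    have ci: "((\<lambda>t. c t i) \<longlongrightarrow> h y i) F"
    proof (rule tendstoI)
      fix e :: real assume "e > 0"
      from key[OF y this] obtain d where d: "d > 0" "\<forall>y'\<in>cube m y d. y' \<in> V \<and> \<bar>h y' i - h y i\<bar> < e"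
        by (elim exE conjE) (rule that)
      show "eventually (\<lambda>t. dist (c t i) (h y i) < e) F"
        using nhds[OF d(1)] by eventually_elim (use d(2) in \<open>simp add: c_def dist_real_def\<close>)
    qed
    have cj: "((\<lambda>t. c t j) \<longlongrightarrow> h y j) F" if "j < m" for j
    proof (cases "j = i")
      case False
      have "((\<lambda>t. (y(l := t)) j) \<longlongrightarrow> y j) F"
        unfolding F_def by (cases "j = l") (auto intro: tendsto_intros)
      moreover have "eventually (\<lambda>t. (y(l := t)) j = c t j) F"
        using evV by eventually_elim (simp add: c_def hj False del: fun_upd_apply)
      ultimately show ?thesis
        unfolding hj[OF y False] by (rule Lim_transform_eventually)
    qed (use ci in simp)
    have cr: "eventually (\<lambda>t. c t \<in> rspace m) F"
      using evV by eventually_elim (use hW W(4) in \<open>auto simp: c_def\<close>)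
    \<comment> \<open>At this stage \<open>c\<close> is only known to converge coordinatewise. That
      suffices here and turns \<open>g (c t) = (y(l := t)) i\<close> into a linear equation for the
      increment of \<open>c\<close> in coordinate \<open>i\<close>.\<close>
    obtain a where a: "eventually (\<lambda>t. g (c t) - g (h y) = (\<Sum>j<m. a t j * (c t j - h y j))) F"
      "\<And>j. j < m \<Longrightarrow> ((\<lambda>t. a t j) \<longlongrightarrow> partial_deriv j g (h y)) F"
      by (rule C1_caratheodory_tendsto[OF W(1) Ck_on_subset[OF g W(2)] hW[OF y] cj cr]) (assumption, rule that)
    have hy: "partial_deriv i g (h y) > 0"
      using dpos hW[OF y] by (simp add: W_def)
    have ai: "eventually (\<lambda>t. a t i > 0) F"
      by (rule order_tendstoD(1)[OF a(2)[OF i] hy])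
    have ne: "eventually (\<lambda>t. t \<noteq> y l) F"
      by (simp add: F_def eventually_at_filter)
    have "eventually (\<lambda>t. (if l = i then inverse (a t i) else - (a t l * inverse (a t i))) =
        (c t i - h y i) / (t - y l)) F"
      using a(1) ai evV ne
    proof eventually_elim
      case (elim t)
      have "(\<Sum>j<m. a t j * (c t j - h y j)) = a t i * (c t i - h y i) + (\<Sum>j\<in>{..<m} - {i}. a t j * (c t j - h y j))"
        using i by (subst sum.remove[of _ i]) auto
      \<comment> \<open>\<open>h\<close> leaves all coordinates except \<open>i\<close> alone, so
        beside \<open>i\<close> only the moved coordinate \<open>l\<close> contributes.\<close>
      also have "(\<Sum>j\<in>{..<m} - {i}. a t j * (c t j - h y j)) =
          (\<Sum>j\<in>{..<m} - {i}. if j = l then a t l * (t - y l) else 0)"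
        by (rule sum.cong) (use hj[OF elim(3)] hj[OF y] in \<open>auto simp: c_def\<close>)
      also have "\<dots> = (if l = i then 0 else a t l * (t - y l))"
        using l by (simp add: sum.delta)
      finally have "(y(l := t)) i - y i = a t i * (c t i - h y i) + (if l = i then 0 else a t l * (t - y l))"
        using elim(1) gh[OF elim(3)] gh[OF y] by (simp add: c_def)
      then have "a t i * (c t i - h y i) = (if l = i then 1 else - a t l) * (t - y l)"
        by (auto split: if_splits)
      moreover have "a t i \<noteq> 0" "t - y l \<noteq> 0"
        using elim(2,4) by simp_all
      ultimately have "(c t i - h y i) / (t - y l) = (if l = i then 1 else - a t l) / a t i"
        by (subst frac_eq_eq) (simp_all only: mult.commute not_False_eq_True)
      then show ?case
        by (simp add: divide_inverse)
    qed
    moreover have "((\<lambda>t. if l = i then inverse (a t i) else - (a t l * inverse (a t i))) \<longlongrightarrow> D l y) F"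
      unfolding D_def using hy by (auto intro!: tendsto_intros a(2) i l)
    ultimately have "((\<lambda>t. (c t i - h y i) / (t - y l)) \<longlongrightarrow> D l y) F"
      by (rule Lim_transform_eventually[rotated])
    then show "((\<lambda>t. h (y(l := t)) i) has_real_derivative D l y) (at (y l))"
      by (simp add: has_field_derivative_iff F_def c_def)
  qed
  \<comment> \<open>An implication, to be fed with the induction hypothesis on the order: the
    remaining coordinates of \<open>h\<close> are those of the identity.\<close>
  have Ck_h: "Ck_on k m V (\<lambda>y. h y i) \<Longrightarrow> Ck_on k m V (\<lambda>y. h y j)" for k j
  proof (cases "j = i")
    case False
    show ?thesis
      by (rule Ck_on_cong[OF V _ Ck_on_coord[OF V]]) (simp add: hj[OF _ False])
  qed simp
  have "Ck_on k m V (\<lambda>y. h y i)" for k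
  proof (induction k)
    case 0
    show ?case using hcont by simp
  next
    case (Suc k)
    have p: "Ck_on k m V (\<lambda>y. partial_deriv l g (h y))" if "l < m" for l
    proof (rule Ck_on_compose[where F = h, OF W(1) V])
      show "h \<in> V \<rightarrow> W" using hW by blast
      show "Ck_on k m W (partial_deriv l g)"
        by (rule Ck_on_subset[OF Ck_on_SucD(3)[OF g that] W(2)])
    qed (rule Ck_h[OF Suc.IH])
    have q: "Ck_on k m V (\<lambda>y. inverse (partial_deriv i g (h y)))"
    proof (rule Ck_on_inverse[OF V _ p[OF i]])
      show "partial_deriv i g (h y) \<noteq> 0" if "y \<in> V" for y
        using dpos hW[OF that] by (force simp: W_def)
    qed
    show ?case
    proof (rule Ck_on_SucI[OF V hcont hD])
      show "Ck_on k m V (D l)" if "l < m" for l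
        unfolding D_def using Ck_on_uminus[OF V Ck_on_mult[OF V p[OF that] q]] q
        by (cases "l = i") simp_all
    qed
  qed
  then have "smooth_between m V m W h"
    using V W(1) hW Ck_h by (intro smooth_betweenI) auto
  moreover have "x(i := g x) \<in> V" "h (x(i := g x)) = x" if "x \<in> W" for x
    using h\<alpha>[OF that] that by (auto simp: V_def \<alpha>_def)
  moreover have "(h y)(i := g (h y)) = y" if "y \<in> V" for y
    using \<alpha>h[OF that] by (simp add: \<alpha>_def)
  ultimately show ?thesis
    by (intro that[of W V h] W(1-3))
qed

lemma smooth_between_linear:
  assumes "openE m U" "openE n V" "\<And>x. x \<in> U \<Longrightarrow> F x \<in> V"
    "\<And>j. j < n \<Longrightarrow> \<exists>a i. (\<forall>x\<in>U. F x j = a * x i)"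
  shows "smooth_between m U n V F"
proof (rule smooth_betweenI)
  fix j k assume "j < n"
  then obtain a i where "\<forall>x\<in>U. F x j = a * x i"
    using assms(4) by blast
  then show "Ck_on k m U (\<lambda>x. F x j)"
    by (intro Ck_on_cong[OF assms(1) _ Ck_on_mult[OF assms(1) Ck_on_const[OF assms(1), of k a]
            Ck_on_coord[OF assms(1), of k i]]]) simp
qed (use assms in auto)

text \<open>For a negative derivative the positive case applies to \<open>- g\<close>; reflecting
  coordinate \<open>i\<close> on the side of \<open>V\<close> restores the sign.\<close>

lemma coordinate_change:
  assumes U: "openE m U" and g: "\<And>k. Ck_on k m U g" and i: "i < m" and x0: "x0 \<in> U"
    and nz: "partial_deriv i g x0 \<noteq> 0"
  obtains W V h where "openE m W" "W \<subseteq> U" "x0 \<in> W" "smooth_between m V m W h"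
    "\<And>x. x \<in> W \<Longrightarrow> x(i := g x) \<in> V" "\<And>x. x \<in> W \<Longrightarrow> h (x(i := g x)) = x"
    "\<And>y. y \<in> V \<Longrightarrow> (h y)(i := g (h y)) = y"
proof (cases "partial_deriv i g x0 > 0")
  case True
  show ?thesis
    by (rule coordinate_change_pos[OF U g i x0 True]) (rule that)
next
  case False
  have "partial_deriv i (\<lambda>x. - g x) x0 = - partial_deriv i g x0"
    using Ck_on_SucD(2)[OF g, unfolded has_partials_def, rule_format, OF i x0]
    by (intro partial_deriv_eq DERIV_minus)
  with False nz have "partial_deriv i (\<lambda>x. - g x) x0 > 0"
    by simp
  obtain W V h where W: "openE m W" "W \<subseteq> U" "x0 \<in> W" and h: "smooth_between m V m W h"
    and WV: "\<And>x. x \<in> W \<Longrightarrow> x(i := - g x) \<in> V" "\<And>x. x \<in> W \<Longrightarrow> h (x(i := - g x)) = x"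
    and hg: "\<And>y. y \<in> V \<Longrightarrow> (h y)(i := - g (h y)) = y"
    by (rule coordinate_change_pos[OF U Ck_on_uminus[OF U g] i x0 \<open>0 < _\<close>]) (rule that)
  define \<rho> :: "rvec \<Rightarrow> rvec" where "\<rho> y = y(i := - y i)" for y
  have \<rho>: "smooth_between m (rspace m) m (rspace m) \<rho>"
  proof (rule smooth_between_linear)
    show "\<exists>a l. \<forall>x\<in>rspace m. \<rho> x j = a * x l" for j
      by (rule exI[of _ "if j = i then -1 else 1"], rule exI[of _ j]) (simp add: \<rho>_def)
  qed (use i in \<open>auto simp: \<rho>_def rspace_iff\<close>)
  define V' where "V' = {y \<in> rspace m. \<rho> y \<in> V}"
  have V': "openE m V'"
    unfolding V'_def by (rule smooth_between_vimage[OF \<rho> smooth_betweenD(1)[OF h]])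
  have "smooth_between m V' m W (\<lambda>y. h (\<rho> y))"
    by (rule smooth_between_compose[OF h smooth_between_subset[OF \<rho> V' _ smooth_betweenD(1)[OF h]]])
      (auto simp: V'_def)
  moreover have "x(i := g x) \<in> V'" "h (\<rho> (x(i := g x))) = x" if "x \<in> W" for x
    using WV[OF that] that W(1)[THEN openE_subset] i
    by (auto simp: V'_def \<rho>_def intro: rspace_upd)
  moreover have "(h (\<rho> y))(i := g (h (\<rho> y))) = y" if "y \<in> V'" for y
  proof -
    have "(h (\<rho> y))(i := - g (h (\<rho> y))) = \<rho> y"
      using that by (intro hg) (simp add: V'_def)
    then show ?thesis
      by (auto simp: \<rho>_def fun_eq_iff split: if_splits)
  qed
  ultimately show ?thesis
    by (intro that[of W V' "\<lambda>y. h (\<rho> y)"] W)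
qed

section \<open>Etale charts and lifts of plots\<close>

text \<open>Smoothness, local lifting with a prescribed value at one point, and uniqueness of the
  germ of a lift, all stated without pullback spaces, so that changes of coordinates are easy to
  follow. Uniqueness concerns lifts that agree at a point; it does not make \<open>\<phi>\<close>
  locally injective, as the projection of the line onto an irrational torus shows.\<close>

definition lifting_chart :: "nat \<Rightarrow> rvec set \<Rightarrow> 'a dspace \<Rightarrow> (rvec \<Rightarrow> 'a) \<Rightarrow> bool" where
  "lifting_chart m U X \<phi> \<longleftrightarrow> openE m U \<and> \<phi> \<in> U \<rightarrow> points X \<and>
     (\<forall>k V F. smooth_between k V m U F \<longrightarrow> (k, V, compose V \<phi> F) \<in> plots X) \<and>
     (\<forall>k V P v u. (k, V, P) \<in> plots X \<longrightarrow> v \<in> V \<longrightarrow> u \<in> U \<longrightarrow> \<phi> u = P v \<longrightarrow>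
        (\<exists>W \<sigma>. W \<subseteq> V \<and> v \<in> W \<and> smooth_between k W m U \<sigma> \<and> \<sigma> v = u \<and> (\<forall>w\<in>W. \<phi> (\<sigma> w) = P w))) \<and>
     (\<forall>k W \<sigma> \<tau> v. smooth_between k W m U \<sigma> \<longrightarrow> smooth_between k W m U \<tau> \<longrightarrow> v \<in> W \<longrightarrow>
        \<sigma> v = \<tau> v \<longrightarrow> (\<forall>w\<in>W. \<phi> (\<sigma> w) = \<phi> (\<tau> w)) \<longrightarrow>
        (\<exists>W'. openE k W' \<and> v \<in> W' \<and> W' \<subseteq> W \<and> (\<forall>w\<in>W'. \<sigma> w = \<tau> w)))"

lemma lifting_chartD:
  assumes "lifting_chart m U X \<phi>"
  shows "openE m U" "u \<in> U \<Longrightarrow> \<phi> u \<in> points X"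
    "smooth_between k V m U F \<Longrightarrow> (k, V, compose V \<phi> F) \<in> plots X"
proof -
  note c = assms[unfolded lifting_chart_def]
  show "openE m U" by (rule c[THEN conjunct1])
  show "u \<in> U \<Longrightarrow> \<phi> u \<in> points X"
    using c[THEN conjunct2, THEN conjunct1] by (rule funcset_mem)
  show "smooth_between k V m U F \<Longrightarrow> (k, V, compose V \<phi> F) \<in> plots X"
    using c[THEN conjunct2, THEN conjunct2, THEN conjunct1] by simp
qed

lemma lifting_chart_lift:
  assumes "lifting_chart m U X \<phi>" "(k, V, P) \<in> plots X" "v \<in> V" "u \<in> U" "\<phi> u = P v"
  obtains W \<sigma> where "W \<subseteq> V" "v \<in> W" "smooth_between k W m U \<sigma>" "\<sigma> v = u"
    "\<And>w. w \<in> W \<Longrightarrow> \<phi> (\<sigma> w) = P w"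
proof -
  have "\<exists>W \<sigma>. W \<subseteq> V \<and> v \<in> W \<and> smooth_between k W m U \<sigma> \<and> \<sigma> v = u \<and> (\<forall>w\<in>W. \<phi> (\<sigma> w) = P w)"
    using assms(1)[unfolded lifting_chart_def, THEN conjunct2, THEN conjunct2, THEN conjunct2, THEN conjunct1]
      assms(2-5) by simp
  then show ?thesis
    by (elim exE conjE) (rule that, assumption+, erule (1) bspec)
qed

lemma lifting_chart_unique:
  assumes "lifting_chart m U X \<phi>" "smooth_between k W m U \<sigma>" "smooth_between k W m U \<tau>" "v \<in> W"
    "\<sigma> v = \<tau> v" "\<And>w. w \<in> W \<Longrightarrow> \<phi> (\<sigma> w) = \<phi> (\<tau> w)"
  obtains W' where "openE k W'" "v \<in> W'" "W' \<subseteq> W" "\<And>w. w \<in> W' \<Longrightarrow> \<sigma> w = \<tau> w"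
proof -
  have "\<exists>W'. openE k W' \<and> v \<in> W' \<and> W' \<subseteq> W \<and> (\<forall>w\<in>W'. \<sigma> w = \<tau> w)"
    using assms(1)[unfolded lifting_chart_def, THEN conjunct2, THEN conjunct2, THEN conjunct2, THEN conjunct2]
      assms(2-6) by simp
  then show ?thesis
    by (elim exE conjE) (rule that, assumption+, erule (1) bspec)
qed

section \<open>Plots of domains, subspaces and pullbacks in explicit form\<close>

lemma points_domain_space [simp]: "points (domain_space n U) = U"
  by (simp add: domain_space_def)

lemma plots_domain_space:
  "(k, V, F) \<in> plots (domain_space n U) \<longleftrightarrow> F \<in> extensional V \<and> smooth_between k V n U F"
  by (simp add: domain_space_def)

lemma points_dsubspace [simp]: "points (dsubspace X A) = A"
  by (simp add: dsubspace_def)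

lemma plots_dsubspace:
  "(k, V, P) \<in> plots (dsubspace X A) \<longleftrightarrow> (k, V, P) \<in> plots X \<and> P ` V \<subseteq> A"
  by (simp add: dsubspace_def)

lemma smooth_between_restrict:
  "smooth_between m U n V (restrict F U) \<longleftrightarrow> smooth_between m U n V F"
proof
  show "smooth_between m U n V F" if "smooth_between m U n V (restrict F U)"
    by (rule smooth_between_cong[OF that]) simp
  show "smooth_between m U n V (restrict F U)" if "smooth_between m U n V F"
    by (rule smooth_between_cong[OF that]) simp
qed

lemma compose_restrict [simp]: "compose V f (restrict F V) = compose V f F"
  by (auto simp: compose_def)

lemma smooth_plot:
  "smooth X Y f \<Longrightarrow> (n, U, P) \<in> plots X \<Longrightarrow> (n, U, compose U f P) \<in> plots Y"
  unfolding smooth_def by blast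

lemma smooth_domain_space_iff:
  "smooth (domain_space m U) X \<phi> \<longleftrightarrow> \<phi> \<in> U \<rightarrow> points X \<and>
     (\<forall>k V F. smooth_between k V m U F \<longrightarrow> (k, V, compose V \<phi> F) \<in> plots X)"
proof -
  have "(k, V, compose V \<phi> F) \<in> plots X"
    if "smooth (domain_space m U) X \<phi>" "smooth_between k V m U F" for k V F
  proof -
    have "(k, V, restrict F V) \<in> plots (domain_space m U)"
      using that(2) by (simp add: plots_domain_space smooth_between_restrict)
    from smooth_plot[OF that(1) this] show ?thesis by simp
  qed
  then show ?thesis
    by (auto simp: smooth_def plots_domain_space)
qed

lemma plots_dproduct_domain:
  "(l, W, R) \<in> plots (dproduct (domain_space k V) (domain_space m U)) \<longleftrightarrow> R \<in> extensional W \<and>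
     smooth_between l W k V (\<lambda>w. fst (R w)) \<and> smooth_between l W m U (\<lambda>w. snd (R w))"
  by (simp add: dproduct_def plots_domain_space compose_def smooth_between_restrict)

lemma points_pullback:
  "points (dpullback (domain_space m U) (domain_space k V) \<phi> P) = {(z, x). z \<in> V \<and> x \<in> U \<and> P z = \<phi> x}"
  by (simp add: dpullback_def)

lemma plots_pullback:
  "(l, W, R) \<in> plots (dpullback (domain_space m U) (domain_space k V) \<phi> P) \<longleftrightarrow> R \<in> extensional W \<and>
     smooth_between l W k V (\<lambda>w. fst (R w)) \<and> smooth_between l W m U (\<lambda>w. snd (R w)) \<and>
     (\<forall>w\<in>W. P (fst (R w)) = \<phi> (snd (R w)))"
proof -
  have "fst (R w) \<in> V" "snd (R w) \<in> U"
    if "smooth_between l W k V (\<lambda>w. fst (R w))" "smooth_between l W m U (\<lambda>w. snd (R w))" "w \<in> W" for w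
    using smooth_betweenD(3) that by blast+
  then show ?thesis
    by (auto simp: dpullback_def plots_dsubspace plots_dproduct_domain image_subset_iff split_beta)
qed

lemma D_open_vimage:
  "D_open X A \<Longrightarrow> (n, U, P) \<in> plots X \<Longrightarrow> openE n {u \<in> U. P u \<in> A}"
  unfolding D_open_def by blast

lemma D_open_domain:
  assumes "openE k V"
  shows "D_open (domain_space k V) B \<longleftrightarrow> openE k B \<and> B \<subseteq> V"
proof
  assume B: "D_open (domain_space k V) B"
  then have sub: "B \<subseteq> V"
    by (simp add: D_open_def)
  have "(k, V, restrict (\<lambda>x. x) V) \<in> plots (domain_space k V)"
    using assms by (simp add: plots_domain_space smooth_between_restrict smooth_between_id)
  from D_open_vimage[OF B this] have "openE k {u \<in> V. restrict (\<lambda>x. x) V u \<in> B}" .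
  moreover have "{u \<in> V. restrict (\<lambda>x. x) V u \<in> B} = B"
    using sub by auto
  ultimately show "openE k B \<and> B \<subseteq> V"
    using sub by simp
next
  assume "openE k B \<and> B \<subseteq> V"
  then show "D_open (domain_space k V) B"
    by (auto simp: D_open_def plots_domain_space intro: smooth_between_vimage)
qed

section \<open>Equivalence of etale charts with unique local lifting\<close>

lemma etaleD:
  assumes "etale X Y f" "x \<in> points X"
  obtains A B where "D_open X A" "x \<in> A" "D_open Y B" "f x \<in> B"
    "diffeomorphism (dsubspace X A) (dsubspace Y B) f"
  using assms unfolding etale_def by blast

lemma diffeological_etale_pullback:
  "diffeological_etale X Y f \<Longrightarrow> (n, U, P) \<in> plots Y \<Longrightarrow>
     etale (dpullback X (domain_space n U) f P) (domain_space n U) fst"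
  unfolding diffeological_etale_def by blast

lemma plot_domain:
  assumes "diffeological_space X" "(k, V, P) \<in> plots X"
  shows "openE k V" "P \<in> extensional V" "v \<in> V \<Longrightarrow> P v \<in> points X"
  using assms unfolding diffeological_space_def parametrizations_def by (auto simp: subset_iff PiE_def)

text \<open>A lift of \<open>P\<close> is the second component of a local inverse of the projection
  from the pullback along \<open>P\<close>. For uniqueness the pullback is taken along
  \<open>\<phi> \<circ> \<sigma>\<close> itself: the graphs of both lifts are plots of it through
  the same point, near which the projection is injective.\<close>

lemma etale_imp_lifting_chart:
  assumes X: "diffeological_space X" and U: "openE m U"
    and e: "diffeological_etale (domain_space m U) X \<phi>"
  shows "lifting_chart m U X \<phi>"
  unfolding lifting_chart_def
proof (intro conjI allI impI)
  have sm: "smooth (domain_space m U) X \<phi>"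
    using e by (simp add: diffeological_etale_def)
  then show "\<phi> \<in> U \<rightarrow> points X"
    by (simp add: smooth_domain_space_iff)
  show pl: "(k, V, compose V \<phi> F) \<in> plots X" if "smooth_between k V m U F" for k V F
    using sm that by (simp add: smooth_domain_space_iff)
  show "\<exists>W \<sigma>. W \<subseteq> V \<and> v \<in> W \<and> smooth_between k W m U \<sigma> \<and> \<sigma> v = u \<and> (\<forall>w\<in>W. \<phi> (\<sigma> w) = P w)"
    if P: "(k, V, P) \<in> plots X" and v: "v \<in> V" and u: "u \<in> U" and uv: "\<phi> u = P v" for k V P v u
  proof -
    let ?Z = "dpullback (domain_space m U) (domain_space k V) \<phi> P"
    note V = plot_domain(1)[OF X P]
    have vu: "(v, u) \<in> points ?Z"
      using v u uv by (simp add: points_pullback)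
    obtain A B where A: "(v, u) \<in> A" and B: "D_open (domain_space k V) B" "v \<in> B"
      and diff: "diffeomorphism (dsubspace ?Z A) (dsubspace (domain_space k V) B) fst"
      by (rule etaleD[OF diffeological_etale_pullback[OF e P] vu]) (rule that, simp_all)
    have Bo: "openE k B" "B \<subseteq> V"
      using B(1) D_open_domain[OF V] by auto
    define s where "s = inv_into A (fst :: rvec \<times> rvec \<Rightarrow> rvec)"
    have bij: "bij_betw fst A B" and ss: "smooth (dsubspace (domain_space k V) B) (dsubspace ?Z A) s"
      using diff by (auto simp: diffeomorphism_def s_def)
    have "(k, B, restrict (\<lambda>x. x) B) \<in> plots (dsubspace (domain_space k V) B)"
      using Bo V by (simp add: plots_dsubspace plots_domain_space smooth_between_restrict smooth_between_id)
    from smooth_plot[OF ss this] have "(k, B, restrict s B) \<in> plots (dsubspace ?Z A)"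
      by (simp add: compose_def cong: restrict_cong)
    then have pz: "smooth_between k B m U (\<lambda>w. snd (restrict s B w))"
      "\<forall>w\<in>B. P (fst (restrict s B w)) = \<phi> (snd (restrict s B w))"
      by (simp_all add: plots_dsubspace plots_pullback)
    have "smooth_between k B m U (\<lambda>w. snd (s w))"
      by (rule smooth_between_cong[OF pz(1)]) simp
    moreover have "s v = (v, u)"
      using inv_into_f_f[OF bij_betw_imp_inj_on[OF bij] A] by (simp add: s_def)
    moreover have "fst (s w) = w" if "w \<in> B" for w
      unfolding s_def by (rule bij_betw_inv_into_right[OF bij that])
    ultimately show ?thesis
      using Bo(2) B(2) pz(2) by (intro exI[of _ B] exI[of _ "\<lambda>w. snd (s w)"]) simp
  qed
  show "\<exists>W'. openE k W' \<and> v \<in> W' \<and> W' \<subseteq> W \<and> (\<forall>w\<in>W'. \<sigma> w = \<tau> w)"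
    if \<sigma>: "smooth_between k W m U \<sigma>" and \<tau>: "smooth_between k W m U \<tau>" and v: "v \<in> W"
      and eq: "\<sigma> v = \<tau> v" "\<forall>w\<in>W. \<phi> (\<sigma> w) = \<phi> (\<tau> w)" for k W \<sigma> \<tau> v
  proof -
    let ?P = "compose W \<phi> \<sigma>"
    let ?Z = "dpullback (domain_space m U) (domain_space k W) \<phi> ?P"
    note P = pl[OF \<sigma>] and W = smooth_betweenD(1)[OF \<sigma>]
    have v\<sigma>: "(v, \<sigma> v) \<in> points ?Z"
      using v smooth_betweenD(3)[OF \<sigma> v] by (simp add: points_pullback compose_eq)
    obtain A B where A: "D_open ?Z A" "(v, \<sigma> v) \<in> A"
      and diff: "diffeomorphism (dsubspace ?Z A) (dsubspace (domain_space k W) B) fst"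
      by (rule etaleD[OF diffeological_etale_pullback[OF e P] v\<sigma>]) (rule that, simp_all)
    have inj: "inj_on fst A"
      using diff by (auto simp: diffeomorphism_def bij_betw_def)
    have plot: "(k, W, restrict (\<lambda>w. (w, \<rho> w)) W) \<in> plots ?Z"
      if "smooth_between k W m U \<rho>" "\<forall>w\<in>W. \<phi> (\<sigma> w) = \<phi> (\<rho> w)" for \<rho>
    proof -
      have "smooth_between k W k W (\<lambda>w. fst (restrict (\<lambda>w. (w, \<rho> w)) W w))"
        by (rule smooth_between_cong[OF smooth_between_id[OF W W]]) auto
      moreover have "smooth_between k W m U (\<lambda>w. snd (restrict (\<lambda>w. (w, \<rho> w)) W w))"
        by (rule smooth_between_cong[OF that(1)]) auto
      ultimately show ?thesis
        using that(2) by (simp add: plots_pullback compose_eq)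
    qed
    \<comment> \<open>The parameters for which both graphs run in the sheet \<open>A\<close>, on
      which \<open>fst\<close> is injective.\<close>
    define W' where "W' = {w \<in> W. restrict (\<lambda>w. (w, \<sigma> w)) W w \<in> A} \<inter> {w \<in> W. restrict (\<lambda>w. (w, \<tau> w)) W w \<in> A}"
    have "openE k W'"
      unfolding W'_def by (intro openin_Int D_open_vimage[OF A(1)] plot \<sigma> \<tau> eq) simp
    moreover have "v \<in> W'"
      using A(2) v eq(1) by (simp add: W'_def)
    moreover have "\<sigma> w = \<tau> w" if "w \<in> W'" for w
      using inj_onD[OF inj, of "(w, \<sigma> w)" "(w, \<tau> w)"] that by (simp add: W'_def split: if_splits)
    moreover have "W' \<subseteq> W"
      by (auto simp: W'_def)
    ultimately show ?thesis
      by (intro exI[of _ W'] conjI ballI)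
  qed
qed (rule U)

text \<open>The sheets of the pullback are the graphs of local lifts. A graph is D-open by
  uniqueness: along any plot of the pullback, the second component and the lift applied to the first
  component have the same image under \<open>\<phi>\<close>, so they agree near each parameter where
  they agree.\<close>

lemma lifting_chart_imp_etale:
  assumes X: "diffeological_space X" and c: "lifting_chart m U X \<phi>"
  shows "diffeological_etale (domain_space m U) X \<phi>"
proof -
  have sm: "smooth (domain_space m U) X \<phi>"
    using lifting_chartD[OF c] by (auto simp: smooth_domain_space_iff)
  have "etale (dpullback (domain_space m U) (domain_space k V) \<phi> P) (domain_space k V) fst"
    (is "etale ?Z _ _") if P: "(k, V, P) \<in> plots X" for k V P
    unfolding etale_def
  proof (intro conjI ballI)
    note V = plot_domain(1)[OF X P]
    show "fst \<in> points ?Z \<rightarrow> points (domain_space k V)"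
      by (auto simp: points_pullback)
    fix z assume "z \<in> points ?Z"
    then obtain v u where z: "z = (v, u)" and vu: "v \<in> V" "u \<in> U" "\<phi> u = P v"
      by (auto simp: points_pullback)
    obtain W \<sigma> where W: "W \<subseteq> V" "v \<in> W" and \<sigma>: "smooth_between k W m U \<sigma>" "\<sigma> v = u"
      "\<And>w. w \<in> W \<Longrightarrow> \<phi> (\<sigma> w) = P w"
      by (rule lifting_chart_lift[OF c P vu]) (rule that)
    note Wo = smooth_betweenD(1)[OF \<sigma>(1)]
    define A where "A = (\<lambda>w. (w, \<sigma> w)) ` W"
    have A_iff: "p \<in> A \<longleftrightarrow> fst p \<in> W \<and> snd p = \<sigma> (fst p)" for p
      by (cases p) (auto simp: A_def)
    have "D_open ?Z A"
      unfolding D_open_def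
    proof (intro conjI)
      show "A \<subseteq> points ?Z"
        using W(1) \<sigma>(3) smooth_betweenD(3)[OF \<sigma>(1)] by (auto simp: A_def points_pullback)
      have "openE l {t \<in> T. R t \<in> A}" if R: "(l, T, R) \<in> plots ?Z" for l T R
      proof (subst openin_subopen, intro ballI)
        fix t0 assume t0: "t0 \<in> {t \<in> T. R t \<in> A}"
        have R': "smooth_between l T k V (\<lambda>w. fst (R w))" "smooth_between l T m U (\<lambda>w. snd (R w))"
          "\<And>w. w \<in> T \<Longrightarrow> P (fst (R w)) = \<phi> (snd (R w))"
          using R by (simp_all add: plots_pullback)
        define T1 where "T1 = {t \<in> T. fst (R t) \<in> W}"
        have T1: "openE l T1"
          unfolding T1_def by (rule smooth_between_vimage[OF R'(1) Wo])
        have 1: "smooth_between l T1 m U (\<lambda>t. snd (R t))"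
          by (rule smooth_between_subset[OF R'(2) T1])
            (use lifting_chartD(1)[OF c] smooth_betweenD(3)[OF R'(2)] in \<open>auto simp: T1_def\<close>)
        have "smooth_between l T1 k W (\<lambda>t. fst (R t))"
          by (rule smooth_between_subset[OF R'(1) T1 _ Wo]) (auto simp: T1_def)
        from smooth_between_compose[OF \<sigma>(1) this]
        have 2: "smooth_between l T1 m U (\<lambda>t. \<sigma> (fst (R t)))" .
        obtain W' where W': "openE l W'" "t0 \<in> W'" "W' \<subseteq> T1" "\<And>t. t \<in> W' \<Longrightarrow> snd (R t) = \<sigma> (fst (R t))"
        proof (rule lifting_chart_unique[OF c 1 2])
          show "t0 \<in> T1" "snd (R t0) = \<sigma> (fst (R t0))"
            using t0 by (auto simp: T1_def A_iff)
          show "\<phi> (snd (R w)) = \<phi> (\<sigma> (fst (R w)))" if "w \<in> T1" for w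
            using that R'(3)[of w] \<sigma>(3)[of "fst (R w)"] by (simp add: T1_def)
        qed (rule that)
        then have "W' \<subseteq> {t \<in> T. R t \<in> A}"
          by (auto simp: A_iff T1_def)
        with W'(1,2) show "\<exists>T'. openE l T' \<and> t0 \<in> T' \<and> T' \<subseteq> {t \<in> T. R t \<in> A}"
          by blast
      qed
      then show "\<forall>(l, T, R)\<in>plots ?Z. openE l {t \<in> T. R t \<in> A}"
        by blast
    qed
    moreover have "z \<in> A"
      using W(2) \<sigma>(2) z by (simp add: A_iff)
    moreover have "D_open (domain_space k V) W"
      using D_open_domain[OF V] Wo W(1) by blast
    moreover have "fst z \<in> W"
      using W(2) z by simp
    moreover have "diffeomorphism (dsubspace ?Z A) (dsubspace (domain_space k V) W) fst"
      unfolding diffeomorphism_def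
    proof (intro conjI)
      have plot: "(l, T, compose T fst R) \<in> plots (dsubspace (domain_space k V) W)"
        if "(l, T, R) \<in> plots (dsubspace ?Z A)" for l T R
        using that by (auto simp: plots_dsubspace plots_pullback plots_domain_space compose_def
            smooth_between_restrict A_iff image_subset_iff)
      then show "smooth (dsubspace ?Z A) (dsubspace (domain_space k V) W) fst"
        unfolding smooth_def by (auto simp: A_iff)
      show bij: "bij_betw fst (points (dsubspace ?Z A)) (points (dsubspace (domain_space k V) W))"
        by (auto simp: bij_betw_def inj_on_def A_def image_image)
      have inv: "inv_into A fst w = (w, \<sigma> w)" if "w \<in> W" for w
        using inv_into_f_f[OF bij_betw_imp_inj_on[OF bij], of "(w, \<sigma> w)"] that by (simp add: A_iff)
      have "(l, T, compose T (inv_into A fst) F) \<in> plots (dsubspace ?Z A)"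
        if F: "(l, T, F) \<in> plots (dsubspace (domain_space k V) W)" for l T F
      proof -
        have F': "smooth_between l T k V F" "\<And>t. t \<in> T \<Longrightarrow> F t \<in> W"
          using F by (auto simp: plots_dsubspace plots_domain_space)
        have FW: "smooth_between l T k W F"
          by (rule smooth_between_subset[OF F'(1) smooth_betweenD(1)[OF F'(1)] _ Wo F'(2)]) auto
        have eq: "compose T (inv_into A fst) F t = (F t, \<sigma> (F t))" if "t \<in> T" for t
          using that inv[OF F'(2)[OF that]] by (simp add: compose_eq)
        have "smooth_between l T k V (\<lambda>t. fst (compose T (inv_into A fst) F t))"
          by (rule smooth_between_cong[OF F'(1)]) (simp add: eq)
        moreover have "smooth_between l T m U (\<lambda>t. snd (compose T (inv_into A fst) F t))"
          by (rule smooth_between_cong[OF smooth_between_compose[OF \<sigma>(1) FW]]) (simp add: eq)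
        moreover have "compose T (inv_into A fst) F \<in> extensional T"
          by (simp add: compose_def)
        ultimately show ?thesis
          using F'(2) \<sigma>(3) by (auto simp: plots_dsubspace plots_pullback eq A_iff)
      qed
      then show "smooth (dsubspace (domain_space k V) W) (dsubspace ?Z A) (inv_into (points (dsubspace ?Z A)) fst)"
        unfolding smooth_def by (auto simp: inv A_iff)
    qed
    ultimately show "\<exists>A B. D_open ?Z A \<and> z \<in> A \<and> D_open (domain_space k V) B \<and> fst z \<in> B \<and>
        diffeomorphism (dsubspace ?Z A) (dsubspace (domain_space k V) B) fst"
      by (intro exI[of _ A] exI[of _ W] conjI)
  qed
  with sm show ?thesis
    unfolding diffeological_etale_def by blast
qed

text \<open>The single rule behind every later change of coordinates: restriction, translation,
  exchange of coordinates, replacement of one coordinate, shear. \<open>h\<close> maps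
  \<open>V\<close> diffeomorphically onto the open part \<open>U'\<close> of the old domain, with
  inverse \<open>\<alpha>\<close>.\<close>

lemma lifting_chart_compose:
  assumes c: "lifting_chart m U X \<phi>" and h: "smooth_between m V m U h"
    and \<alpha>: "smooth_between m U' m V \<alpha>" and sub: "U' \<subseteq> U"
    and hV: "\<And>v. v \<in> V \<Longrightarrow> h v \<in> U'" and \<alpha>h: "\<And>v. v \<in> V \<Longrightarrow> \<alpha> (h v) = v"
    and h\<alpha>: "\<And>u. u \<in> U' \<Longrightarrow> h (\<alpha> u) = u"
  shows "lifting_chart m V X (\<lambda>v. \<phi> (h v))"
  unfolding lifting_chart_def
proof (intro conjI allI impI)
  note h' = smooth_betweenD[OF h] and U' = smooth_betweenD(1)[OF \<alpha>]
  show "openE m V" by (rule h')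
  show "(\<lambda>v. \<phi> (h v)) \<in> V \<rightarrow> points X"
    using lifting_chartD(2)[OF c] h'(3) by blast
  show "(k, T, compose T (\<lambda>v. \<phi> (h v)) F) \<in> plots X" if "smooth_between k T m V F" for k T F
    using lifting_chartD(3)[OF c smooth_between_compose[OF h that]] by (simp add: compose_def)
  show "\<exists>W \<sigma>. W \<subseteq> T \<and> t \<in> W \<and> smooth_between k W m V \<sigma> \<and> \<sigma> t = v \<and> (\<forall>w\<in>W. \<phi> (h (\<sigma> w)) = P w)"
    if P: "(k, T, P) \<in> plots X" and t: "t \<in> T" and v: "v \<in> V" and eq: "\<phi> (h v) = P t" for k T P t v
  proof -
    obtain W \<sigma> where W: "W \<subseteq> T" "t \<in> W" and \<sigma>: "smooth_between k W m U \<sigma>" "\<sigma> t = h v"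
      "\<And>w. w \<in> W \<Longrightarrow> \<phi> (\<sigma> w) = P w"
      by (rule lifting_chart_lift[OF c P t h'(3)[OF v] eq]) (rule that)
    \<comment> \<open>A lift through the old chart may leave \<open>U'\<close>, where
      \<open>\<alpha>\<close> is defined; it starts there, at \<open>h v\<close>.\<close>
    define W1 where "W1 = {w \<in> W. \<sigma> w \<in> U'}"
    have W1: "openE k W1"
      unfolding W1_def by (rule smooth_between_vimage[OF \<sigma>(1) U'])
    have "smooth_between k W1 m U' \<sigma>"
      by (rule smooth_between_subset[OF \<sigma>(1) W1 _ U']) (auto simp: W1_def)
    from smooth_between_compose[OF \<alpha> this]
    have "smooth_between k W1 m V (\<lambda>w. \<alpha> (\<sigma> w))" .
    then show ?thesis
      using W \<sigma>(2,3) \<alpha>h[OF v] h\<alpha> hV[OF v]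
      by (intro exI[of _ W1] exI[of _ "\<lambda>w. \<alpha> (\<sigma> w)"]) (auto simp: W1_def)
  qed
  show "\<exists>W'. openE k W' \<and> v \<in> W' \<and> W' \<subseteq> W \<and> (\<forall>w\<in>W'. \<sigma> w = \<tau> w)"
    if \<sigma>: "smooth_between k W m V \<sigma>" and \<tau>: "smooth_between k W m V \<tau>" and v: "v \<in> W"
      and eq: "\<sigma> v = \<tau> v" "\<forall>w\<in>W. \<phi> (h (\<sigma> w)) = \<phi> (h (\<tau> w))" for k W \<sigma> \<tau> v
  proof -
    obtain W' where W': "openE k W'" "v \<in> W'" "W' \<subseteq> W" "\<And>w. w \<in> W' \<Longrightarrow> h (\<sigma> w) = h (\<tau> w)"
      by (rule lifting_chart_unique[OF c smooth_between_compose[OF h \<sigma>] smooth_between_compose[OF h \<tau>] v])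
        (use eq in simp, use eq(2) in blast, rule that)
    have "\<sigma> w = \<tau> w" if "w \<in> W'" for w
      using W'(4)[OF that] \<alpha>h smooth_betweenD(3)[OF \<sigma>] smooth_betweenD(3)[OF \<tau>] W'(3) that
      by (metis subsetD)
    then show ?thesis
      by (intro exI[of _ W'] conjI ballI W'(1-3))
  qed
qed

lemma lifting_chart_subset:
  assumes c: "lifting_chart m U X \<phi>" and V: "openE m V" "V \<subseteq> U"
  shows "lifting_chart m V X \<phi>"
  by (rule lifting_chart_compose[OF c smooth_between_id[OF V(1) lifting_chartD(1)[OF c] V(2)]
        smooth_between_id[OF V(1) V(1) order_refl] V(2)]) (assumption | rule refl)+

lemma etale_manifold_chart:
  assumes M: "diffeological_etale_manifold m M" and x: "x \<in> points M"
  obtains U \<phi> u where "lifting_chart m U M \<phi>" "u \<in> U" "\<phi> u = x"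
proof -
  obtain \<A> where X: "diffeological_space M"
    and A: "\<forall>(U, \<phi>)\<in>\<A>. openE m U \<and> diffeological_etale (domain_space m U) M \<phi>"
    and cover: "(\<Union>(U, \<phi>)\<in>\<A>. \<phi> ` U) = points M"
    using M unfolding diffeological_etale_manifold_def by (elim exE conjE) (rule that)
  obtain U \<phi> u where u: "(U, \<phi>) \<in> \<A>" "u \<in> U" "\<phi> u = x"
    using x unfolding cover[symmetric] by blast
  then have "openE m U" "diffeological_etale (domain_space m U) M \<phi>"
    using A by auto
  then have "lifting_chart m U M \<phi>"
    by (rule etale_imp_lifting_chart[OF X])
  then show ?thesis
    using u(2,3) by (rule that)
qed

section \<open>Linear algebra in internal tangent spaces\<close>

lemma field_real_ring: "Ring.field real_ring"
proof -
  have "cring real_ring"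
  proof (rule cringI)
    show "abelian_group real_ring"
      by (rule abelian_groupI) (auto intro: exI[of _ "- _"] add.left_inverse)
    show "Group.comm_monoid real_ring"
      by (rule comm_monoidI) auto
  qed (auto simp: distrib_right)
  then show ?thesis
  proof (rule cring.cring_fieldI2)
    show "\<exists>b\<in>carrier real_ring. a \<otimes>\<^bsub>real_ring\<^esub> b = \<one>\<^bsub>real_ring\<^esub>"
      if "a \<noteq> \<zero>\<^bsub>real_ring\<^esub>" for a
      using that by (intro bexI[of _ "inverse a"]) auto
  qed auto
qed

lemma cring_real_ring: "cring real_ring"
  using field_real_ring by (simp add: field_def domain_def)

section \<open>The direct sum over centered plots and the kernel of the colimit\<close>

lemma carrier_tangent_sum:
  "c \<in> carrier (tangent_sum X x) \<longleftrightarrow> finite {p. c p \<noteq> origin} \<and>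
     (\<forall>p. p \<notin> centered_plots X x \<longrightarrow> c p = origin) \<and> (\<forall>n U P. c (n, U, P) \<in> rspace n)"
  by (simp add: tangent_sum_def)

lemma tangent_sum_ops [simp]:
  "add (tangent_sum X x) c d = (\<lambda>p i. c p i + d p i)"
  "smult (tangent_sum X x) r c = (\<lambda>p i. r * c p i)"
  "zero (tangent_sum X x) = (\<lambda>_ _. 0)"
  by (simp_all add: tangent_sum_def)

lemma finite_support_add:
  fixes c d :: "'p \<Rightarrow> rvec"
  assumes "finite {p. c p \<noteq> origin}" "finite {p. d p \<noteq> origin}"
  shows "finite {p. (\<lambda>i. c p i + d p i) \<noteq> origin}"
  by (rule finite_subset[OF _ finite_UnI[OF assms]]) (auto simp: fun_eq_iff)

lemma finite_support_scale:
  fixes c :: "'p \<Rightarrow> rvec"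
  assumes "finite {p. c p \<noteq> origin}"
  shows "finite {p. (\<lambda>i. r * c p i) \<noteq> origin}"
  by (rule finite_subset[OF _ assms]) (auto simp: fun_eq_iff)

lemma tangent_sum_add_closed:
  "c \<in> carrier (tangent_sum X x) \<Longrightarrow> d \<in> carrier (tangent_sum X x) \<Longrightarrow>
     (\<lambda>p i. c p i + d p i) \<in> carrier (tangent_sum X x)"
  using finite_support_add[of c d] by (auto simp: carrier_tangent_sum rspace_iff)

lemma tangent_sum_scale_closed:
  "c \<in> carrier (tangent_sum X x) \<Longrightarrow> (\<lambda>p i. r * c p i) \<in> carrier (tangent_sum X x)"
  using finite_support_scale[of c r] by (auto simp: carrier_tangent_sum rspace_iff)

lemma tangent_sum_zero_closed: "(\<lambda>_ _. 0) \<in> carrier (tangent_sum X x)"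
  by (simp add: carrier_tangent_sum rspace_iff)

lemma module_tangent_sum: "Module.module real_ring (tangent_sum X x)"
proof (rule module_criteria[OF cring_real_ring])
  show "\<forall>v\<in>carrier (tangent_sum X x). \<exists>w\<in>carrier (tangent_sum X x).
      add (tangent_sum X x) v w = zero (tangent_sum X x)"
  proof
    fix v assume "v \<in> carrier (tangent_sum X x)"
    then show "\<exists>w\<in>carrier (tangent_sum X x). add (tangent_sum X x) v w = zero (tangent_sum X x)"
      by (intro bexI[of _ "\<lambda>p i. -1 * v p i"] tangent_sum_scale_closed) auto
  qed
qed (simp_all add: tangent_sum_add_closed tangent_sum_scale_closed tangent_sum_zero_closed
    algebra_simps)

lemma tangent_inj_carrier:
  assumes "(n, U, P) \<in> centered_plots X x" "v \<in> rspace n"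
  shows "tangent_inj (n, U, P) v \<in> carrier (tangent_sum X x)"
proof -
  have "finite {p. tangent_inj (n, U, P) v p \<noteq> origin}"
    by (rule finite_subset[of _ "{(n, U, P)}"]) (auto simp: tangent_inj_def)
  with assms show ?thesis
    by (auto simp: carrier_tangent_sum tangent_inj_def rspace_iff)
qed

lemma tangent_relators_carrier: "tangent_relators X x \<subseteq> carrier (tangent_sum X x)"
proof
  fix c assume "c \<in> tangent_relators X x"
  then obtain m V Q n U P W F v where
    c: "c = (\<lambda>p i. tangent_inj (m, V, Q) v p i - tangent_inj (n, U, P) (differential m n F origin v) p i)"
    and Q: "(m, V, Q) \<in> centered_plots X x" "v \<in> rspace m" and P: "(n, U, P) \<in> centered_plots X x"
    unfolding tangent_relators_def by blast
  have "(\<lambda>p i. tangent_inj (m, V, Q) v p i + -1 * tangent_inj (n, U, P) (differential m n F origin v) p i)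
      \<in> carrier (tangent_sum X x)"
    by (intro tangent_sum_add_closed tangent_sum_scale_closed[where r = "-1"]
        tangent_inj_carrier Q P differential_rspace)
  then show "c \<in> carrier (tangent_sum X x)"
    by (simp add: c)
qed

lemma tangent_kernel_submodule: "submodule real_ring (tangent_kernel X x) (tangent_sum X x)"
  unfolding tangent_kernel_def
  by (rule module.span_is_submodule[OF module_tangent_sum tangent_relators_carrier])

lemma tangent_kernel_closed:
  "c \<in> tangent_kernel X x \<Longrightarrow> d \<in> tangent_kernel X x \<Longrightarrow> (\<lambda>p i. c p i + d p i) \<in> tangent_kernel X x"
  "c \<in> tangent_kernel X x \<Longrightarrow> (\<lambda>p i. r * c p i) \<in> tangent_kernel X x"
  "(\<lambda>_ _. 0) \<in> tangent_kernel X x"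
  using submodule.m_closed[OF tangent_kernel_submodule[of X x], of c d]
    submodule.smult_closed[OF tangent_kernel_submodule[of X x], of r c]
    submodule.zero_closed[OF tangent_kernel_submodule[of X x]]
  by simp_all

lemma tangent_kernel_relator: "c \<in> tangent_relators X x \<Longrightarrow> c \<in> tangent_kernel X x"
  unfolding tangent_kernel_def
  by (rule subsetD[OF module.in_own_span[OF module_tangent_sum tangent_relators_carrier]])

text \<open>The elements of the direct sum with property \<open>Q\<close> form a submodule that
  contains the relators, hence their span.\<close>

lemma tangent_kernel_induct:
  assumes c: "c \<in> tangent_kernel X x"
    and relator: "\<And>c. c \<in> tangent_relators X x \<Longrightarrow> Q c"
    and zero: "Q (\<lambda>_ _. 0)"
    and add: "\<And>c d. Q c \<Longrightarrow> Q d \<Longrightarrow> Q (\<lambda>p i. c p i + d p i)"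
    and scale: "\<And>r c. Q c \<Longrightarrow> Q (\<lambda>p i. r * c p i)"
  shows "Q c"
proof -
  define N where "N = {c \<in> carrier (tangent_sum X x). Q c}"
  have "submodule real_ring N (tangent_sum X x)"
    by (rule submodule.intro[OF module_tangent_sum])
      (auto simp: N_def tangent_sum_add_closed tangent_sum_scale_closed tangent_sum_zero_closed
        zero add scale)
  moreover have "tangent_relators X x \<subseteq> N"
    using relator tangent_relators_carrier[of X x] by (auto simp: N_def)
  ultimately have "tangent_kernel X x \<subseteq> N"
    unfolding tangent_kernel_def by (intro module.span_is_subset[OF module_tangent_sum])
  with c show ?thesis
    by (auto simp: N_def)
qed

text \<open>Extends \<open>plot_differential\<close> from single summands to the whole direct sum,
  so that the operations of the quotient can be computed on representatives.\<close>

definition tangent_class :: "'a dspace \<Rightarrow> 'a \<Rightarrow> ('a param \<Rightarrow> rvec) \<Rightarrow> ('a param \<Rightarrow> rvec) set" where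
  "tangent_class X x c = tangent_kernel X x +>\<^bsub>tangent_sum X x\<^esub> c"

lemma tangent_class_image: "tangent_class X x c = (\<lambda>h p i. h p i + c p i) ` tangent_kernel X x"
  by (auto simp: tangent_class_def a_r_coset_def')

lemma tangent_class_memI:
  "h \<in> tangent_kernel X x \<Longrightarrow> (\<lambda>p i. h p i + c p i) \<in> tangent_class X x c"
  unfolding tangent_class_image by (rule imageI)

lemma tangent_class_memD:
  "d \<in> tangent_class X x c \<Longrightarrow> (\<lambda>p i. d p i - c p i) \<in> tangent_kernel X x"
  unfolding tangent_class_image by (auto simp: fun_eq_iff)

lemma tangent_class_mem_iff:
  "d \<in> tangent_class X x c \<longleftrightarrow> (\<lambda>p i. d p i - c p i) \<in> tangent_kernel X x"
  using tangent_class_memI[of "\<lambda>p i. d p i - c p i" X x c] tangent_class_memD[of d X x c] by auto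

lemma tangent_class_eq_iff:
  "tangent_class X x c = tangent_class X x d \<longleftrightarrow> (\<lambda>p i. c p i - d p i) \<in> tangent_kernel X x"
proof
  assume "tangent_class X x c = tangent_class X x d"
  moreover have "c \<in> tangent_class X x c"
    by (simp add: tangent_class_mem_iff tangent_kernel_closed(3))
  ultimately show "(\<lambda>p i. c p i - d p i) \<in> tangent_kernel X x"
    by (simp add: tangent_class_mem_iff)
next
  assume cd: "(\<lambda>p i. c p i - d p i) \<in> tangent_kernel X x"
  show "tangent_class X x c = tangent_class X x d"
  proof (rule Set.set_eqI)
    fix e
    have "(\<lambda>p i. e p i - d p i) \<in> tangent_kernel X x"
      if "(\<lambda>p i. e p i - c p i) \<in> tangent_kernel X x"
      using tangent_kernel_closed(1)[OF that cd] by simp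
    moreover have "(\<lambda>p i. e p i - c p i) \<in> tangent_kernel X x"
      if "(\<lambda>p i. e p i - d p i) \<in> tangent_kernel X x"
      using tangent_kernel_closed(1)[OF that tangent_kernel_closed(2)[OF cd, of "-1"]] by simp
    ultimately show "e \<in> tangent_class X x c \<longleftrightarrow> e \<in> tangent_class X x d"
      unfolding tangent_class_mem_iff by blast
  qed
qed

lemma carrier_internal_tangent_space:
  "carrier (internal_tangent_space X x) = tangent_class X x ` carrier (tangent_sum X x)"
  by (auto simp: internal_tangent_space_def quotient_module_def A_RCOSETS_def' tangent_class_def)

lemma zero_internal_tangent_space:
  "zero (internal_tangent_space X x) = tangent_class X x (\<lambda>_ _. 0)"
  by (simp add: internal_tangent_space_def quotient_module_def tangent_class_image)

lemma add_tangent_class: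
  "add (internal_tangent_space X x) (tangent_class X x c) (tangent_class X x d) =
     tangent_class X x (\<lambda>p i. c p i + d p i)"
proof -
  have "add (internal_tangent_space X x) (tangent_class X x c) (tangent_class X x d) =
      {\<lambda>p i. a p i + b p i | a b. a \<in> tangent_class X x c \<and> b \<in> tangent_class X x d}"
    by (auto simp: internal_tangent_space_def quotient_module_def set_add_def set_mult_def)
  also have "\<dots> = tangent_class X x (\<lambda>p i. c p i + d p i)"
  proof (intro Set.set_eqI iffI)
    fix e assume "e \<in> {\<lambda>p i. a p i + b p i | a b. a \<in> tangent_class X x c \<and> b \<in> tangent_class X x d}"
    then obtain a b where e: "e = (\<lambda>p i. a p i + b p i)"
      and ab: "(\<lambda>p i. a p i - c p i) \<in> tangent_kernel X x" "(\<lambda>p i. b p i - d p i) \<in> tangent_kernel X x"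
      unfolding tangent_class_mem_iff by blast
    show "e \<in> tangent_class X x (\<lambda>p i. c p i + d p i)"
      using tangent_kernel_closed(1)[OF ab] by (simp add: e tangent_class_mem_iff algebra_simps)
  next
    fix e assume "e \<in> tangent_class X x (\<lambda>p i. c p i + d p i)"
    then have "(\<lambda>p i. e p i - d p i) \<in> tangent_class X x c"
      by (simp add: tangent_class_mem_iff algebra_simps)
    moreover have "d \<in> tangent_class X x d"
      by (simp add: tangent_class_mem_iff tangent_kernel_closed(3))
    moreover have "e = (\<lambda>p i. (e p i - d p i) + d p i)"
      by simp
    ultimately show "e \<in> {\<lambda>p i. a p i + b p i | a b. a \<in> tangent_class X x c \<and> b \<in> tangent_class X x d}"
      by (intro CollectI exI[of _ "\<lambda>p i. e p i - d p i"] exI[of _ d] conjI)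
  qed
  finally show ?thesis .
qed

text \<open>Scalar multiplication in the quotient is a union over all representatives; the united
  sets coincide, and there is at least one because the kernel contains zero.\<close>

lemma smult_tangent_class:
  "smult (internal_tangent_space X x) r (tangent_class X x c) = tangent_class X x (\<lambda>p i. r * c p i)"
proof -
  have "smult (internal_tangent_space X x) r (tangent_class X x c) =
      (\<Union>a\<in>tangent_class X x c. tangent_class X x (\<lambda>p i. r * a p i))"
    by (simp add: internal_tangent_space_def quotient_module_def tangent_class_def)
  also have "\<dots> = (\<Union>a\<in>tangent_class X x c. tangent_class X x (\<lambda>p i. r * c p i))"
  proof (intro SUP_cong refl)
    fix a assume "a \<in> tangent_class X x c"
    then have "(\<lambda>p i. a p i - c p i) \<in> tangent_kernel X x"
      by (simp add: tangent_class_mem_iff)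
    from tangent_kernel_closed(2)[OF this, of r]
    show "tangent_class X x (\<lambda>p i. r * a p i) = tangent_class X x (\<lambda>p i. r * c p i)"
      by (simp add: tangent_class_eq_iff right_diff_distrib)
  qed
  also have "tangent_class X x c \<noteq> {}"
    using tangent_kernel_closed(3)[of X x] by (auto simp: tangent_class_image)
  then have "(\<Union>a\<in>tangent_class X x c. tangent_class X x (\<lambda>p i. r * c p i)) =
      tangent_class X x (\<lambda>p i. r * c p i)"
    by simp
  finally show ?thesis .
qed

lemma plot_differential_class: "plot_differential X x p v = tangent_class X x (tangent_inj p v)"
  by (simp add: plot_differential_def tangent_class_def)

lemma tangent_inj_linear:
  "tangent_inj p (\<lambda>i. v i + w i) = (\<lambda>q i. tangent_inj p v q i + tangent_inj p w q i)"
  "tangent_inj p (\<lambda>i. r * v i) = (\<lambda>q i. r * tangent_inj p v q i)"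
  "tangent_inj p origin = (\<lambda>_ _. 0)"
  by (auto simp: tangent_inj_def fun_eq_iff)

lemma plot_differential_add:
  "plot_differential X x p (\<lambda>i. v i + w i) =
     add (internal_tangent_space X x) (plot_differential X x p v) (plot_differential X x p w)"
  by (simp add: plot_differential_class tangent_inj_linear add_tangent_class)

lemma plot_differential_scale:
  "plot_differential X x p (\<lambda>i. r * v i) = smult (internal_tangent_space X x) r (plot_differential X x p v)"
  by (simp add: plot_differential_class tangent_inj_linear smult_tangent_class)

lemma plot_differential_zero: "plot_differential X x p origin = zero (internal_tangent_space X x)"
  by (simp add: plot_differential_class tangent_inj_linear zero_internal_tangent_space)

lemma plot_differential_carrier:
  "(n, U, P) \<in> centered_plots X x \<Longrightarrow> v \<in> rspace n \<Longrightarrow>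
     plot_differential X x (n, U, P) v \<in> carrier (internal_tangent_space X x)"
  by (simp add: plot_differential_class carrier_internal_tangent_space tangent_inj_carrier)

lemma plot_differential_morphism:
  assumes "(m, V, Q) \<in> centered_plots X x" "(n, U, P) \<in> centered_plots X x"
    and "plot_morphism (m, V, Q) (n, U, P) W F" "v \<in> rspace m"
  shows "plot_differential X x (m, V, Q) v = plot_differential X x (n, U, P) (differential m n F origin v)"
proof -
  have "(\<lambda>p i. tangent_inj (m, V, Q) v p i - tangent_inj (n, U, P) (differential m n F origin v) p i)
      \<in> tangent_relators X x"
    using assms unfolding tangent_relators_def by blast
  then show ?thesis
    unfolding plot_differential_class tangent_class_eq_iff by (rule tangent_kernel_relator)
qed

text \<open>A family of linear functionals that is compatible with the morphisms of plots descends to the colimit.\<close>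

lemma plot_differential_eqD:
  fixes D :: "'a param \<Rightarrow> rvec \<Rightarrow> real"
  assumes add: "\<And>p v w. D p (\<lambda>i. v i + w i) = D p v + D p w"
    and scale: "\<And>p r v. D p (\<lambda>i. r * v i) = r * D p v"
    and morphism: "\<And>m V Q n U P W F v. (m, V, Q) \<in> centered_plots X x \<Longrightarrow> (n, U, P) \<in> centered_plots X x \<Longrightarrow>
      plot_morphism (m, V, Q) (n, U, P) W F \<Longrightarrow> v \<in> rspace m \<Longrightarrow>
      D (m, V, Q) v = D (n, U, P) (differential m n F origin v)"
    and eq: "plot_differential X x p v = plot_differential X x q w"
  shows "D p v = D q w"
proof -
  \<comment> \<open>The functional that \<open>D\<close> induces on the direct sum; it has to vanish
    on the kernel.\<close>
  define \<Phi> where "\<Phi> c = (\<Sum>p | c p \<noteq> origin. D p (c p))" for c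
  have zero: "D p origin = 0" for p
    using scale[of p 0 origin] by simp
  have \<Phi>: "\<Phi> c = (\<Sum>p\<in>A. D p (c p))" if "finite A" "{p. c p \<noteq> origin} \<subseteq> A" for c A
    unfolding \<Phi>_def using that zero by (intro sum.mono_neutral_left) auto
  \<comment> \<open>Over an infinite support the sum in \<open>\<Phi>\<close> is \<open>0\<close> by
    convention and additivity can fail, so finite support is carried along in the induction over the
    kernel.\<close>
  define S where "S c \<longleftrightarrow> finite {p. c p \<noteq> origin}" for c :: "'a param \<Rightarrow> rvec"
  have \<Phi>_add: "\<Phi> (\<lambda>p i. c p i + d p i) = \<Phi> c + \<Phi> d" if "S c" "S d" for c d
  proof -
    let ?A = "{p. c p \<noteq> origin} \<union> {p. d p \<noteq> origin}"
    have A: "finite ?A"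
      using that by (simp add: S_def)
    have "{p. (\<lambda>i. c p i + d p i) \<noteq> origin} \<subseteq> ?A"
      by (auto simp: fun_eq_iff)
    from \<Phi>[OF A this] \<Phi>[OF A, of c] \<Phi>[OF A, of d] show ?thesis
      by (simp add: add sum.distrib)
  qed
  have \<Phi>_scale: "\<Phi> (\<lambda>p i. r * c p i) = r * \<Phi> c" if "S c" for r c
  proof -
    have A: "finite {p. c p \<noteq> origin}"
      using that by (simp add: S_def)
    have "{p. (\<lambda>i. r * c p i) \<noteq> origin} \<subseteq> {p. c p \<noteq> origin}"
      by (auto simp: fun_eq_iff)
    from \<Phi>[OF A this] \<Phi>[OF A, of c] show ?thesis
      by (simp add: scale sum_distrib_left)
  qed
  have S_inj: "S (tangent_inj p v)" for p :: "'a param" and v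
    unfolding S_def by (rule finite_subset[of _ "{p}"]) (auto simp: tangent_inj_def)
  have \<Phi>_inj: "\<Phi> (tangent_inj p v) = D p v" for p v
  proof -
    have "{q. tangent_inj p v q \<noteq> origin} \<subseteq> {p}"
      by (auto simp: tangent_inj_def)
    with \<Phi>[of "{p}" "tangent_inj p v"] show ?thesis
      by (simp add: tangent_inj_def)
  qed
  have S_add: "S (\<lambda>p i. c p i + d p i)" if "S c" "S d" for c d
    using that unfolding S_def by (rule finite_support_add)
  have S_scale: "S (\<lambda>p i. r * c p i)" if "S c" for r c
    using that unfolding S_def by (rule finite_support_scale)
  have diff: "\<Phi> (\<lambda>r i. tangent_inj p v r i - tangent_inj q w r i) = D p v - D q w"
    "S (\<lambda>r i. tangent_inj p v r i - tangent_inj q w r i)" for p v q w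
    using \<Phi>_add[OF S_inj S_scale[OF S_inj, of "-1"], of p v q w] \<Phi>_scale[OF S_inj, of "-1" q w]
      S_add[OF S_inj S_scale[OF S_inj, of "-1"], of p v q w] by (simp_all add: \<Phi>_inj)
  have "(\<lambda>r i. tangent_inj p v r i - tangent_inj q w r i) \<in> tangent_kernel X x"
    using eq unfolding plot_differential_class tangent_class_eq_iff .
  then have "S (\<lambda>r i. tangent_inj p v r i - tangent_inj q w r i) \<and>
      \<Phi> (\<lambda>r i. tangent_inj p v r i - tangent_inj q w r i) = 0"
  proof (rule tangent_kernel_induct)
    fix c assume "c \<in> tangent_relators X x"
    then show "S c \<and> \<Phi> c = 0"
      unfolding tangent_relators_def using diff morphism by auto
  next
    show "S (\<lambda>_ _. 0) \<and> \<Phi> (\<lambda>_ _. 0) = 0"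
      by (simp add: S_def \<Phi>_def)
  next
    fix c d assume "S c \<and> \<Phi> c = 0" "S d \<and> \<Phi> d = 0"
    then show "S (\<lambda>p i. c p i + d p i) \<and> \<Phi> (\<lambda>p i. c p i + d p i) = 0"
      by (simp add: S_add \<Phi>_add)
  next
    fix r c assume "S c \<and> \<Phi> c = 0"
    then show "S (\<lambda>p i. r * c p i) \<and> \<Phi> (\<lambda>p i. r * c p i) = 0"
      by (simp add: S_scale \<Phi>_scale)
  qed
  then show ?thesis
    by (simp add: diff)
qed

section \<open>The internal tangent space in an etale chart\<close>

lemma centered_plots_iff:
  "(n, U, P) \<in> centered_plots X x \<longleftrightarrow> (n, U, P) \<in> plots X \<and> origin \<in> U \<and> P origin = x"
  by (simp add: centered_plots_def)

lemma plot_morphism_iff: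
  "plot_morphism (m, V, Q) (n, U, P) W F \<longleftrightarrow> W \<subseteq> V \<and> origin \<in> W \<and> smooth_between m W n U F \<and>
     F origin = origin \<and> (\<forall>w\<in>W. Q w = P (F w))"
  by (simp add: plot_morphism_def)

lemma plot_morphism_compose:
  assumes F: "plot_morphism (m, V, Q) (n, U, P) W F" and G: "plot_morphism (n, U, P) (l, T, R) W' G"
  shows "plot_morphism (m, V, Q) (l, T, R) {w \<in> W. F w \<in> W'} (\<lambda>w. G (F w))"
    and "differential m l (\<lambda>w. G (F w)) origin v =
      differential n l G origin (differential m n F origin v)"
proof -
  define W1 where "W1 = {w \<in> W. F w \<in> W'}"
  have F': "W \<subseteq> V" "origin \<in> W" "smooth_between m W n U F" "F origin = origin" "\<And>w. w \<in> W \<Longrightarrow> Q w = P (F w)"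
    using F by (simp_all add: plot_morphism_iff)
  have G': "origin \<in> W'" "smooth_between n W' l T G" "G origin = origin" "\<And>w. w \<in> W' \<Longrightarrow> P w = R (G w)"
    using G by (simp_all add: plot_morphism_iff)
  note W' = smooth_betweenD(1)[OF G'(2)]
  have W1: "openE m W1"
    unfolding W1_def by (rule smooth_between_vimage[OF F'(3) W'])
  have FW: "smooth_between m W1 n W' F"
    by (rule smooth_between_subset[OF F'(3) W1 _ W']) (auto simp: W1_def)
  have o: "origin \<in> W1"
    using F'(2,4) G'(1) by (simp add: W1_def)
  show "plot_morphism (m, V, Q) (l, T, R) {w \<in> W. F w \<in> W'} (\<lambda>w. G (F w))"
    unfolding W1_def[symmetric] plot_morphism_iff
    using smooth_between_compose[OF G'(2) FW] F' G' o by (auto simp: W1_def)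
  show "differential m l (\<lambda>w. G (F w)) origin v =
      differential n l G origin (differential m n F origin v)"
    using differential_compose[OF G'(2) FW o, of v] F'(4) by simp
qed

text \<open>A chart with the origin in its domain is itself a centered plot. Existence and
  uniqueness of lifts make it a terminal object among the plots centered at that point, with germs
  as morphisms, and a colimit over a category with a terminal object is the value there, here
  \<open>rspace m\<close>.\<close>

locale pointed_chart =
  fixes m :: nat and U :: "rvec set" and X :: "'a dspace" and \<phi> :: "rvec \<Rightarrow> 'a"
  assumes space: "diffeological_space X" and chart: "lifting_chart m U X \<phi>" and origin: "origin \<in> U"
begin

definition chart_plot :: "'a param" where
  "chart_plot = (m, U, restrict \<phi> U)"

lemma chart_plot_centered: "chart_plot \<in> centered_plots X (\<phi> origin)"
proof -
  note U = lifting_chartD(1)[OF chart]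
  have "(m, U, compose U \<phi> (\<lambda>x. x)) \<in> plots X"
    by (rule lifting_chartD(3)[OF chart smooth_between_id[OF U U order_refl]])
  moreover have "compose U \<phi> (\<lambda>x. x) = restrict \<phi> U"
    by (simp add: compose_def)
  ultimately show ?thesis
    using origin by (simp add: chart_plot_def centered_plots_iff)
qed

lemma chart_plot_morphism_id: "plot_morphism chart_plot chart_plot U (\<lambda>x. x)"
  using origin smooth_between_id[OF lifting_chartD(1)[OF chart] lifting_chartD(1)[OF chart] order_refl]
  by (simp add: chart_plot_def plot_morphism_iff)

lemma chart_morphismE:
  assumes "(n, V, P) \<in> centered_plots X (\<phi> origin)"
  obtains W \<sigma> where "plot_morphism (n, V, P) chart_plot W \<sigma>"
proof -
  have P: "(n, V, P) \<in> plots X" "origin \<in> V" "\<phi> origin = P origin"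
    using assms by (simp_all add: centered_plots_iff)
  obtain W \<sigma> where W: "W \<subseteq> V" "origin \<in> W" and \<sigma>: "smooth_between n W m U \<sigma>" "\<sigma> origin = origin"
    and eq: "\<And>w. w \<in> W \<Longrightarrow> \<phi> (\<sigma> w) = P w"
    by (rule lifting_chart_lift[OF chart P(1,2) origin P(3)]) (rule that)
  have "P w = restrict \<phi> U (\<sigma> w)" if "w \<in> W" for w
    using eq[OF that] smooth_betweenD(3)[OF \<sigma>(1) that] by simp
  then have "plot_morphism (n, V, P) chart_plot W \<sigma>"
    using W \<sigma> by (simp add: chart_plot_def plot_morphism_iff)
  then show ?thesis by (rule that)
qed

text \<open>Two lifts of one plot that both send the origin to the origin have the same germ there,
  and a differential depends on the germ only.\<close>

lemma chart_morphism_differential_unique: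
  assumes \<sigma>: "plot_morphism (n, V, P) chart_plot W \<sigma>" and \<tau>: "plot_morphism (n, V, P) chart_plot W' \<tau>"
  shows "differential n m \<sigma> origin = differential n m \<tau> origin"
proof -
  note U = lifting_chartD(1)[OF chart]
  have \<sigma>': "origin \<in> W" "smooth_between n W m U \<sigma>" "\<sigma> origin = origin" "\<And>w. w \<in> W \<Longrightarrow> P w = restrict \<phi> U (\<sigma> w)"
    and \<tau>': "origin \<in> W'" "smooth_between n W' m U \<tau>" "\<tau> origin = origin" "\<And>w. w \<in> W' \<Longrightarrow> P w = restrict \<phi> U (\<tau> w)"
    using \<sigma> \<tau> by (simp_all add: chart_plot_def plot_morphism_iff)
  have WW: "openE n (W \<inter> W')"
    using smooth_betweenD(1)[OF \<sigma>'(2)] smooth_betweenD(1)[OF \<tau>'(2)] by (rule openin_Int)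
  have 1: "smooth_between n (W \<inter> W') m U \<sigma>"
    by (rule smooth_between_subset[OF \<sigma>'(2) WW _ U]) (auto intro: smooth_betweenD(3)[OF \<sigma>'(2)])
  have 2: "smooth_between n (W \<inter> W') m U \<tau>"
    by (rule smooth_between_subset[OF \<tau>'(2) WW _ U]) (auto intro: smooth_betweenD(3)[OF \<tau>'(2)])
  have eq: "\<phi> (\<sigma> w) = \<phi> (\<tau> w)" if "w \<in> W \<inter> W'" for w
    using \<sigma>'(4)[of w] \<tau>'(4)[of w] smooth_betweenD(3)[OF 1 that] smooth_betweenD(3)[OF 2 that] that by simp
  have o: "origin \<in> W \<inter> W'" "\<sigma> origin = \<tau> origin"
    using \<sigma>'(1,3) \<tau>'(1,3) by simp_all
  obtain T where "openE n T" "origin \<in> T" "T \<subseteq> W \<inter> W'" "\<And>w. w \<in> T \<Longrightarrow> \<sigma> w = \<tau> w"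
    by (rule lifting_chart_unique[OF chart 1 2 o eq]) (assumption, rule that)
  then show ?thesis
    by (intro differential_cong)
qed

abbreviation chart_differential :: "rvec \<Rightarrow> ('a param \<Rightarrow> rvec) set" where
  "chart_differential \<equiv> plot_differential X (\<phi> origin) chart_plot"

lemma plot_differential_eq:
  assumes "(n, V, P) \<in> centered_plots X (\<phi> origin)" "plot_morphism (n, V, P) chart_plot W \<sigma>" "v \<in> rspace n"
  shows "plot_differential X (\<phi> origin) (n, V, P) v = chart_differential (differential n m \<sigma> origin v)"
  using plot_differential_morphism[of n V P X "\<phi> origin" m U "restrict \<phi> U" W \<sigma> v]
    assms chart_plot_centered by (simp add: chart_plot_def)

text \<open>Each coordinate of the differential of a lift is a functional that descends to the
  colimit: a morphism followed by a lift is a lift, and all lifts have one differential. On the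
  chart itself the identity is a lift, so these functionals recover the vector.\<close>

lemma chart_differential_inject:
  assumes v: "v \<in> rspace m" and w: "w \<in> rspace m" and eq: "chart_differential v = chart_differential w"
  shows "v = w"
proof
  fix j
  \<comment> \<open>Any lift will do. On plots without a lift the choice is arbitrary, yet
    \<open>D\<close> is linear there as well, since \<open>differential\<close> is linear in the
    vector for every map.\<close>
  define S where "S p = (SOME \<sigma>. \<exists>W. plot_morphism p chart_plot W \<sigma>)" for p :: "'a param"
  define D where "D p v = differential (fst p) m (S p) origin v" for p :: "'a param" and v
  have D: "D (n, V, P) = differential n m \<sigma> origin" if \<sigma>: "plot_morphism (n, V, P) chart_plot W \<sigma>" for n V P W \<sigma>
  proof -
    have "\<exists>W. plot_morphism (n, V, P) chart_plot W (S (n, V, P))"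
      unfolding S_def by (rule someI[of _ \<sigma>]) (rule exI[of _ W], rule \<sigma>)
    then obtain W' where "plot_morphism (n, V, P) chart_plot W' (S (n, V, P))" ..
    from chart_morphism_differential_unique[OF this \<sigma>] show ?thesis
      by (simp add: D_def fun_eq_iff)
  qed
  have D0: "D chart_plot u = u" if "u \<in> rspace m" for u
    using D[of m U "restrict \<phi> U" U "\<lambda>x. x"] chart_plot_morphism_id differential_id[OF that]
    by (simp add: chart_plot_def)
  have "D chart_plot v j = D chart_plot w j"
  proof (rule plot_differential_eqD[where D = "\<lambda>p v. D p v j", OF _ _ _ eq])
    show "D p (\<lambda>i. v i + w i) j = D p v j + D p w j" for p v w
      by (simp add: D_def differential_add)
    show "D p (\<lambda>i. r * v i) j = r * D p v j" for p r v
      by (simp add: D_def differential_scale)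
    show "D (k, V, Q) v j = D (n, T, P) (differential k n F origin v) j"
      if Q: "(k, V, Q) \<in> centered_plots X (\<phi> origin)" and P: "(n, T, P) \<in> centered_plots X (\<phi> origin)"
        and F: "plot_morphism (k, V, Q) (n, T, P) W F" for k V Q n T P W F v
    proof -
      obtain W' \<sigma> where \<sigma>: "plot_morphism (n, T, P) chart_plot W' \<sigma>"
        using P by (rule chart_morphismE)
      note c = plot_morphism_compose[OF F \<sigma>[unfolded chart_plot_def], folded chart_plot_def]
      show ?thesis
        unfolding D[OF c(1)] D[OF \<sigma>] c(2) ..
    qed
  qed
  then show "v j = w j"
    using D0 v w by simp
qed

text \<open>By induction on the support: the relator of a lift moves a summand from its plot to the
  chart, and summands at the chart add up to a single one.\<close>

lemma carrier_tangent_space: "carrier (internal_tangent_space X (\<phi> origin)) = chart_differential ` rspace m"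
proof
  let ?T = "internal_tangent_space X (\<phi> origin)" and ?C = "tangent_class X (\<phi> origin)"
  have "?C c \<in> chart_differential ` rspace m"
    if "finite A" "c \<in> carrier (tangent_sum X (\<phi> origin))" "{p. c p \<noteq> origin} \<subseteq> A" for A c
    using that
  proof (induction A arbitrary: c rule: finite_induct)
    case empty
    then have "c = (\<lambda>_ _. 0)"
      by (auto simp: fun_eq_iff)
    then have "?C c = chart_differential origin"
      by (simp add: plot_differential_zero zero_internal_tangent_space)
    then show ?case
      by (simp add: rspace_iff)
  next
    case (insert p A)
    show ?case
    proof (cases "c p = origin")
      case True
      with insert.prems show ?thesis
        by (intro insert.IH) auto
    next
      case False
      obtain n V P where p: "p = (n, V, P)"
        by (cases p)
      have P: "(n, V, P) \<in> centered_plots X (\<phi> origin)" and cp: "c p \<in> rspace n"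
        using insert.prems(1) False by (auto simp: carrier_tangent_sum p)
      define d where "d = c(p := origin)"
      have "finite {q. d q \<noteq> origin}"
        by (rule finite_subset[of _ "{q. c q \<noteq> origin}"])
          (use insert.prems(1) in \<open>auto simp: d_def carrier_tangent_sum\<close>)
      then have "d \<in> carrier (tangent_sum X (\<phi> origin))"
        using insert.prems(1) by (auto simp: d_def carrier_tangent_sum rspace_iff)
      moreover have "{q. d q \<noteq> origin} \<subseteq> A"
        using insert.prems(2) by (auto simp: d_def)
      ultimately have "?C d \<in> chart_differential ` rspace m"
        by (rule insert.IH)
      then obtain w where w: "w \<in> rspace m" "?C d = chart_differential w"
        by blast
      obtain W \<sigma> where \<sigma>: "plot_morphism (n, V, P) chart_plot W \<sigma>"
        using P by (rule chart_morphismE)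
      let ?u = "differential n m \<sigma> origin (c p)"
      have "c = (\<lambda>q i. tangent_inj p (c p) q i + d q i)"
        by (auto simp: d_def tangent_inj_def fun_eq_iff)
      then have "?C c = add ?T (?C (tangent_inj p (c p))) (?C d)"
        by (simp add: add_tangent_class)
      also have "\<dots> = add ?T (chart_differential ?u) (chart_differential w)"
        using plot_differential_eq[OF P \<sigma> cp] w(2) by (simp add: plot_differential_class p)
      also have "\<dots> = chart_differential (\<lambda>i. ?u i + w i)"
        by (simp add: plot_differential_add)
      finally show ?thesis
        using w(1) differential_rspace[of n m \<sigma> origin "c p"] by (auto simp: rspace_iff)
    qed
  qed
  then show "carrier ?T \<subseteq> chart_differential ` rspace m"
    by (auto simp: carrier_internal_tangent_space carrier_tangent_sum)
  show "chart_differential ` rspace m \<subseteq> carrier ?T"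
    using plot_differential_carrier chart_plot_centered by (auto simp: chart_plot_def)
qed

end

text \<open>The tangent map is defined by a description, so a map with the required properties has
  to be constructed: the differential of \<open>F\<close>, transported along the two chart
  isomorphisms. It is the only one because every tangent vector comes from the chart plot.\<close>

lemma internal_tangent_map_chart:
  fixes M :: "'a dspace" and N :: "'b dspace"
  assumes M: "pointed_chart m U M \<phi>" and N: "pointed_chart n V N \<psi>" and f: "smooth M N f"
    and F: "smooth_between m U n V F" "F origin = origin" and eq: "\<And>u. u \<in> U \<Longrightarrow> f (\<phi> u) = \<psi> (F u)"
    and v: "v \<in> rspace m"
  shows "internal_tangent_map M N f (\<phi> origin)
      (plot_differential M (\<phi> origin) (pointed_chart.chart_plot m U \<phi>) v) =
    plot_differential N (\<psi> origin) (pointed_chart.chart_plot n V \<psi>) (differential m n F origin v)"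
proof -
  interpret M: pointed_chart m U M \<phi> by (rule M)
  interpret N: pointed_chart n V N \<psi> by (rule N)
  define x where "x = \<phi> origin"
  have fx: "f x = \<psi> origin"
    using eq[OF M.origin] F(2) by (simp add: x_def)
  let ?TM = "internal_tangent_space M x" and ?TN = "internal_tangent_space N (f x)"
  let ?J = "differential m n F origin"
  define Q where "Q L \<longleftrightarrow> L \<in> extensional (carrier ?TM) \<and> L \<in> module_hom real_ring ?TM ?TN \<and>
        (\<forall>k T P. (k, T, P) \<in> centered_plots M x \<longrightarrow>
           (\<forall>v\<in>rspace k. L (plot_differential M x (k, T, P) v) =
              plot_differential N (f x) (k, T, compose T f P) v))" for L
  have centered: "(k, T, compose T f P) \<in> centered_plots N (f x)"
    if "(k, T, P) \<in> centered_plots M x" for k T P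
    using that smooth_plot[OF f, of k T P] by (simp add: centered_plots_iff compose_eq)
  \<comment> \<open>Since \<open>f \<circ> \<phi>\<close> equals \<open>\<psi> \<circ> F\<close>,
    the map \<open>F\<close> is a lift of the plot \<open>f \<circ> \<phi>\<close> to the chart of
    \<open>N\<close>.\<close>
  have morphism: "plot_morphism (m, U, compose U f (restrict \<phi> U)) N.chart_plot U F"
    using M.origin F eq smooth_betweenD(3)[OF F(1)]
    by (simp add: N.chart_plot_def plot_morphism_iff compose_eq)
  \<comment> \<open>If \<open>\<sigma>\<close> lifts a plot of \<open>M\<close>, then
    \<open>F \<circ> \<sigma>\<close> lifts its image under \<open>f\<close>.\<close>
  have pd: "plot_differential N (f x) (k, T, compose T f P) v =
      N.chart_differential (?J (differential k m \<sigma> origin v))"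
    if P: "(k, T, P) \<in> centered_plots M x" and \<sigma>: "plot_morphism (k, T, P) M.chart_plot W \<sigma>"
      and v: "v \<in> rspace k" for k T P W \<sigma> v
  proof -
    have "plot_morphism (k, T, compose T f P) (m, U, compose U f (restrict \<phi> U)) W \<sigma>"
      using \<sigma> smooth_betweenD(3)[of k W m U \<sigma>]
      by (auto simp: M.chart_plot_def plot_morphism_iff compose_def subset_iff)
    note c = plot_morphism_compose[OF this morphism[unfolded N.chart_plot_def], folded N.chart_plot_def]
    show ?thesis
      using N.plot_differential_eq[OF _ c(1) v] centered[OF P] unfolding c(2) fx by simp
  qed
  have J_lin: "?J (\<lambda>i. v i + w i) = (\<lambda>i. ?J v i + ?J w i)" "?J (\<lambda>i. r * v i) = (\<lambda>i. r * ?J v i)" for v w r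
    by (rule differential_add, rule differential_scale)
  define L where "L = restrict (\<lambda>t. N.chart_differential (?J (inv_into (rspace m) M.chart_differential t))) (carrier ?TM)"
  have inj: "inj_on M.chart_differential (rspace m)"
    by (rule inj_onI) (rule M.chart_differential_inject)
  have carrier_M: "carrier ?TM = M.chart_differential ` rspace m"
    unfolding x_def by (rule M.carrier_tangent_space)
  have carrier_N: "carrier ?TN = N.chart_differential ` rspace n"
    unfolding fx by (rule N.carrier_tangent_space)
  have L: "L (M.chart_differential v) = N.chart_differential (?J v)" if "v \<in> rspace m" for v
    unfolding L_def carrier_M using that by (simp add: inv_into_f_f[OF inj])
  have "L \<in> module_hom real_ring ?TM ?TN"
    unfolding module_hom_def
  proof (intro CollectI conjI allI impI)
    show "L \<in> carrier ?TM \<rightarrow> carrier ?TN"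
      unfolding carrier_M carrier_N using L differential_rspace by auto
  next
    fix s t assume "s \<in> carrier ?TM \<and> t \<in> carrier ?TM"
    then obtain v w where vw: "v \<in> rspace m" "w \<in> rspace m"
      and st: "s = M.chart_differential v" "t = M.chart_differential w"
      unfolding carrier_M by blast
    have "(\<lambda>i. v i + w i) \<in> rspace m"
      using vw by (simp add: rspace_iff)
    from L[OF this] show "L (add ?TM s t) = add ?TN (L s) (L t)"
      unfolding st L[OF vw(1)] L[OF vw(2)] J_lin by (simp add: plot_differential_add x_def fx[unfolded x_def])
  next
    fix r t assume "r \<in> carrier real_ring \<and> t \<in> carrier ?TM"
    then obtain v where v: "v \<in> rspace m" and t: "t = M.chart_differential v"
      unfolding carrier_M by blast
    have "(\<lambda>i. r * v i) \<in> rspace m"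
      using v by (simp add: rspace_iff)
    from L[OF this] show "L (smult ?TM r t) = smult ?TN r (L t)"
      unfolding t L[OF v] J_lin by (simp add: plot_differential_scale x_def fx[unfolded x_def])
  qed
  moreover have "L (plot_differential M x (k, T, P) v) = plot_differential N (f x) (k, T, compose T f P) v"
    if P: "(k, T, P) \<in> centered_plots M x" and v: "v \<in> rspace k" for k T P v
  proof -
    obtain W \<sigma> where \<sigma>: "plot_morphism (k, T, P) M.chart_plot W \<sigma>"
      using P unfolding x_def by (rule M.chart_morphismE)
    have "plot_differential M x (k, T, P) v = M.chart_differential (differential k m \<sigma> origin v)"
      using M.plot_differential_eq[OF P[unfolded x_def] \<sigma> v] by (simp add: x_def)
    then show ?thesis
      unfolding pd[OF P \<sigma> v] by (simp add: L differential_rspace)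
  qed
  moreover have "L \<in> extensional (carrier ?TM)"
    by (simp add: L_def)
  ultimately have QL: "Q L"
    by (simp add: Q_def)
  have determined: "L' (M.chart_differential v) = N.chart_differential (?J v)" if "Q L'" "v \<in> rspace m" for L' v
  proof -
    have c: "(m, U, restrict \<phi> U) \<in> centered_plots M x"
      using M.chart_plot_centered by (simp add: M.chart_plot_def x_def)
    have "L' (plot_differential M x (m, U, restrict \<phi> U) v) =
        plot_differential N (f x) (m, U, compose U f (restrict \<phi> U)) v"
      using that c by (simp add: Q_def)
    also have "\<dots> = N.chart_differential (?J v)"
      using pd[OF c _ that(2), of U "\<lambda>x. x"] M.chart_plot_morphism_id differential_id[OF that(2)]
      by (simp add: M.chart_plot_def)
    finally show ?thesis
      by (simp add: M.chart_plot_def x_def)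
  qed
  have "L' = L" if "Q L'" for L'
  proof (rule extensionalityI)
    show "L' \<in> extensional (carrier ?TM)" "L \<in> extensional (carrier ?TM)"
      using that QL by (simp_all add: Q_def)
    fix t assume "t \<in> carrier ?TM"
    then obtain v where "v \<in> rspace m" "t = M.chart_differential v"
      unfolding carrier_M by blast
    then show "L' t = L t"
      using determined[OF that] L by simp
  qed
  with QL have "Q (THE L. Q L)"
    by (rule theI)
  then have "Q (internal_tangent_map M N f x)"
    by (simp add: internal_tangent_map_def Q_def)
  from determined[OF this v] show ?thesis
    by (simp add: x_def)
qed

section \<open>The rank of the internal tangent map\<close>

definition unit_vec :: "nat \<Rightarrow> rvec" where
  "unit_vec b = (\<lambda>i. if i = b then 1 else 0)"

lemma unit_vec_rspace: "b < m \<Longrightarrow> unit_vec b \<in> rspace m"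
  by (auto simp: unit_vec_def rspace_iff)

text \<open>The linear algebra in isolation: \<open>T\<close> stands for the tangent space of the
  target, \<open>e\<close> for its identification with \<open>rspace n\<close>, and \<open>J\<close>
  for the differential of \<open>F\<close>. The image is handled through the formulas for the
  operations on values of \<open>e\<close>.\<close>

locale embedded_image =
  fixes T :: "(real, 'w) module" and e :: "rvec \<Rightarrow> 'w" and m n :: nat and J :: "rvec \<Rightarrow> rvec"
  assumes add_e: "add T (e v) (e w) = e (\<lambda>i. v i + w i)"
    and smult_e: "smult T r (e v) = e (\<lambda>i. r * v i)"
    and zero_e: "zero T = e origin"
    and inj_e: "inj_on e (rspace n)"
    and J_add: "J (\<lambda>i. v i + w i) = (\<lambda>i. J v i + J w i)"
    and J_scale: "J (\<lambda>i. r * v i) = (\<lambda>i. r * J v i)"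
    and J_rspace: "J v \<in> rspace n"
begin

definition image_module :: "(real, 'w) module" where
  "image_module = T\<lparr>carrier := (\<lambda>v. e (J v)) ` rspace m\<rparr>"

lemma carrier_image: "carrier image_module = (\<lambda>v. e (J v)) ` rspace m"
  by (simp add: image_module_def)

lemma image_ops:
  "add image_module (e v) (e w) = e (\<lambda>i. v i + w i)"
  "smult image_module r (e v) = e (\<lambda>i. r * v i)"
  "zero image_module = e origin"
  by (simp_all add: image_module_def add_e smult_e zero_e)

lemma J_origin: "J origin = origin"
  using J_scale[of 0 origin] by simp

lemma image_carrierI: "v \<in> rspace m \<Longrightarrow> e (J v) \<in> carrier image_module"
  by (simp add: carrier_image)

lemma vectorspace_image: "vectorspace real_ring image_module"
proof (rule vs_criteria[OF field_real_ring])
  have add: "(\<lambda>i. v i + w i) \<in> rspace m" if "v \<in> rspace m" "w \<in> rspace m" for v w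
    using that by (simp add: rspace_iff)
  have scale: "(\<lambda>i. r * v i) \<in> rspace m" if "v \<in> rspace m" for r v
    using that by (simp add: rspace_iff)
  have "e origin = e (J origin)"
    by (simp add: J_origin)
  also have "\<dots> \<in> carrier image_module"
    by (rule image_carrierI) (simp add: rspace_iff)
  finally show "zero image_module \<in> carrier image_module"
    by (simp add: image_ops)
  show "\<forall>v w. v \<in> carrier image_module \<and> w \<in> carrier image_module \<longrightarrow>
      add image_module v w \<in> carrier image_module"
    unfolding carrier_image by (auto simp: image_ops J_add[symmetric] intro!: imageI add)
  show "\<forall>c v. c \<in> carrier real_ring \<and> v \<in> carrier image_module \<longrightarrow>
      smult image_module c v \<in> carrier image_module"
    unfolding carrier_image by (auto simp: image_ops J_scale[symmetric] intro!: imageI scale)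
  show "\<forall>v\<in>carrier image_module. \<exists>w\<in>carrier image_module. add image_module v w = zero image_module"
  proof
    fix v assume "v \<in> carrier image_module"
    then obtain w where w: "w \<in> rspace m" "v = e (J w)"
      by (auto simp: carrier_image)
    have "add image_module v (e (J (\<lambda>i. -1 * w i))) = zero image_module"
      unfolding w(2) J_scale by (simp add: image_ops)
    then show "\<exists>w\<in>carrier image_module. add image_module v w = zero image_module"
      by (rule bexI) (rule image_carrierI[OF scale[OF w(1)]])
  qed
qed (auto simp: carrier_image image_ops algebra_simps)

text \<open>The columns \<open>J (unit_vec b)\<close> generate the image, and those from
  \<open>j\<close> on vanish.\<close>

lemma dim_image_le:
  assumes "\<And>b. j \<le> b \<Longrightarrow> b < m \<Longrightarrow> J (unit_vec b) = origin"
  shows "vectorspace.dim real_ring image_module \<le> j"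
proof -
  interpret V: vectorspace real_ring image_module by (rule vectorspace_image)
  \<comment> \<open>The bound \<open>b < m\<close> is kept beside \<open>b < j\<close> because
    \<open>j\<close> may exceed \<open>m\<close>.\<close>
  define A where "A = (\<lambda>b. e (J (unit_vec b))) ` {b. b < j \<and> b < m}"
  have A: "A \<subseteq> carrier image_module"
    by (auto simp: A_def intro: image_carrierI unit_vec_rspace)
  have sub: "submodule real_ring (V.span A) image_module"
    by (rule V.span_is_submodule[OF A])
  have unit: "e (J (unit_vec b)) \<in> V.span A" if "b < m" for b
  proof (cases "b < j")
    case True
    then have "e (J (unit_vec b)) \<in> A"
      using that by (auto simp: A_def)
    then show ?thesis
      using V.in_own_span[OF A] by blast
  next
    case False
    then have "e (J (unit_vec b)) = zero image_module"
      using assms[of b] that by (simp add: image_ops)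
    then show ?thesis
      using submodule.zero_closed[OF sub] by simp
  qed
  \<comment> \<open>Truncations of \<open>v\<close>, lengthened by one coordinate at a time, build
    \<open>J v\<close> from the columns.\<close>
  have span: "e (J (\<lambda>i. if i < c then v i else 0)) \<in> V.span A" if "c \<le> m" for v c
    using that
  proof (induction c)
    case 0
    then show ?case
      using submodule.zero_closed[OF sub] by (simp add: J_origin image_ops)
  next
    case (Suc c)
    let ?t = "\<lambda>i. if i < c then v i else 0"
    have "(\<lambda>i. if i < Suc c then v i else 0) = (\<lambda>i. ?t i + v c * unit_vec c i)"
      by (auto simp: unit_vec_def fun_eq_iff less_Suc_eq)
    then have "e (J (\<lambda>i. if i < Suc c then v i else 0)) =
        add image_module (e (J ?t)) (smult image_module (v c) (e (J (unit_vec c))))"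
      by (simp only: image_ops J_add J_scale)
    also have "\<dots> \<in> V.span A"
      using Suc by (intro submodule.m_closed[OF sub] submodule.smult_closed[OF sub] unit) auto
    finally show ?case .
  qed
  have "carrier image_module \<subseteq> V.span A"
  proof
    fix t assume "t \<in> carrier image_module"
    then obtain v where v: "v \<in> rspace m" "t = e (J v)"
      by (auto simp: carrier_image)
    have "(\<lambda>i. if i < m then v i else 0) = v"
      using v(1) by (auto simp: rspace_iff fun_eq_iff)
    then show "t \<in> V.span A"
      using span[OF order_refl, of v] v(2) by simp
  qed
  then have "V.span A = carrier image_module"
    using V.span_is_subset2[OF A] by blast
  then have "V.dim \<le> card A"
    by (intro V.gen_ge_dim A) (simp_all add: A_def)
  also have "\<dots> \<le> card {b. b < j \<and> b < m}"
    unfolding A_def by (rule card_image_le) simp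
  also have "\<dots> \<le> card {..<j}"
    by (rule card_mono) auto
  finally show ?thesis
    by simp
qed

text \<open>\<open>V.lin_dep\<close> concerns sets of vectors, with coefficients attached to the
  vectors, whereas the assumption concerns a family indexed by \<open>B\<close>; so the columns
  first have to be shown distinct.\<close>

lemma dim_image_ge:
  assumes fin: "vectorspace.fin_dim real_ring image_module"
    and B: "B \<subseteq> {..<m}"
    and indep: "\<And>c b. (\<And>i. (\<Sum>b\<in>B. c b * J (unit_vec b) i) = 0) \<Longrightarrow> b \<in> B \<Longrightarrow> c b = 0"
  shows "card B \<le> vectorspace.dim real_ring image_module"
proof -
  interpret V: vectorspace real_ring image_module by (rule vectorspace_image)
  define u where "u b = e (J (unit_vec b))" for b
  have finB: "finite B"
    using B by (rule finite_subset) simp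
  have inj: "inj_on u B"
  proof (rule inj_onI, rule ccontr)
    fix b b' assume b: "b \<in> B" "b' \<in> B" "u b = u b'" "b \<noteq> b'"
    then have J: "J (unit_vec b) = J (unit_vec b')"
      unfolding u_def by (intro inj_onD[OF inj_e] J_rspace)
    \<comment> \<open>Two equal columns would satisfy the relation with coefficients
      \<open>1\<close> and \<open>-1\<close>.\<close>
    define c :: "nat \<Rightarrow> real" where "c a = (if a = b then 1 else 0) - (if a = b' then 1 else 0)" for a
    have "(\<Sum>a\<in>B. c a * J (unit_vec a) i) = 0" for i
    proof -
      have "(\<Sum>a\<in>B. c a * J (unit_vec a) i) =
          (\<Sum>a\<in>B. (if a = b then J (unit_vec b) i else 0) - (if a = b' then J (unit_vec b') i else 0))"
        by (rule sum.cong) (auto simp: c_def)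
      also have "\<dots> = J (unit_vec b) i - J (unit_vec b') i"
        using b finB by (simp add: sum_subtractf sum.delta)
      finally show ?thesis
        by (simp add: J)
    qed
    from indep[OF this b(1)] b(4) show False
      by (simp add: c_def)
  qed
  have uB: "u ` B \<subseteq> carrier image_module"
    using B by (auto simp: u_def intro!: image_carrierI unit_vec_rspace)
  have lincomb: "module.lincomb image_module a (u ` B') = e (\<lambda>i. \<Sum>b\<in>B'. a (u b) * J (unit_vec b) i)"
    if "finite B'" "B' \<subseteq> B" for a B'
    using that
  proof (induction B' rule: finite_induct)
    case empty
    then show ?case
      by (simp add: V.lincomb_def image_ops)
  next
    case (insert b B')
    have nin: "u b \<notin> u ` B'"
      using insert.hyps insert.prems inj by (auto simp: inj_on_def)
    have "module.lincomb image_module a (u ` B' \<union> {u b}) =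
        add image_module (smult image_module (a (u b)) (u b)) (module.lincomb image_module a (u ` B'))"
      using insert.hyps insert.prems uB nin by (intro V.lincomb_insert) auto
    also have "\<dots> = e (\<lambda>i. a (u b) * J (unit_vec b) i + (\<Sum>b\<in>B'. a (u b) * J (unit_vec b) i))"
      using insert.IH insert.prems by (simp add: u_def image_ops)
    finally show ?case
      using insert.hyps by simp
  qed
  have "\<not> V.lin_dep (u ` B)"
  proof (rule V.finite_lin_indpt2)
    show "finite (u ` B)" "u ` B \<subseteq> carrier image_module"
      using finB uB by auto
    fix a assume "V.lincomb a (u ` B) = zero image_module"
    then have "e (\<lambda>i. \<Sum>b\<in>B. a (u b) * J (unit_vec b) i) = e origin"
      by (simp add: lincomb[OF finB order_refl] image_ops)
    moreover have "(\<lambda>i. \<Sum>b\<in>B. a (u b) * J (unit_vec b) i) \<in> rspace n" "origin \<in> rspace n"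
      using J_rspace by (auto simp: rspace_iff intro!: sum.neutral)
    ultimately have "(\<lambda>i. \<Sum>b\<in>B. a (u b) * J (unit_vec b) i) = origin"
      by (rule inj_onD[OF inj_e])
    then have "a (u b) = 0" if "b \<in> B" for b
      using indep[of "\<lambda>b. a (u b)" b] that by (simp add: fun_eq_iff)
    then show "\<forall>v\<in>u ` B. a v = zero real_ring"
      by simp
  qed
  then have "card (u ` B) \<le> V.dim"
    by (rule V.li_le_dim(2)[OF fin uB])
  then show ?thesis
    by (simp add: card_image[OF inj])
qed

end

section \<open>The rank in terms of partial derivatives of a local representation\<close>

lemma differential_unit_vec:
  "b < m \<Longrightarrow> differential m n F a (unit_vec b) = (\<lambda>i. if i < n then partial_deriv b (\<lambda>x. F x i) a else 0)"
  by (auto simp: differential_def unit_vec_def fun_eq_iff if_distrib sum.delta cong: if_cong)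

lemma smooth_between_translate:
  assumes "openE m U" "u \<in> rspace m"
  shows "smooth_between m {w \<in> rspace m. (\<lambda>i. w i + u i) \<in> U} m U (\<lambda>w i. w i + u i)"
    (is "smooth_between m ?V m U ?t")
proof -
  have r: "openE m (rspace m)"
    by simp
  have t: "smooth_between m (rspace m) m (rspace m) ?t"
    using assms(2) by (intro smooth_betweenI Ck_on_add Ck_on_coord Ck_on_const)
      (auto simp: rspace_iff)
  have V: "openE m ?V"
    by (rule smooth_between_vimage[OF t assms(1)])
  show ?thesis
    by (rule smooth_between_subset[OF t V _ assms(1)]) auto
qed

text \<open>The two derivative predicates are equivalent for each candidate \<open>D\<close>, so the
  descriptions behind \<open>deriv\<close> agree whether or not a derivative exists.\<close>

lemma partial_deriv_translate:
  "partial_deriv b (\<lambda>w. f (\<lambda>i. w i + u i) - c) origin = partial_deriv b (\<lambda>x. f x :: real) u"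
proof -
  have "(\<lambda>t. f (\<lambda>i. (origin(b := t)) i + u i) - c) = (\<lambda>t. f (u(b := t + u b)) - c)"
    by (intro ext arg_cong[where f = f] arg_cong2[where f = "(-)"] refl) (auto simp: fun_eq_iff)
  moreover have "deriv (\<lambda>t. f (u(b := t + u b)) - c) 0 = deriv (\<lambda>t. f (u(b := t))) (u b)"
  proof -
    have "((\<lambda>t. f (u(b := t + u b)) - c) has_field_derivative D) (at 0) \<longleftrightarrow>
        ((\<lambda>t. f (u(b := t))) has_field_derivative D) (at (u b))" for D
    proof -
      have "((\<lambda>t. f (u(b := t + u b)) - c) has_field_derivative D) (at 0) \<longleftrightarrow>
          ((\<lambda>t. f (u(b := t + u b))) has_field_derivative D) (at 0)"
        using DERIV_diff[OF _ DERIV_const[of c], of "\<lambda>t. f (u(b := t + u b))" D 0]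
          DERIV_add[OF _ DERIV_const[of c], of "\<lambda>t. f (u(b := t + u b)) - c" D 0] by auto
      also have "\<dots> \<longleftrightarrow> ((\<lambda>t. f (u(b := t))) has_field_derivative D) (at (u b))"
        using DERIV_at_within_shift[of "\<lambda>t. f (u(b := t))" D "u b" 0 UNIV] by (simp add: add.commute)
      finally show ?thesis .
    qed
    then show ?thesis
      by (simp add: deriv_def)
  qed
  ultimately show ?thesis
    by (simp add: partial_deriv_def)
qed

lemma partial_deriv_cong:
  assumes "openE m U" "u \<in> U" "b < m" "\<And>x. x \<in> U \<Longrightarrow> f x = g x"
  shows "partial_deriv b f u = partial_deriv b g u"
  unfolding partial_deriv_def
proof (rule deriv_cong_ev)
  show "eventually (\<lambda>t. f (u(b := t)) = g (u(b := t))) (nhds (u b))"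
    using eventually_upd_in[OF assms(1,2,3)] by eventually_elim (rule assms(4))
qed simp

text \<open>As \<open>\<psi>\<close> need not be locally injective, \<open>F\<close> is not
  determined by \<open>f\<close> and the charts; it is part of the data.\<close>

definition local_representation ::
    "nat \<Rightarrow> nat \<Rightarrow> 'a dspace \<Rightarrow> 'b dspace \<Rightarrow> ('a \<Rightarrow> 'b) \<Rightarrow>
     rvec set \<Rightarrow> (rvec \<Rightarrow> 'a) \<Rightarrow> rvec set \<Rightarrow> (rvec \<Rightarrow> 'b) \<Rightarrow> (rvec \<Rightarrow> rvec) \<Rightarrow> bool" where
  "local_representation m n M N f U \<phi> V \<psi> F \<longleftrightarrow> lifting_chart m U M \<phi> \<and> lifting_chart n V N \<psi> \<and>
     smooth_between m U n V F \<and> (\<forall>u\<in>U. f (\<phi> u) = \<psi> (F u))"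

text \<open>Tangent spaces are built from plots centered at the origin, so the point under
  consideration has to be moved to the parameter zero.\<close>

lemma lifting_chart_translate:
  assumes c: "lifting_chart m U X \<phi>" and u: "u \<in> U"
  shows "lifting_chart m {w \<in> rspace m. (\<lambda>i. w i + u i) \<in> U} X (\<lambda>w. \<phi> (\<lambda>i. w i + u i))" (is ?c)
    and "smooth_between m U m {w \<in> rspace m. (\<lambda>i. w i + u i) \<in> U} (\<lambda>w i. w i - u i)" (is ?s)
proof -
  let ?V = "{w \<in> rspace m. (\<lambda>i. w i + u i) \<in> U}"
  note U = lifting_chartD(1)[OF c]
  have ur: "u \<in> rspace m"
    using u openE_subset[OF U] by blast
  note t = smooth_between_translate[OF U ur]
  have "(\<lambda>i. - u i) \<in> rspace m"
    using ur by (simp add: rspace_iff)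
  from smooth_between_translate[OF smooth_betweenD(1)[OF t] this]
  have "smooth_between m {w \<in> rspace m. (\<lambda>i. w i - u i) \<in> ?V} m ?V (\<lambda>w i. w i - u i)"
    by simp
  moreover have "{w \<in> rspace m. (\<lambda>i. w i - u i) \<in> ?V} = U"
    using openE_subset[OF U] ur by (auto simp: rspace_iff)
  ultimately show s: ?s
    by simp
  show ?c
    by (rule lifting_chart_compose[OF c t s order_refl]) auto
qed

text \<open>With both charts centered, the image of the internal tangent map is spanned by the
  columns of partial derivatives of \<open>F\<close> at \<open>u\<close>. Hence \<open>k\<close> is
  at most the number of generating columns and at least the number of independent ones.\<close>

lemma local_representation_rank:
  fixes M :: "'a dspace" and N :: "'b dspace"
  assumes MN: "diffeological_space M" "diffeological_space N" and f: "smooth M N f"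
    and rank: "constant_internal_rank M N f k"
    and rep: "local_representation m n M N f U \<phi> V \<psi> F" and u: "u \<in> U"
  shows "(\<And>b i. j \<le> b \<Longrightarrow> b < m \<Longrightarrow> i < n \<Longrightarrow> partial_deriv b (\<lambda>x. F x i) u = 0) \<Longrightarrow> k \<le> j"
    and "B \<subseteq> {..<m} \<Longrightarrow>
      (\<And>c b. (\<And>i. i < n \<Longrightarrow> (\<Sum>b\<in>B. c b * partial_deriv b (\<lambda>x. F x i) u) = 0) \<Longrightarrow> b \<in> B \<Longrightarrow> c b = 0) \<Longrightarrow>
      card B \<le> k"
proof -
  have c\<phi>: "lifting_chart m U M \<phi>" and c\<psi>: "lifting_chart n V N \<psi>" and F: "smooth_between m U n V F"
    and eq: "\<And>u. u \<in> U \<Longrightarrow> f (\<phi> u) = \<psi> (F u)"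
    using rep by (simp_all add: local_representation_def)
  define v where "v = F u"
  have v: "v \<in> V"
    unfolding v_def by (rule smooth_betweenD(3)[OF F u])
  define U' V' where "U' = {w \<in> rspace m. (\<lambda>i. w i + u i) \<in> U}" and "V' = {w \<in> rspace n. (\<lambda>i. w i + v i) \<in> V}"
  define \<phi>' \<psi>' where "\<phi>' = (\<lambda>w. \<phi> (\<lambda>i. w i + u i))" and "\<psi>' = (\<lambda>w. \<psi> (\<lambda>i. w i + v i))"
  define F' where "F' = (\<lambda>w i. F (\<lambda>i. w i + u i) i - v i)"
  note ur = subsetD[OF openE_subset[OF lifting_chartD(1)[OF c\<phi>]] u]
  have zero: "origin \<in> U'" "origin \<in> V'"
    using u v by (simp_all add: U'_def V'_def rspace_iff)
  have M': "pointed_chart m U' M \<phi>'"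
    using lifting_chart_translate(1)[OF c\<phi> u] zero MN by (simp add: pointed_chart_def U'_def \<phi>'_def)
  have N': "pointed_chart n V' N \<psi>'"
    using lifting_chart_translate(1)[OF c\<psi> v] zero MN by (simp add: pointed_chart_def V'_def \<psi>'_def)
  have F': "smooth_between m U' n V' F'"
    unfolding F'_def U'_def V'_def
    by (rule smooth_between_compose[OF lifting_chart_translate(2)[OF c\<psi> v] smooth_between_compose[OF F
            smooth_between_translate[OF lifting_chartD(1)[OF c\<phi>] ur]]])
  have F'0: "F' origin = origin"
    by (simp add: F'_def v_def)
  have eq': "f (\<phi>' w) = \<psi>' (F' w)" if "w \<in> U'" for w
    using that eq by (simp add: \<phi>'_def \<psi>'_def F'_def U'_def)
  interpret M': pointed_chart m U' M \<phi>' by (rule M')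
  interpret N': pointed_chart n V' N \<psi>' by (rule N')
  let ?J = "differential m n F' origin"
  interpret J: embedded_image "internal_tangent_space N (\<psi>' origin)" N'.chart_differential m n ?J
  proof
    show "inj_on N'.chart_differential (rspace n)"
      by (rule inj_onI) (rule N'.chart_differential_inject)
  qed (simp_all add: plot_differential_add plot_differential_scale plot_differential_zero
      differential_add differential_scale differential_rspace)
  have fx: "f (\<phi>' origin) = \<psi>' origin"
    using eq'[OF zero(1)] F'0 by simp
  have "internal_tangent_map M N f (\<phi>' origin) ` carrier (internal_tangent_space M (\<phi>' origin)) =
      (\<lambda>v. N'.chart_differential (?J v)) ` rspace m"
    unfolding M'.carrier_tangent_space image_image
    by (rule image_cong[OF refl]) (rule internal_tangent_map_chart[OF M' N' f F' F'0 eq'])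
  then have im: "internal_tangent_space N (f (\<phi>' origin))
      \<lparr>carrier := internal_tangent_map M N f (\<phi>' origin) ` carrier (internal_tangent_space M (\<phi>' origin))\<rparr> =
      J.image_module"
    by (simp add: J.image_module_def fx)
  \<comment> \<open>The rank hypothesis at the single point \<open>\<phi>' origin\<close>, which is
    \<open>\<phi> u\<close>.\<close>
  note J = rank[unfolded constant_internal_rank_def, THEN bspec,
      OF lifting_chartD(2)[OF M'.chart zero(1)], unfolded has_rank_def im]
  have J: "vectorspace.fin_dim real_ring J.image_module" "vectorspace.dim real_ring J.image_module = k"
    using J by blast+
  have unit: "?J (unit_vec b) i = (if i < n then partial_deriv b (\<lambda>x. F x i) u else 0)" if "b < m" for b i
    using partial_deriv_translate[of b "\<lambda>x. F x i" u "v i"] that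
    by (simp add: differential_unit_vec F'_def)
  show "k \<le> j" if "\<And>b i. j \<le> b \<Longrightarrow> b < m \<Longrightarrow> i < n \<Longrightarrow> partial_deriv b (\<lambda>x. F x i) u = 0"
    unfolding J(2)[symmetric]
    by (rule J.dim_image_le) (use that unit in \<open>simp add: fun_eq_iff\<close>)
  show "card B \<le> k" if B: "B \<subseteq> {..<m}" and
    ind: "\<And>c b. (\<And>i. i < n \<Longrightarrow> (\<Sum>b\<in>B. c b * partial_deriv b (\<lambda>x. F x i) u) = 0) \<Longrightarrow> b \<in> B \<Longrightarrow> c b = 0"
    unfolding J(2)[symmetric]
  proof (rule J.dim_image_ge[OF J(1) B])
    fix c b assume c: "\<And>i. (\<Sum>b\<in>B. c b * ?J (unit_vec b) i) = 0" and b: "b \<in> B"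
    show "c b = 0"
    proof (rule ind[OF _ b])
      fix i assume i: "i < n"
      have "(\<Sum>b\<in>B. c b * partial_deriv b (\<lambda>x. F x i) u) = (\<Sum>b\<in>B. c b * ?J (unit_vec b) i)"
        by (rule sum.cong) (use B i in \<open>auto simp: unit\<close>)
      then show "(\<Sum>b\<in>B. c b * partial_deriv b (\<lambda>x. F x i) u) = 0"
        using c by simp
    qed
  qed
qed

section \<open>Normalizing the local representation\<close>

text \<open>Moves a chosen coordinate to position \<open>j\<close>. A transposition is its own
  inverse, so one map serves for both directions of a change of chart.\<close>

definition swap_coords :: "nat \<Rightarrow> nat \<Rightarrow> rvec \<Rightarrow> rvec" where
  "swap_coords a b x = x(a := x b, b := x a)"

lemma swap_coords_swap [simp]: "swap_coords a b (swap_coords a b x) = x"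
  by (auto simp: swap_coords_def)

lemma smooth_between_swap:
  assumes U: "openE m U" and ab: "a < m" "b < m"
  shows "smooth_between m {x \<in> rspace m. swap_coords a b x \<in> U} m U (swap_coords a b)"
    and "smooth_between m U m {x \<in> rspace m. swap_coords a b x \<in> U} (swap_coords a b)"
proof -
  have s: "smooth_between m (rspace m) m (rspace m) (swap_coords a b)"
  proof (rule smooth_between_linear)
    show "\<exists>r l. \<forall>x\<in>rspace m. swap_coords a b x j = r * x l" for j
      by (rule exI[of _ 1], rule exI[of _ "if j = b then a else if j = a then b else j"])
        (simp add: swap_coords_def)
  qed (use ab in \<open>auto simp: swap_coords_def rspace_iff\<close>)
  have V: "openE m {x \<in> rspace m. swap_coords a b x \<in> U}"
    by (rule smooth_between_vimage[OF s U])
  show "smooth_between m {x \<in> rspace m. swap_coords a b x \<in> U} m U (swap_coords a b)"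
    by (rule smooth_between_subset[OF s V _ U]) auto
  show "smooth_between m U m {x \<in> rspace m. swap_coords a b x \<in> U} (swap_coords a b)"
    by (rule smooth_between_subset[OF s U openE_subset[OF U] V])
      (use openE_subset[OF U] smooth_betweenD(3)[OF s] in auto)
qed

lemma lifting_chart_swap:
  assumes c: "lifting_chart m U X \<phi>" and ab: "a < m" "b < m"
  shows "lifting_chart m {x \<in> rspace m. swap_coords a b x \<in> U} X (\<lambda>x. \<phi> (swap_coords a b x))"
  by (rule lifting_chart_compose[OF c smooth_between_swap[OF lifting_chartD(1)[OF c] ab] order_refl]) simp_all

lemma local_representation_exists:
  assumes M: "diffeological_etale_manifold m M" and N: "diffeological_etale_manifold n N"
    and f: "smooth M N f" and x: "x \<in> points M"
  obtains U \<phi> V \<psi> F u where "local_representation m n M N f U \<phi> V \<psi> F" "u \<in> U" "\<phi> u = x"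
proof -
  obtain U \<phi> u where \<phi>: "lifting_chart m U M \<phi>" "u \<in> U" "\<phi> u = x"
    using M x by (rule etale_manifold_chart)
  have "f x \<in> points N"
    using f x by (auto simp: smooth_def)
  then obtain V \<psi> v where \<psi>: "lifting_chart n V N \<psi>" "v \<in> V" "\<psi> v = f x"
    by (rule etale_manifold_chart[OF N])
  note U = lifting_chartD(1)[OF \<phi>(1)]
  have "(m, U, compose U \<phi> (\<lambda>x. x)) \<in> plots M"
    by (rule lifting_chartD(3)[OF \<phi>(1) smooth_between_id[OF U U order_refl]])
  from smooth_plot[OF f this] have P: "(m, U, compose U f (compose U \<phi> (\<lambda>x. x))) \<in> plots N" .
  have "\<psi> v = compose U f (compose U \<phi> (\<lambda>x. x)) u"
    using \<phi>(2,3) \<psi>(3) by (simp add: compose_eq)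
  from lifting_chart_lift[OF \<psi>(1) P \<phi>(2) \<psi>(2) this]
  obtain W F where W: "W \<subseteq> U" "u \<in> W" and F: "smooth_between m W n V F"
    and eq: "\<And>w. w \<in> W \<Longrightarrow> \<psi> (F w) = compose U f (compose U \<phi> (\<lambda>x. x)) w"
    by metis
  have "f (\<phi> w) = \<psi> (F w)" if "w \<in> W" for w
    using eq[OF that] W(1) that by (simp add: compose_eq subset_iff)
  then have "local_representation m n M N f W \<phi> V \<psi> F"
    using lifting_chart_subset[OF \<phi>(1) smooth_betweenD(1)[OF F] W(1)] \<psi>(1) F
    by (simp add: local_representation_def)
  then show ?thesis
    using W(2) \<phi>(3) by (rule that)
qed

text \<open>In the source coordinates \<open>x(b := F x a)\<close> the component \<open>a\<close> of
  the map becomes the coordinate \<open>b\<close>. Exchanging \<open>b\<close> with \<open>j\<close>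
  in the source and \<open>a\<close> with \<open>j\<close> in the target puts it at position
  \<open>j\<close>; since \<open>j \<le> a\<close> and \<open>j \<le> b\<close>, the coordinates
  below \<open>j\<close> are not disturbed.\<close>

lemma local_representation_step:
  assumes rep: "local_representation m n M N f U \<phi> V \<psi> F" and u: "u \<in> U"
    and j: "\<And>x i. x \<in> U \<Longrightarrow> i < j \<Longrightarrow> F x i = x i"
    and a: "j \<le> a" "a < n" and b: "j \<le> b" "b < m" and nz: "partial_deriv b (\<lambda>x. F x a) u \<noteq> 0"
  obtains U' \<phi>' V' \<psi>' F' u' where "local_representation m n M N f U' \<phi>' V' \<psi>' F'" "u' \<in> U'" "\<phi>' u' = \<phi> u"
    "\<And>x i. x \<in> U' \<Longrightarrow> i < Suc j \<Longrightarrow> F' x i = x i"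
proof -
  have c\<phi>: "lifting_chart m U M \<phi>" and c\<psi>: "lifting_chart n V N \<psi>" and F: "smooth_between m U n V F"
    and eq: "\<And>u. u \<in> U \<Longrightarrow> f (\<phi> u) = \<psi> (F u)"
    using rep by (simp_all add: local_representation_def)
  note U = lifting_chartD(1)[OF c\<phi>] and V = lifting_chartD(1)[OF c\<psi>]
  have jm: "j < m" and jn: "j < n"
    using a b by simp_all
  obtain W T h where W: "openE m W" "W \<subseteq> U" "u \<in> W" and h: "smooth_between m T m W h"
    and \<alpha>T: "\<And>x. x \<in> W \<Longrightarrow> x(b := F x a) \<in> T" and h\<alpha>: "\<And>x. x \<in> W \<Longrightarrow> h (x(b := F x a)) = x"
    and \<alpha>h: "\<And>y. y \<in> T \<Longrightarrow> (h y)(b := F (h y) a) = y"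
    by (rule coordinate_change[OF U smooth_betweenD(8)[OF F a(2)] b(2) u nz]) (rule that)
  note T = smooth_betweenD(1)[OF h]
  have hT: "h y \<in> W" if "y \<in> T" for y
    by (rule smooth_betweenD(3)[OF h that])
  have hU: "smooth_between m T m U h"
    by (rule smooth_between_subset[OF h T order_refl U]) (use hT W(2) in blast)
  have \<alpha>: "smooth_between m W m T (\<lambda>x. x(b := F x a))"
  proof (rule smooth_betweenI[OF W(1) T \<alpha>T])
    show "Ck_on k m W (\<lambda>x. (x(b := F x a)) l)" for l k
      using Ck_on_subset[OF smooth_betweenD(8)[OF F a(2)] W(2), of k] Ck_on_coord[OF W(1), of k l]
      by (cases "l = b") simp_all
  qed
  have c1: "lifting_chart m T M (\<lambda>y. \<phi> (h y))"
    by (rule lifting_chart_compose[OF c\<phi> hU \<alpha> W(2) hT \<alpha>h h\<alpha>])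
  define U' V' where "U' = {x \<in> rspace m. swap_coords b j x \<in> T}" and "V' = {y \<in> rspace n. swap_coords a j y \<in> V}"
  define \<phi>' \<psi>' where "\<phi>' = (\<lambda>x. \<phi> (h (swap_coords b j x)))" and "\<psi>' = (\<lambda>y. \<psi> (swap_coords a j y))"
  define F' where "F' = (\<lambda>x. swap_coords a j (F (h (swap_coords b j x))))"
  have "lifting_chart m U' M \<phi>'"
    unfolding U'_def \<phi>'_def by (rule lifting_chart_swap[OF c1 b(2) jm])
  moreover have "lifting_chart n V' N \<psi>'"
    unfolding V'_def \<psi>'_def by (rule lifting_chart_swap[OF c\<psi> a(2) jn])
  moreover have "smooth_between m U' n V' F'"
    unfolding F'_def U'_def V'_def
    by (rule smooth_between_compose[OF smooth_between_swap(2)[OF V a(2) jn]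
          smooth_between_compose[OF F smooth_between_compose[OF hU smooth_between_swap(1)[OF T b(2) jm]]]])
  moreover have hin: "h (swap_coords b j x) \<in> U" if "x \<in> U'" for x
    using that hT W(2) by (auto simp: U'_def)
  then have "f (\<phi>' x) = \<psi>' (F' x)" if "x \<in> U'" for x
    using that eq by (simp add: \<phi>'_def \<psi>'_def F'_def)
  ultimately have "local_representation m n M N f U' \<phi>' V' \<psi>' F'"
    by (simp add: local_representation_def)
  moreover have "swap_coords b j (u(b := F u a)) \<in> U'"
    using smooth_betweenD(3)[OF smooth_between_swap(2)[OF T b(2) jm] \<alpha>T[OF W(3)]] by (simp add: U'_def)
  moreover have "\<phi>' (swap_coords b j (u(b := F u a))) = \<phi> u"
    by (simp add: \<phi>'_def h\<alpha>[OF W(3)])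
  moreover have "F' x i = x i" if x: "x \<in> U'" and i: "i < Suc j" for x i
  proof -
    let ?y = "swap_coords b j x"
    have y: "?y \<in> T"
      using x by (simp add: U'_def)
    show ?thesis
    proof (cases "i = j")
      case True
      \<comment> \<open>The inversion formula, read in coordinate \<open>b\<close>.\<close>
      have "F (h ?y) a = ?y b"
        using fun_cong[OF \<alpha>h[OF y], of b] by simp
      then show ?thesis
        by (simp add: F'_def True swap_coords_def)
    next
      case False
      with i a(1) b(1) have ne: "i < j" "i \<noteq> a" "i \<noteq> b"
        by simp_all
      have "F' x i = F (h ?y) i"
        using ne by (simp add: F'_def swap_coords_def)
      also have "\<dots> = h ?y i"
        by (rule j[OF hin[OF x] ne(1)])
      also have "\<dots> = ?y i"
        using fun_cong[OF \<alpha>h[OF y], of i] ne(3) by simp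
      also have "\<dots> = x i"
        using ne by (simp add: swap_coords_def)
      finally show ?thesis .
    qed
  qed
  ultimately show ?thesis
    by (rule that)
qed

lemma local_representation_partials:
  assumes rep: "local_representation m n M N f U \<phi> V \<psi> F" and u: "u \<in> U"
    and j: "\<And>x i. x \<in> U \<Longrightarrow> i < j \<Longrightarrow> F x i = x i" and i: "i < j" and b: "b < m"
  shows "partial_deriv b (\<lambda>x. F x i) u = (if b = i then 1 else 0)"
proof -
  have U: "openE m U"
    using rep lifting_chartD(1) by (auto simp: local_representation_def)
  have "partial_deriv b (\<lambda>x. F x i) u = partial_deriv b (\<lambda>x. x i) u"
    by (rule partial_deriv_cong[OF U u b]) (rule j[OF _ i])
  then show ?thesis
    by (simp add: partial_deriv_coord)
qed

text \<open>The bounds on \<open>j\<close> come out of the induction itself: a step finds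
  \<open>b\<close> with \<open>j \<le> b < m\<close> and \<open>a\<close> with
  \<open>j \<le> a < n\<close>, so \<open>Suc j\<close> is at most \<open>m\<close> and at most
  \<open>n\<close>.\<close>

lemma local_representation_straight:
  fixes M :: "'a dspace" and N :: "'b dspace"
  assumes M: "diffeological_etale_manifold m M" and N: "diffeological_etale_manifold n N"
    and f: "smooth M N f" and rank: "constant_internal_rank M N f k" and x: "x \<in> points M"
  shows "j \<le> k \<Longrightarrow> j \<le> m \<and> j \<le> n \<and> (\<exists>U \<phi> V \<psi> F u. local_representation m n M N f U \<phi> V \<psi> F \<and>
    u \<in> U \<and> \<phi> u = x \<and> (\<forall>x\<in>U. \<forall>i<j. F x i = x i))"
proof (induction j)
  case 0
  obtain U \<phi> V \<psi> F u where "local_representation m n M N f U \<phi> V \<psi> F" "u \<in> U" "\<phi> u = x"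
    by (rule local_representation_exists[OF M N f x])
  then show ?case
    by (intro conjI exI[of _ U] exI[of _ \<phi>] exI[of _ V] exI[of _ \<psi>] exI[of _ F] exI[of _ u]) simp_all
next
  case (Suc j)
  then have "\<exists>U \<phi> V \<psi> F u. local_representation m n M N f U \<phi> V \<psi> F \<and>
      u \<in> U \<and> \<phi> u = x \<and> (\<forall>x\<in>U. \<forall>i<j. F x i = x i)"
    by simp
  then obtain U \<phi> V \<psi> F u where rep: "local_representation m n M N f U \<phi> V \<psi> F"
    and u: "u \<in> U" "\<phi> u = x" and Fj: "\<forall>x\<in>U. \<forall>i<j. F x i = x i"
    by (elim exE conjE) (rule that)
  have Fj': "F x i = x i" if "x \<in> U" "i < j" for x i
    using Fj that by simp
  have MN: "diffeological_space M" "diffeological_space N"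
    using M N by (simp_all add: diffeological_etale_manifold_def)
  \<comment> \<open>Otherwise all columns from \<open>j\<close> on vanish at \<open>u\<close> and
    the rank is at most \<open>j\<close>, which is less than \<open>k\<close>.\<close>
  have "\<exists>b i. j \<le> b \<and> b < m \<and> i < n \<and> partial_deriv b (\<lambda>x. F x i) u \<noteq> 0"
  proof (rule ccontr)
    assume *: "\<not> ?thesis"
    have "k \<le> j"
      by (rule local_representation_rank(1)[OF MN f rank rep u(1)]) (use * in simp)
    with Suc.prems show False by simp
  qed
  then obtain b a where b: "j \<le> b" "b < m" and a: "a < n" and nz: "partial_deriv b (\<lambda>x. F x a) u \<noteq> 0"
    by (elim exE conjE) (rule that)
  \<comment> \<open>Components below \<open>j\<close> are coordinates and do not vary in a direction
    \<open>b \<ge> j\<close>.\<close>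
  have ja: "j \<le> a"
  proof (rule ccontr)
    assume "\<not> j \<le> a"
    then have aj: "a < j" by linarith
    have "partial_deriv b (\<lambda>x. F x a) u = (if b = a then 1 else 0)"
      by (rule local_representation_partials[OF rep u(1) Fj' aj b(2)])
    with nz b(1) aj show False by (auto split: if_splits)
  qed
  obtain U' \<phi>' V' \<psi>' F' u' where "local_representation m n M N f U' \<phi>' V' \<psi>' F'" "u' \<in> U'" "\<phi>' u' = \<phi> u"
    "\<And>x i. x \<in> U' \<Longrightarrow> i < Suc j \<Longrightarrow> F' x i = x i"
    by (rule local_representation_step[OF rep u(1) Fj' ja a b nz]) (assumption, assumption, rule that)
  then show ?case
    using a ja b u(2)
    by (intro conjI exI[of _ U'] exI[of _ \<phi>'] exI[of _ V'] exI[of _ \<psi>'] exI[of _ F'] exI[of _ u']) simp_all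
qed

text \<open>The coordinates from \<open>k\<close> on move from \<open>u0\<close> to \<open>u\<close>
  one at a time, each along a segment inside the cube, and the mean value theorem with a vanishing
  derivative leaves \<open>f\<close> unchanged. On an arbitrary domain the points with given first
  \<open>k\<close> coordinates may be disconnected, hence the restriction to a cube.\<close>

lemma constant_on_cube:
  assumes f: "Ck_on (Suc 0) m (cube m u0 r) f" and k: "k \<le> m" and u: "u \<in> cube m u0 r" and u0: "u0 \<in> rspace m"
    and zero: "\<And>b x. k \<le> b \<Longrightarrow> b < m \<Longrightarrow> x \<in> cube m u0 r \<Longrightarrow> partial_deriv b f x = 0"
  shows "f (\<lambda>i. if i < k then u i else u0 i) = f u"
proof -
  define w where "w c = (\<lambda>i. if i < c then u i else u0 i)" for c
  have r: "r > 0 \<or> m = 0"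
    using u by (force simp: cube_def)
  have "f (w c) = f (w k)" if "k \<le> c" "c \<le> m" for c
    using that
  proof (induction c rule: dec_induct)
    case (step c)
    have in_cube: "(w c)(c := t) \<in> cube m u0 r" if "t \<in> closed_segment (u0 c) (u c)" for t
      using segment_abs_le[OF that] u u0 step.prems r
      by (auto simp: w_def cube_def rspace_iff intro: le_less_trans)
    have "\<exists>t\<in>closed_segment (u0 c) (u c). f ((w c)(c := u c)) - f ((w c)(c := u0 c)) =
        partial_deriv c f ((w c)(c := t)) * (u c - u0 c)"
    proof (rule mean_value_segment)
      fix t assume t: "t \<in> closed_segment (u0 c) (u c)"
      show "((\<lambda>t. f ((w c)(c := t))) has_real_derivative partial_deriv c f ((w c)(c := t))) (at t)"
        using Ck_on_SucD(2)[OF f, unfolded has_partials_def, rule_format, OF _ in_cube[OF t], of c] step.prems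
        by simp
    qed
    then have "f ((w c)(c := u c)) = f ((w c)(c := u0 c))"
      using zero[OF step.hyps(1) _ in_cube] step.prems by auto
    moreover have "(w c)(c := u c) = w (Suc c)" "(w c)(c := u0 c) = w c"
      by (auto simp: w_def fun_eq_iff less_Suc_eq)
    ultimately show ?case
      using step by simp
  qed simp
  from this[OF k order_refl] have "f (w m) = f (w k)" .
  moreover have "w m = u"
    using u u0 by (auto simp: w_def cube_def rspace_iff fun_eq_iff)
  ultimately show ?thesis
    by (simp add: w_def)
qed

text \<open>The shear \<open>y + G y\<close> changes only the coordinates from \<open>k\<close> on,
  by amounts that depend on the first \<open>k\<close>. So it leaves \<open>G\<close> unchanged and
  has the inverse \<open>y - G y\<close>. The last assumption expresses this dependence, for
  \<open>Q\<close> as well as for \<open>G\<close>.\<close>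

lemma lifting_chart_shear:
  assumes c: "lifting_chart n V X \<psi>" and Q: "openE n Q"
    and G: "\<And>j l. Ck_on l n Q (\<lambda>y. G y j)" and G0: "\<And>y j. j < k \<or> n \<le> j \<Longrightarrow> G y j = 0"
    and inv: "\<And>y z. y \<in> Q \<Longrightarrow> z \<in> rspace n \<Longrightarrow> (\<And>i. i < k \<Longrightarrow> z i = y i) \<Longrightarrow> z \<in> Q \<and> G z = G y"
  shows "lifting_chart n {y \<in> Q. (\<lambda>i. y i + G y i) \<in> V} X (\<lambda>y. \<psi> (\<lambda>i. y i + G y i))"
proof -
  let ?s = "\<lambda>y i. y i + G y i" and ?t = "\<lambda>y i. y i - G y i"
  define V' where "V' = {y \<in> Q. ?s y \<in> V}"
  note V = lifting_chartD(1)[OF c] and Qr = openE_subset[OF Q]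
  have r: "?s y \<in> rspace n" "?t y \<in> rspace n" if "y \<in> Q" for y
    using subsetD[OF Qr that] G0[of _ y] by (auto simp: rspace_iff)
  have sinv: "?s y \<in> Q" "G (?s y) = G y" and tinv: "?t y \<in> Q" "G (?t y) = G y" if "y \<in> Q" for y
    using inv[OF that r(1)[OF that]] inv[OF that r(2)[OF that]] G0[of _ y] by simp_all
  have s: "smooth_between n Q n Q ?s"
    by (intro smooth_betweenI Q sinv(1) Ck_on_add Ck_on_coord G)
  have t: "smooth_between n Q n Q ?t"
    by (intro smooth_betweenI Q tinv(1) Ck_on_diff Ck_on_coord G)
  have V': "openE n V'"
    unfolding V'_def by (rule smooth_between_vimage[OF s V])
  have VQ: "openE n (V \<inter> Q)"
    using V Q by (rule openin_Int)
  have "smooth_between n V' n V ?s"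
    by (rule smooth_between_subset[OF s V' _ V]) (auto simp: V'_def)
  moreover have "smooth_between n (V \<inter> Q) n V' ?t"
    by (rule smooth_between_subset[OF t VQ _ V']) (auto simp: V'_def tinv)
  ultimately have "lifting_chart n V' X (\<lambda>y. \<psi> (?s y))"
    by (rule lifting_chart_compose[OF c]) (auto simp: V'_def sinv tinv)
  then show ?thesis
    by (simp add: V'_def)
qed

text \<open>On a cube the components of \<open>F\<close> from \<open>k\<close> on depend on the
  first \<open>k\<close> coordinates only, so the image of the cube lies in a graph over the first
  \<open>k\<close> target coordinates; shearing the target chart along this graph flattens
  it.\<close>

lemma local_representation_normal_form:
  assumes rep: "local_representation m n M N f U \<phi> V \<psi> F" and u0: "u0 \<in> U"
    and k: "k \<le> m" "k \<le> n" and Fk: "\<And>x i. x \<in> U \<Longrightarrow> i < k \<Longrightarrow> F x i = x i"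
    and zero: "\<And>b x i. k \<le> b \<Longrightarrow> b < m \<Longrightarrow> x \<in> U \<Longrightarrow> k \<le> i \<Longrightarrow> i < n \<Longrightarrow> partial_deriv b (\<lambda>x. F x i) x = 0"
  obtains U' V' \<psi>' where "u0 \<in> U'" "lifting_chart m U' M \<phi>" "lifting_chart n V' N \<psi>'"
    "\<And>u. u \<in> U' \<Longrightarrow> (\<lambda>i. if i < k then u i else 0) \<in> V'"
    "\<And>u. u \<in> U' \<Longrightarrow> f (\<phi> u) = \<psi>' (\<lambda>i. if i < k then u i else 0)"
proof -
  have c\<phi>: "lifting_chart m U M \<phi>" and c\<psi>: "lifting_chart n V N \<psi>" and F: "smooth_between m U n V F"
    and eq: "\<And>u. u \<in> U \<Longrightarrow> f (\<phi> u) = \<psi> (F u)"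
    using rep by (simp_all add: local_representation_def)
  note U = lifting_chartD(1)[OF c\<phi>]
  have u0r: "u0 \<in> rspace m"
    using subsetD[OF openE_subset[OF U] u0] .
  obtain r where r: "r > 0" "cube m u0 r \<subseteq> U"
    using U u0 by (rule openE_cubeE)
  define C where "C = cube m u0 r"
  have C: "openE m C" "C \<subseteq> U"
    using r by (simp_all add: C_def)
  \<comment> \<open>Turns a target point into a source point: the first \<open>k\<close> coordinates
    are kept, the others are those of the center \<open>u0\<close>.\<close>
  define \<pi> where "\<pi> y = (\<lambda>i. if i < k then y i else u0 i)" for y :: rvec
  have \<pi>: "smooth_between n (rspace n) m (rspace m) \<pi>"
  proof (rule smooth_betweenI)
    show "Ck_on l n (rspace n) (\<lambda>y. \<pi> y j)" for j l
      by (cases "j < k") (simp_all add: \<pi>_def Ck_on_coord Ck_on_const)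
  qed (use u0r k in \<open>auto simp: \<pi>_def rspace_iff\<close>)
  define Q where "Q = {y \<in> rspace n. \<pi> y \<in> C}"
  have Q: "openE n Q"
    unfolding Q_def by (rule smooth_between_vimage[OF \<pi> C(1)])
  \<comment> \<open>The height of the graph. Zero below \<open>k\<close>, so that the shear fixes
    the first \<open>k\<close> coordinates, and zero from \<open>n\<close> on, so that it stays in
    \<open>rspace n\<close>.\<close>
  define G where "G y i = (if k \<le> i \<and> i < n then F (\<pi> y) i else 0)" for y i
  have "smooth_between n Q m U \<pi>"
    by (rule smooth_between_subset[OF \<pi> Q _ U]) (use C(2) in \<open>auto simp: Q_def\<close>)
  from smooth_between_compose[OF F this]
  have F\<pi>: "smooth_between n Q n V (\<lambda>y. F (\<pi> y))" .
  define \<psi>' where "\<psi>' y = \<psi> (\<lambda>i. y i + G y i)" for y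
  define V' where "V' = {y \<in> Q. (\<lambda>i. y i + G y i) \<in> V}"
  have c\<psi>': "lifting_chart n V' N \<psi>'"
    unfolding \<psi>'_def V'_def
  proof (rule lifting_chart_shear[OF c\<psi> Q])
    show "Ck_on l n Q (\<lambda>y. G y j)" for j l
      using smooth_betweenD(8)[OF F\<pi>, of j l] by (cases "k \<le> j \<and> j < n") (auto simp: G_def Ck_on_const Q)
    show "G y j = 0" if "j < k \<or> n \<le> j" for y j
      using that by (auto simp: G_def)
    show "z \<in> Q \<and> G z = G y" if y: "y \<in> Q" and z: "z \<in> rspace n" "\<And>i. i < k \<Longrightarrow> z i = y i" for y z
    proof -
      have "\<pi> z = \<pi> y"
        using z(2) by (auto simp: \<pi>_def)
      moreover from this have "G z = G y"
        by (intro ext) (simp add: G_def)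
      ultimately show ?thesis
        using y z(1) by (simp add: Q_def)
    qed
  qed
  have main: "(\<lambda>i. if i < k then u i else 0) \<in> V' \<and> \<psi>' (\<lambda>i. if i < k then u i else 0) = \<psi> (F u)"
    if u: "u \<in> C" for u :: rvec
  proof -
    let ?u = "\<lambda>i. if i < k then u i else 0"
    have uU: "u \<in> U"
      using u C(2) by blast
    have \<pi>u: "\<pi> ?u = (\<lambda>i. if i < k then u i else u0 i)"
      by (auto simp: \<pi>_def)
    \<comment> \<open>Resetting coordinates to those of the center does not leave the cube.\<close>
    have "\<pi> ?u \<in> C"
      using u u0r r(1) unfolding \<pi>u by (auto simp: C_def cube_def rspace_iff)
    moreover have "?u \<in> rspace n"
      using k by (simp add: rspace_iff)
    ultimately have uQ: "?u \<in> Q"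
      by (simp add: Q_def)
    have "F (\<pi> ?u) i = F u i" if i: "k \<le> i" "i < n" for i
      unfolding \<pi>u
    proof (rule constant_on_cube[OF _ k(1) u[unfolded C_def] u0r])
      show "Ck_on (Suc 0) m (cube m u0 r) (\<lambda>x. F x i)"
        by (rule Ck_on_subset[OF smooth_betweenD(8)[OF F i(2)] r(2)])
      show "partial_deriv b (\<lambda>x. F x i) x = 0" if "k \<le> b" "b < m" "x \<in> cube m u0 r" for b x
        using zero[OF that(1,2) _ i] r(2) that(3) by blast
    qed
    moreover have "F u i = 0" if "n \<le> i" for i
      using subsetD[OF smooth_betweenD(7)[OF F] smooth_betweenD(3)[OF F uU]] that by (simp add: rspace_iff)
    ultimately have "(\<lambda>i. ?u i + G ?u i) = F u"
      using Fk[OF uU] by (auto simp: G_def fun_eq_iff not_less)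
    then show ?thesis
      using uQ smooth_betweenD(3)[OF F uU] by (simp add: V'_def \<psi>'_def)
  qed
  show ?thesis
  proof (rule that)
    show "u0 \<in> C"
      using r(1) u0r by (simp add: C_def)
    show "lifting_chart m C M \<phi>"
      by (rule lifting_chart_subset[OF c\<phi> C])
    show "lifting_chart n V' N \<psi>'"
      by (rule c\<psi>')
    show "(\<lambda>i. if i < k then u i else 0) \<in> V'" if "u \<in> C" for u
      using main[OF that] by simp
    show "f (\<phi> u) = \<psi>' (\<lambda>i. if i < k then u i else 0)" if "u \<in> C" for u
      using main[OF that] eq C(2) that by auto
  qed
qed

text \<open>A nonzero entry in row \<open>a\<close> and column \<open>b\<close> would make the
  columns \<open>0, ..., k - 1\<close> and \<open>b\<close> independent, one more than the rank
  allows: in the first \<open>k\<close> rows they form an identity matrix followed by a zero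
  column.\<close>

lemma local_representation_vanishing:
  fixes M :: "'a dspace" and N :: "'b dspace"
  assumes MN: "diffeological_space M" "diffeological_space N" and f: "smooth M N f"
    and rank: "constant_internal_rank M N f k"
    and rep: "local_representation m n M N f U \<phi> V \<psi> F" and u: "u \<in> U" and k: "k \<le> m" "k \<le> n"
    and Fk: "\<And>x i. x \<in> U \<Longrightarrow> i < k \<Longrightarrow> F x i = x i" and b: "k \<le> b" "b < m" and a: "k \<le> a" "a < n"
  shows "partial_deriv b (\<lambda>x. F x a) u = 0"
proof (rule ccontr)
  assume nz: "partial_deriv b (\<lambda>x. F x a) u \<noteq> 0"
  define B where "B = insert b {..<k}"
  have B: "B \<subseteq> {..<m}"
    using b k by (auto simp: B_def)
  have "card B \<le> k"
  proof (rule local_representation_rank(2)[OF MN f rank rep u B])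
    fix c b' assume c: "\<And>i. i < n \<Longrightarrow> (\<Sum>b\<in>B. c b * partial_deriv b (\<lambda>x. F x i) u) = 0" and b': "b' \<in> B"
    \<comment> \<open>Row \<open>i\<close> of the relation reads off the coefficient
      \<open>c i\<close>; column \<open>b\<close> contributes nothing since
      \<open>i < k \<le> b\<close>.\<close>
    have low: "c i = 0" if i: "i < k" for i
    proof -
      have "(\<Sum>b\<in>B. c b * partial_deriv b (\<lambda>x. F x i) u) = (\<Sum>b\<in>B. if b = i then c i else 0)"
        by (rule sum.cong) (use B local_representation_partials[OF rep u Fk i] in \<open>auto simp: subset_iff\<close>)
      also have "\<dots> = c i"
        using i by (simp add: B_def sum.delta)
      finally show ?thesis
        using c[of i] i k by simp
    qed
    \<comment> \<open>With the other coefficients gone, row \<open>a\<close> leaves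
      \<open>c b\<close> times the nonzero entry.\<close>
    have "(\<Sum>b\<in>B. c b * partial_deriv b (\<lambda>x. F x a) u) = c b * partial_deriv b (\<lambda>x. F x a) u"
      using b low by (simp add: B_def)
    with c[OF a(2)] nz have "c b = 0"
      by simp
    with low b' show "c b' = 0"
      by (auto simp: B_def)
  qed
  moreover have "card B = Suc k"
    using b by (simp add: B_def)
  ultimately show False
    by simp
qed

text \<open>The bounds on \<open>k\<close> belong to the conclusion because the normal form
  presupposes them: it keeps \<open>k\<close> of the \<open>m\<close> source coordinates and places
  them among the \<open>n\<close> target coordinates.\<close>

theorem theorem6p11:
  fixes M :: "'a dspace" and N :: "'b dspace" and f :: "'a \<Rightarrow> 'b" and m n k :: nat and x :: 'a
  assumes "diffeological_etale_manifold m M"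
    and "diffeological_etale_manifold n N"
    and "smooth M N f"
    and "constant_internal_rank M N f k"
    and "x \<in> points M"
  shows "k \<le> m \<and> k \<le> n \<and>
    (\<exists>U V \<phi> \<psi> F.
       openin (Euclidean_space m) U \<and> openin (Euclidean_space n) V \<and>
       diffeological_etale (domain_space m U) M \<phi> \<and>
       diffeological_etale (domain_space n V) N \<psi> \<and>
       x \<in> \<phi> ` U \<and> f x \<in> \<psi> ` V \<and>
       F \<in> U \<rightarrow> V \<and>
       (\<forall>u\<in>U. F u = (\<lambda>i. if i < k then u i else 0)) \<and>
       (\<forall>u\<in>U. f (\<phi> u) = \<psi> (F u)))"
proof -
  have MN: "diffeological_space M" "diffeological_space N"
    using assms(1,2) by (simp_all add: diffeological_etale_manifold_def)
  note straight = local_representation_straight[OF assms order_refl]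
  have k: "k \<le> m" "k \<le> n"
    using straight[THEN conjunct1] straight[THEN conjunct2, THEN conjunct1] .
  from straight[THEN conjunct2, THEN conjunct2] obtain U \<phi> V \<psi> F u0 where rep: "local_representation m n M N f U \<phi> V \<psi> F"
    and u0: "u0 \<in> U" "\<phi> u0 = x" and Fk: "\<forall>x\<in>U. \<forall>i<k. F x i = x i"
    by (elim exE conjE) (rule that)
  have Fk': "F x i = x i" if "x \<in> U" "i < k" for x i
    using Fk that by simp
  \<comment> \<open>Needed at all points of \<open>U\<close>, whereas the straightening used the
    rank at \<open>x\<close> only.\<close>
  have zero: "partial_deriv b (\<lambda>x. F x i) u = 0"
    if b: "k \<le> b" "b < m" and u: "u \<in> U" and i: "k \<le> i" "i < n" for b u i
  proof (rule local_representation_vanishing[OF MN assms(3,4) rep u k _ b i])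
    show "F x i = x i" if "x \<in> U" "i < k" for x i
      using that by (rule Fk')
  qed
  obtain U' V' \<psi>' where u0': "u0 \<in> U'" and \<phi>: "lifting_chart m U' M \<phi>" and \<psi>': "lifting_chart n V' N \<psi>'"
    and V': "\<And>u. u \<in> U' \<Longrightarrow> (\<lambda>i. if i < k then u i else 0) \<in> V'"
    and eq: "\<And>u. u \<in> U' \<Longrightarrow> f (\<phi> u) = \<psi>' (\<lambda>i. if i < k then u i else 0)"
    by (rule local_representation_normal_form[OF rep u0(1) k Fk' zero]) (assumption+, rule that)
  show ?thesis
  proof (intro conjI exI)
    show "k \<le> m" "k \<le> n"
      by (rule k)+
    show "openE m U'" "openE n V'"
      using \<phi> \<psi>' by (auto intro: lifting_chartD(1))
    show "diffeological_etale (domain_space m U') M \<phi>"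
      by (rule lifting_chart_imp_etale[OF MN(1) \<phi>])
    show "diffeological_etale (domain_space n V') N \<psi>'"
      by (rule lifting_chart_imp_etale[OF MN(2) \<psi>'])
    show "x \<in> \<phi> ` U'"
      using u0' u0(2) by blast
    show "f x \<in> \<psi>' ` V'"
      using eq[OF u0'] V'[OF u0'] u0(2) by simp
    show "(\<lambda>u i. if i < k then u i else 0) \<in> U' \<rightarrow> V'"
      using V' by (rule funcsetI)
    show "\<forall>u\<in>U'. (\<lambda>i. if i < k then u i else 0) = (\<lambda>i. if i < k then u i else 0)"
      by simp
    show "\<forall>u\<in>U'. f (\<phi> u) = \<psi>' (\<lambda>i. if i < k then u i else 0)"
      using eq by (rule ballI)
  qed
qed



end
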